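(* Let $G$ be a hypergraph and let $G_1,\dots,G_c$ be its connected components. Then $$j(I(G))=j(I(G_1))\cdots j(I(G_c)).$$
   Context: A hypergraph $G$ has a finite non-empty node set $V(G)=\{x_1,\dots,x_n\}$ and an edge set $E(G)$ consisting of finitely many non-empty subsets of $V(G)$. Fix a field $\Bbbk$ and view the nodes as indeterminates. The edge ideal of $G$ is the ideal $I(G)=(x_{i_1}\cdots x_{i_k} : \{x_{i_1},\dots,x_{i_k}\}\in E(G))$ of the local ring $R=\Bbbk[x_1,\dots,x_n]_{(x_1,\dots,x_n)}$; for a connected component $G_i$, the ideal $I(G_i)$ is taken in the analogous local ring built on the nodes $V(G_i)$ of $G_i$ only. $G$ is connected if for any two nodes $x_i,x_j$ there is a sequence of edges such that $x_i$ belongs to the first edge, $x_j$ belongs to the last edge, and consecutive edges have a common node; connected components are the maximal connected pieces (an isolated node forms its own component). For an ideal $I$ in a Noetherian local ring $(R,\mathfrak m)$ of dimension $n\ge1$, the $j$-multiplicity is $j(I)=(n-1)!\lim_{t\to\infty}\lambda_R(\Gamma_{\mathfrak m}(I^t/I^{t+1}))/t^{n-1}$, where $\lambda_R$ is length and $\Gamma_{\mathfrak m}$ is the zeroth local cohomology. *)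

theory Defs
  imports
    "HOL-Algebra.Module"
    "HOL-Algebra.Ideal_Product"
    "HOL-Library.Poly_Mapping"
    "HOL-Library.Extended_Nat"
    "HOL-Library.Extended_Real"
begin

section \<open>Hypergraphs\<close>

record 'v hypergraph =
  nodes :: "'v set"
  edges :: "'v set set"

definition is_hypergraph :: "'v hypergraph \<Rightarrow> bool" where
  "is_hypergraph G \<longleftrightarrow>
     finite (nodes G) \<and> nodes G \<noteq> {} \<and> (\<forall>e\<in>edges G. e \<noteq> {} \<and> e \<subseteq> nodes G)"

definition edge_path :: "'v hypergraph \<Rightarrow> 'v \<Rightarrow> 'v set list \<Rightarrow> 'v \<Rightarrow> bool" where
  "edge_path G x es y \<longleftrightarrow>
     es \<noteq> [] \<and> set es \<subseteq> edges G \<and> x \<in> hd es \<and> y \<in> last es \<and>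
     (\<forall>i. Suc i < length es \<longrightarrow> es ! i \<inter> es ! Suc i \<noteq> {})"

text \<open>Only distinct nodes have to be joined, so that a single node without edges is connected.\<close>

definition connected_hypergraph :: "'v hypergraph \<Rightarrow> bool" where
  "connected_hypergraph G \<longleftrightarrow>
     (\<forall>x\<in>nodes G. \<forall>y\<in>nodes G. x \<noteq> y \<longrightarrow> (\<exists>es. edge_path G x es y))"

definition subhypergraph :: "'v hypergraph \<Rightarrow> 'v hypergraph \<Rightarrow> bool" where
  "subhypergraph H G \<longleftrightarrow>
     is_hypergraph H \<and> nodes H \<subseteq> nodes G \<and> edges H \<subseteq> edges G"

definition connected_components :: "'v hypergraph \<Rightarrow> 'v hypergraph set" where
  "connected_components G =
     {H. subhypergraph H G \<and> connected_hypergraph H \<and>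
         (\<forall>H'. subhypergraph H' G \<and> connected_hypergraph H' \<and> subhypergraph H H' \<longrightarrow> H' = H)}"


section \<open>Localization of a commutative ring\<close>

text \<open>Fractions \<open>a / s\<close> with \<open>s\<close> in a multiplicative set \<open>S\<close>, as classes of pairs \<open>(a, s)\<close>.\<close>

definition frac_rel :: "('a, 'm) ring_scheme \<Rightarrow> 'a set \<Rightarrow> (('a \<times> 'a) \<times> ('a \<times> 'a)) set" where
  "frac_rel A S =
     {((a, s), (b, t)). a \<in> carrier A \<and> s \<in> S \<and> b \<in> carrier A \<and> t \<in> S \<and>
        (\<exists>u\<in>S. u \<otimes>\<^bsub>A\<^esub> (t \<otimes>\<^bsub>A\<^esub> a) = u \<otimes>\<^bsub>A\<^esub> (s \<otimes>\<^bsub>A\<^esub> b))}"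

definition fraction :: "('a, 'm) ring_scheme \<Rightarrow> 'a set \<Rightarrow> 'a \<Rightarrow> 'a \<Rightarrow> ('a \<times> 'a) set" where
  "fraction A S a s = frac_rel A S `` {(a, s)}"

text \<open>The unions below range over representatives; all members of such a union coincide.\<close>

definition localization :: "('a, 'm) ring_scheme \<Rightarrow> 'a set \<Rightarrow> ('a \<times> 'a) set ring" where
  "localization A S =
     \<lparr> carrier = (carrier A \<times> S) // frac_rel A S,
       mult = (\<lambda>X Y. \<Union>(a, s)\<in>X. \<Union>(b, t)\<in>Y. fraction A S (a \<otimes>\<^bsub>A\<^esub> b) (s \<otimes>\<^bsub>A\<^esub> t)),
       one = fraction A S \<one>\<^bsub>A\<^esub> \<one>\<^bsub>A\<^esub>,
       zero = fraction A S \<zero>\<^bsub>A\<^esub> \<one>\<^bsub>A\<^esub>,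
       add = (\<lambda>X Y. \<Union>(a, s)\<in>X. \<Union>(b, t)\<in>Y.
                fraction A S (a \<otimes>\<^bsub>A\<^esub> t \<oplus>\<^bsub>A\<^esub> b \<otimes>\<^bsub>A\<^esub> s) (s \<otimes>\<^bsub>A\<^esub> t)) \<rparr>"


section \<open>Modules: quotients, zeroth local cohomology, length\<close>

text \<open>The components \<open>mult\<close> and \<open>one\<close> of a module record play no role in the locale
  \<open>module\<close>; they are left unspecified in quotients.\<close>

definition self_module :: "('a, 'm) ring_scheme \<Rightarrow> ('a, 'a) module" where
  "self_module R =
     \<lparr> carrier = carrier R, mult = mult R, one = \<one>\<^bsub>R\<^esub>, zero = \<zero>\<^bsub>R\<^esub>, add = add R, smult = mult R \<rparr>"

definition quotient_module :: "('a, 'b, 'm) module_scheme \<Rightarrow> 'b set \<Rightarrow> ('a, 'b set) module" where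
  "quotient_module M N =
     \<lparr> carrier = a_rcosets\<^bsub>M\<^esub> N, mult = undefined, one = undefined,
       zero = N, add = set_add M,
       smult = (\<lambda>a X. \<Union>x\<in>X. N +>\<^bsub>M\<^esub> (a \<odot>\<^bsub>M\<^esub> x)) \<rparr>"

primrec ideal_power :: "('a, 'm) ring_scheme \<Rightarrow> 'a set \<Rightarrow> nat \<Rightarrow> 'a set" where
  "ideal_power R I 0 = carrier R"
| "ideal_power R I (Suc t) = ideal_prod R I (ideal_power R I t)"

definition local_cohomology_zero ::
    "('a, 'm) ring_scheme \<Rightarrow> 'a set \<Rightarrow> ('a, 'b, 'n) module_scheme \<Rightarrow> ('a, 'b, 'n) module_scheme" where
  "local_cohomology_zero R J M =
     M \<lparr> carrier := {x \<in> carrier M. \<exists>k. \<forall>a\<in>ideal_power R J k. a \<odot>\<^bsub>M\<^esub> x = \<zero>\<^bsub>M\<^esub>} \<rparr>"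

definition module_length :: "('a, 'm) ring_scheme \<Rightarrow> ('a, 'b, 'n) module_scheme \<Rightarrow> enat" where
  "module_length R M =
     Sup {enat l | l. \<exists>C :: nat \<Rightarrow> 'b set.
       (\<forall>i\<le>l. submodule (C i) R M) \<and> (\<forall>i<l. C i \<subset> C (Suc i))}"


section \<open>The j-multiplicity of an ideal in a local ring\<close>

definition krull_dim :: "('a, 'm) ring_scheme \<Rightarrow> enat" where
  "krull_dim R =
     Sup {enat l | l. \<exists>P :: nat \<Rightarrow> 'a set.
       (\<forall>i\<le>l. primeideal (P i) R) \<and> (\<forall>i<l. P i \<subset> P (Suc i))}"

definition max_ideal :: "('a, 'm) ring_scheme \<Rightarrow> 'a set" where
  "max_ideal R = (THE M. maximalideal M R)"

definition power_quotient :: "('a, 'm) ring_scheme \<Rightarrow> 'a set \<Rightarrow> nat \<Rightarrow> ('a, 'a set) module" where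
  "power_quotient R I t =
     quotient_module ((self_module R) \<lparr> carrier := ideal_power R I t \<rparr>) (ideal_power R I (Suc t))"

text \<open>Meaningful for an ideal \<open>I\<close> of a Noetherian local ring \<open>R\<close> of dimension at least one;
  the limit is taken in the extended reals because \<open>module_length\<close> takes values in \<open>enat\<close>.\<close>

definition j_multiplicity :: "('a, 'm) ring_scheme \<Rightarrow> 'a set \<Rightarrow> ereal" where
  "j_multiplicity R I =
     (let n = the_enat (krull_dim R) in
        ereal (fact (n - 1)) *
        lim (\<lambda>t. ereal_of_enat
                   (module_length R (local_cohomology_zero R (max_ideal R) (power_quotient R I t)))
                 / ereal (real t ^ (n - 1))))"


section \<open>Edge ideals\<close>

text \<open>Polynomials with coefficients in \<open>'k\<close> and indeterminates in \<open>'v\<close> are finitely supported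
  functions from exponent vectors to coefficients.\<close>

type_synonym ('v, 'k) mpoly_rep = "('v \<Rightarrow>\<^sub>0 nat) \<Rightarrow>\<^sub>0 'k"

definition indet :: "'v \<Rightarrow> ('v, 'k::field) mpoly_rep" where
  "indet v = Poly_Mapping.single (Poly_Mapping.single v 1) 1"

definition polynomial_ring :: "'v set \<Rightarrow> ('v, 'k::field) mpoly_rep ring" where
  "polynomial_ring V =
     \<lparr> carrier = {p. \<forall>m\<in>Poly_Mapping.keys p. Poly_Mapping.keys m \<subseteq> V},
       mult = (*), one = 1, zero = 0, add = (+) \<rparr>"

definition outside_origin :: "'v set \<Rightarrow> ('v, 'k::field) mpoly_rep set" where
  "outside_origin V =
     carrier (polynomial_ring V) - genideal (polynomial_ring V) (indet ` V)"

text \<open>The local ring \<open>k[V]\<close> localized at the ideal \<open>(V)\<close>; the argument \<open>TYPE('k)\<close> fixes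
  the coefficient field.\<close>

definition local_ring ::
    "'k::field itself \<Rightarrow> 'v set \<Rightarrow> (('v, 'k) mpoly_rep \<times> ('v, 'k) mpoly_rep) set ring" where
  "local_ring _ V = localization (polynomial_ring V) (outside_origin V)"

definition edge_ideal ::
    "'k::field itself \<Rightarrow> 'v hypergraph \<Rightarrow> (('v, 'k) mpoly_rep \<times> ('v, 'k) mpoly_rep) set set" where
  "edge_ideal K G =
     genideal (local_ring K (nodes G))
       ((\<lambda>e. fraction (polynomial_ring (nodes G)) (outside_origin (nodes G)) (\<Prod>v\<in>e. indet v) 1)
          ` edges G)"

end

(*
  For monomial ideals the length of the torsion of I^t/I^(t+1) is the number of monomials w in
  I^t - I^(t+1) such that, for every node v, some w v^k lies in I^(t+1). This number is eventually
  a polynomial in t: Dickson's lemma reduces a difference of monomial ideals to finitely many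
  slices in one variable less. Its degree is at most n - 1, since the monomials counted for
  different t are distinct and have exponents at most t. Hence the limit defining j exists. If the
  nodes split into two parts with no common edge, the order of w with respect to I is the sum of
  the orders of its two factors, so the counting function is the convolution of those of the parts,
  and the leading coefficients of a convolution multiply by the Vandermonde identity.

  The dimension of the local ring is bounded by n because elements in the successive differences
  of a chain of primes are algebraically independent, while the number of monomials of bounded
  degree in n variables grows like the n-th power of the bound.
*)

theory Submission
  imports Defs "HOL-Computational_Algebra.Polynomial" "HOL-Computational_Algebra.Primes"
begin

text \<open>For a fixed t the torsion monomials form a difference of two monomial ideals in the
  nodes, but both ideals move with t, so Dickson's lemma does not apply to them directly. One extra
  variable per edge, as in a presentation of the Rees algebra, turns t into a degree and gathers all
  t into one pair of ideals. Edge variables have degree one and node variables degree zero; hence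
  the count is a polynomial and not only a quasi-polynomial, while its levels are finite only
  because the torsion is.

  Existence of the limits matters: \<open>lim\<close> is total, so without it the value for a union
  would say nothing about the parts. A limit may be 0, as for an isolated node, so the coefficient
  at n - 1 is meant whatever the degree, and convolutions are treated by averaging instead of by
  leading terms of exact degree.

  Localization does no harm because denominators have a non-zero constant term: a monomial ideal of
  the polynomial ring contains b as soon as it contains s b. Membership can thus be read off the
  exponents of a numerator.\<close>

abbreviation "lookup \<equiv> Poly_Mapping.lookup"
abbreviation "keys \<equiv> Poly_Mapping.keys"
abbreviation "single \<equiv> Poly_Mapping.single"

section \<open>Eventually polynomial counting functions\<close>

text \<open>Real coefficients, because Hilbert polynomials such as binomials have
  denominators.\<close>

definition eventually_poly :: "(nat \<Rightarrow> nat) \<Rightarrow> bool" where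
  "eventually_poly f \<longleftrightarrow>
     (\<exists>p::real poly. \<forall>\<^sub>F t in sequentially. real (f t) = poly p (real t))"

lemma eventually_poly_cong:
  assumes "eventually_poly f" "\<forall>\<^sub>F t in sequentially. g t = f t"
  shows "eventually_poly g"
proof -
  obtain p :: "real poly" where
    "\<forall>\<^sub>F t in sequentially. real (f t) = poly p (real t)"
    using assms unfolding eventually_poly_def by blast
  with assms(2) have "\<forall>\<^sub>F t in sequentially. real (g t) = poly p (real t)"
    by eventually_elim simp
  then show ?thesis unfolding eventually_poly_def by blast
qed

lemma eventually_poly_zero: "eventually_poly (\<lambda>t. 0)"
  unfolding eventually_poly_def by (intro exI[of _ 0]) simp

lemma eventually_poly_add:
  assumes "eventually_poly f" "eventually_poly g"
  shows "eventually_poly (\<lambda>t. f t + g t)"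
proof -
  obtain p q :: "real poly" where
    p: "\<forall>\<^sub>F t in sequentially. real (f t) = poly p (real t)" and
    q: "\<forall>\<^sub>F t in sequentially. real (g t) = poly q (real t)"
    using assms unfolding eventually_poly_def by blast
  from p q have "\<forall>\<^sub>F t in sequentially. real (f t + g t) = poly (p + q) (real t)"
    by eventually_elim simp
  then show ?thesis unfolding eventually_poly_def by blast
qed

lemma eventually_poly_sum:
  assumes "finite A" "\<And>j. j \<in> A \<Longrightarrow> eventually_poly (f j)"
  shows "eventually_poly (\<lambda>t. \<Sum>j\<in>A. f j t)"
  using assms by (induction A) (auto intro: eventually_poly_zero eventually_poly_add)

text \<open>Serves the slices at exponent j of a variable of degree one, which reach level t from
  level t - j. The guard keeps truncated subtraction out of the count.\<close>

lemma eventually_poly_shift: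
  assumes "eventually_poly f"
  shows "eventually_poly (\<lambda>t. if j \<le> t then f (t - j) else 0)"
proof -
  obtain p :: "real poly" where
    p: "\<forall>\<^sub>F t in sequentially. real (f t) = poly p (real t)"
    using assms unfolding eventually_poly_def by blast
  then obtain N where N: "\<And>t. t \<ge> N \<Longrightarrow> real (f t) = poly p (real t)"
    unfolding eventually_sequentially by blast
  have "\<forall>\<^sub>F t in sequentially. real (if j \<le> t then f (t - j) else 0)
      = poly (pcompose p [:- real j, 1:]) (real t)"
    using eventually_ge_at_top[of "N + j"]
  proof eventually_elim
    case (elim t)
    then show ?case using N[of "t - j"] by (simp add: poly_pcompose of_nat_diff)
  qed
  then show ?thesis unfolding eventually_poly_def by blast
qed

text \<open>Telescoping (s+1)^(k+1) - s^(k+1) expresses t^(k+1) through the power sums up to order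
  k, and the sum of order k can be solved for. All lower orders enter, hence the strong
  induction.\<close>

lemma power_sum_poly: "\<exists>q::real poly. \<forall>t::nat. (\<Sum>s<t. real s ^ k) = poly q (real t)"
proof (induction k rule: less_induct)
  case (less k)
  then obtain q :: "nat \<Rightarrow> real poly" where
    q: "\<And>j t. j < k \<Longrightarrow> (\<Sum>s<t. real s ^ j) = poly (q j) (real t)" by metis
  define r where "r = smult (1 / real (Suc k))
      (monom 1 (Suc k) - (\<Sum>j<k. smult (real (Suc k choose j)) (q j)))"
  have "(\<Sum>s<t. real s ^ k) = poly r (real t)" for t
  proof -
    have step: "real (Suc s) ^ Suc k - real s ^ Suc k
        = real (Suc k) * real s ^ k + (\<Sum>j<k. real (Suc k choose j) * real s ^ j)" for s
    proof -
      have "real (Suc s) ^ Suc k = (\<Sum>j\<le>Suc k. real (Suc k choose j) * real s ^ j)"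
        using binomial_ring[of "real s" 1 "Suc k"] by (simp add: add.commute)
      also have "\<dots> = real s ^ Suc k + (real (Suc k) * real s ^ k
          + (\<Sum>j<k. real (Suc k choose j) * real s ^ j))"
        by (simp only: sum.atMost_Suc lessThan_Suc_atMost[symmetric] sum.lessThan_Suc
            binomial_n_n binomial_Suc_n)
      finally show ?thesis by simp
    qed
    have "real t ^ Suc k = (\<Sum>s<t. real (Suc s) ^ Suc k - real s ^ Suc k)"
      by (subst sum_lessThan_telescope) simp
    also have "\<dots> = real (Suc k) * (\<Sum>s<t. real s ^ k)
        + (\<Sum>j<k. real (Suc k choose j) * (\<Sum>s<t. real s ^ j))"
      unfolding step sum.distrib sum_distrib_left
      by (intro arg_cong2[of _ _ _ _ "(+)"] refl sum.swap)
    also have "(\<Sum>j<k. real (Suc k choose j) * (\<Sum>s<t. real s ^ j))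
        = (\<Sum>j<k. real (Suc k choose j) * poly (q j) (real t))"
      using q by (intro sum.cong) auto
    finally show ?thesis
      unfolding r_def by (simp add: poly_sum poly_monom field_simps del: of_nat_Suc)
  qed
  then show ?case by blast
qed

lemma poly_antidifference: "\<exists>q::real poly. \<forall>t::nat. (\<Sum>s<t. poly p (real s)) = poly q (real t)"
proof -
  obtain q :: "nat \<Rightarrow> real poly" where
    q: "\<And>k t. (\<Sum>s<t. real s ^ k) = poly (q k) (real t)" using power_sum_poly by metis
  have "(\<Sum>s<t. poly p (real s)) = poly (\<Sum>k\<le>degree p. smult (coeff p k) (q k)) (real t)" for t
    unfolding poly_altdef[of p]
    by (subst sum.swap) (simp add: poly_sum q[symmetric] sum_distrib_left)
  then show ?thesis by blast
qed

lemma eventually_poly_partial_sums: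
  assumes "eventually_poly f"
  shows "eventually_poly (\<lambda>t. \<Sum>s\<le>t. f s)"
proof -
  obtain p :: "real poly" and N where
    N: "\<And>t. t \<ge> N \<Longrightarrow> real (f t) = poly p (real t)"
    using assms unfolding eventually_poly_def eventually_sequentially by blast
  obtain q :: "real poly" where q: "\<And>t. (\<Sum>s<t. poly p (real s)) = poly q (real t)"
    using poly_antidifference by metis
  \<comment> \<open>\<open>c\<close> repairs the terms before \<open>N\<close>, where
    \<open>f\<close> need not agree with \<open>p\<close>. Composing with \<open>[:1, 1:]\<close>
    below turns the sum over s < t + 1 into the sum over s <= t.\<close>
  define c where "c = (\<Sum>s<N. real (f s)) - poly q (real N)"
  have "\<forall>\<^sub>F t in sequentially. real (\<Sum>s\<le>t. f s) = poly (pcompose q [:1, 1:] + [:c:]) (real t)"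
    using eventually_ge_at_top[of N]
  proof eventually_elim
    case (elim t)
    have split: "(\<Sum>s<Suc t. g s) = (\<Sum>s<N. g s) + (\<Sum>s=N..<Suc t. g s)" for g :: "nat \<Rightarrow> real"
      using elim by (metis atLeast0LessThan le_SucI sum.atLeastLessThan_concat zero_le)
    have "real (\<Sum>s\<le>t. f s) = (\<Sum>s<N. real (f s)) + (\<Sum>s=N..<Suc t. real (f s))"
      using split[of "\<lambda>s. real (f s)"] by (simp add: lessThan_Suc_atMost)
    also have "(\<Sum>s=N..<Suc t. real (f s)) = (\<Sum>s=N..<Suc t. poly p (real s))"
      using N by (intro sum.cong) auto
    also have "\<dots> = poly q (real (Suc t)) - poly q (real N)"
      using split[of "\<lambda>s. poly p (real s)"] q by (simp del: of_nat_Suc sum.lessThan_Suc)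
    finally show ?case by (simp add: c_def poly_pcompose add.commute)
  qed
  then show ?thesis unfolding eventually_poly_def by blast
qed

section \<open>Hilbert functions of differences of monomial ideals\<close>

text \<open>Exponent vectors of monomials in the variables \<open>I\<close>. Total functions
  vanishing off \<open>I\<close> let \<open>fun_upd\<close> remove a variable or put it back without
  a change of type.\<close>

definition supported :: "'i set \<Rightarrow> ('i \<Rightarrow> nat) set" where
  "supported I = {a. \<forall>i. i \<notin> I \<longrightarrow> a i = 0}"

text \<open>The exponent sets of monomial ideals in the variables \<open>I\<close>.\<close>

definition up_closed :: "'i set \<Rightarrow> ('i \<Rightarrow> nat) set \<Rightarrow> bool" where
  "up_closed I S \<longleftrightarrow> S \<subseteq> supported I \<and> (\<forall>a\<in>S. \<forall>b\<in>supported I. a \<le> b \<longrightarrow> b \<in> S)"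

section \<open>Dickson's lemma and ascending chains of monomial ideals\<close>

lemma incseq_subsequence:
  fixes f :: "nat \<Rightarrow> nat"
  shows "\<exists>r. strict_mono r \<and> incseq (f \<circ> r)"
proof -
  obtain g :: "nat \<Rightarrow> nat" where g: "strict_mono g" "monoseq (\<lambda>n. f (g n))"
    using seq_monosub by blast
  show ?thesis
  proof (cases "incseq (\<lambda>n. f (g n))")
    case True
    then show ?thesis using g by (auto simp: o_def)
  next
    case False
    then have dec: "decseq (\<lambda>n. f (g n))" using g by (simp add: monoseq_iff)
    \<comment> \<open>A non-increasing sequence of naturals is constant once it has reached its
      least value.\<close>
    obtain n where n: "\<And>m. f (g n) \<le> f (g m)"
      using ex_has_least_nat[of "\<lambda>_. True" undefined "\<lambda>n. f (g n)"] by auto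
    have "f (g (m + n)) = f (g n)" for m
      using n[of "m + n"] decseqD[OF dec, of n "m + n"] by simp
    then have "incseq (f \<circ> (\<lambda>m. g (m + n)))" by (simp add: incseq_def)
    moreover have "strict_mono (\<lambda>m. g (m + n))"
      using g(1) by (simp add: strict_mono_def)
    ultimately show ?thesis by blast
  qed
qed

text \<open>Refine the subsequence one coordinate at a time; a coordinate that is already monotone
  stays so under refinement.\<close>

lemma dickson_subsequence:
  fixes f :: "nat \<Rightarrow> 'i \<Rightarrow> nat"
  assumes "finite I"
  shows "\<exists>r. strict_mono r \<and> (\<forall>i\<in>I. incseq (\<lambda>n. f (r n) i))"
  using assms
proof (induction I)
  case empty
  then show ?case by (intro exI[of _ id]) (simp add: strict_mono_def)
next
  case (insert i I)
  then obtain r where r: "strict_mono r" "\<And>i. i \<in> I \<Longrightarrow> incseq (\<lambda>n. f (r n) i)" by blast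
  obtain g where g: "strict_mono g" "incseq ((\<lambda>n. f (r n) i) \<circ> g)"
    using incseq_subsequence by blast
  have "incseq (\<lambda>n. f (r (g n)) j)" if "j \<in> insert i I" for j
    using that g(2) r(2)[of j] strict_mono_leD[OF g(1)]
    by (cases "j = i") (auto simp: incseq_def o_def)
  moreover have "strict_mono (\<lambda>n. r (g n))"
    using r(1) g(1) by (simp add: strict_mono_def)
  ultimately show ?case by blast
qed

text \<open>Were the chain never stable, each \<open>T m\<close> would miss some \<open>a m\<close>
  of the union. In a subsequence increasing in every coordinate the first term lies in some
  \<open>T m\<close>, which then contains the later term \<open>a (r m)\<close>; but this one lies
  outside \<open>T (r m)\<close>, which includes \<open>T m\<close>.\<close>

lemma up_closed_chain_stable:
  assumes "finite I" "\<And>j. up_closed I (T j)" "incseq T"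
  shows "\<exists>m. \<forall>j\<ge>m. T j = T m"
proof (rule ccontr)
  assume "\<nexists>m. \<forall>j\<ge>m. T j = T m"
  then have "\<forall>m. \<exists>a. a \<in> (\<Union>j. T j) - T m"
    using incseqD[OF assms(3)] by (metis DiffI UNIV_I UN_I subsetI subset_antisym)
  then obtain a where a: "\<And>m. a m \<in> (\<Union>j. T j) - T m" by metis
  obtain r where r: "strict_mono r" "\<And>i. i \<in> I \<Longrightarrow> incseq (\<lambda>n. a (r n) i)"
    using dickson_subsequence[OF assms(1)] by metis
  obtain m where m: "a (r 0) \<in> T m" using a[of "r 0"] by blast
  have rm: "m \<le> r m" by (rule strict_mono_imp_increasing[OF r(1)])
  have supp: "a k \<in> supported I" for k using a[of k] assms(2) by (auto simp: up_closed_def)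
  have "a (r 0) \<le> a (r m)"
    using r(2) supp by (auto simp: le_fun_def incseq_def supported_def) (metis zero_le)
  then have "a (r m) \<in> T m" using m assms(2)[of m] supp by (auto simp: up_closed_def)
  then show False using a[of "r m"] incseqD[OF assms(3) rm] by blast
qed

text \<open>Only the variables in \<open>W\<close> carry degree one. The others have degree zero, so
  a level can be infinite.\<close>

definition level :: "'i set \<Rightarrow> ('i \<Rightarrow> nat) set \<Rightarrow> nat \<Rightarrow> ('i \<Rightarrow> nat) set" where
  "level W S t = {a\<in>S. sum a W = t}"

text \<open>Induction on the variables. Fixing the exponent j of i cuts out a monomial ideal in the
  other variables, which grows with j and so is constant from some m on. If i is in
  \<open>W\<close>, the slices from m on contribute partial sums of a single counting function; if
  not, finiteness of the levels leaves only the slices below m.\<close>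

lemma eventually_poly_level:
  assumes "finite I" "up_closed I S" "up_closed I S'" "W \<subseteq> I" "\<And>t. finite (level W (S - S') t)"
  shows "eventually_poly (\<lambda>t. card (level W (S - S') t))"
  using assms
proof (induction I arbitrary: S S' W)
  case empty
  then have "W = {}" by simp
  then have "level W (S - S') t = {}" if "t > 0" for t using that by (simp add: level_def)
  then have "\<forall>\<^sub>F t in sequentially. card (level W (S - S') t) = 0"
    by (intro eventually_mono[OF eventually_gt_at_top[of 0]]) simp
  then show ?case by (rule eventually_poly_cong[OF eventually_poly_zero])
next
  case (insert i I)
  define sl where "sl S j = {a\<in>supported I. a(i := j) \<in> S}" for S :: "('a \<Rightarrow> nat) set" and j
  have sl_up: "up_closed I (sl S j)" if "up_closed (insert i I) S" for S j
    unfolding up_closed_def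
  proof (intro conjI ballI impI)
    show "sl S j \<subseteq> supported I" by (auto simp: sl_def)
    fix a b assume ab: "a \<in> sl S j" "b \<in> supported I" "a \<le> b"
    have "b(i := j) \<in> supported (insert i I)" "a(i := j) \<le> b(i := j)"
      using ab by (auto simp: supported_def le_fun_def)
    then show "b \<in> sl S j" using ab that by (auto simp: sl_def up_closed_def)
  qed
  have sl_inc: "incseq (sl S)" if "up_closed (insert i I) S" for S
    unfolding incseq_def
  proof (intro allI impI subsetI)
    fix j k :: nat and a assume jk: "j \<le> k" and a: "a \<in> sl S j"
    have "a(i := k) \<in> supported (insert i I)" "a(i := j) \<le> a(i := k)"
      using a jk by (auto simp: supported_def le_fun_def sl_def)
    then show "a \<in> sl S k" using a that by (auto simp: sl_def up_closed_def)
  qed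
  obtain m1 where m1: "\<And>j. j \<ge> m1 \<Longrightarrow> sl S j = sl S m1"
    using up_closed_chain_stable[OF insert.hyps(1) sl_up sl_inc, OF insert.prems(1) insert.prems(1)]
    by metis
  obtain m2 where m2: "\<And>j. j \<ge> m2 \<Longrightarrow> sl S' j = sl S' m2"
    using up_closed_chain_stable[OF insert.hyps(1) sl_up sl_inc, OF insert.prems(2) insert.prems(2)]
    by metis
  define m where "m = max m1 m2"
  define D where "D j t = level (W - {i}) (sl S j - sl S' j) t" for j t
  have stable: "D j = D m" if "j \<ge> m" for j
    using m1[of j] m1[of m] m2[of j] m2[of m] that by (auto simp: D_def m_def fun_eq_iff)
  have finW: "finite W" using insert.prems(3) insert.hyps(1) by (meson finite.insertI finite_subset)
  have sum_upd: "sum (a(i := j)) W = sum a (W - {i}) + (if i \<in> W then j else 0)" for a j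
  proof -
    have "sum (a(i := j)) (W - {i}) = sum a (W - {i})" by (intro sum.cong) auto
    then show ?thesis
      using sum.remove[OF finW, of i "a(i := j)"] by (cases "i \<in> W") (auto simp: add.commute)
  qed
  have in_D: "a \<in> D j t \<longleftrightarrow> a \<in> supported I \<and>
      a(i := j) \<in> level W (S - S') (t + (if i \<in> W then j else 0))" for a j t
    using sum_upd[of a j] by (auto simp: D_def level_def sl_def)
  \<comment> \<open>Vectors supported on \<open>I\<close> vanish at i, so the exponent j and the
    vector can both be recovered.\<close>
  have inj: "inj_on (\<lambda>(j, a). a(i := j)) (A \<times> supported I)" for A :: "nat set"
  proof (rule inj_onI, clarify)
    fix j a k b assume a: "a \<in> supported I" "b \<in> supported I" and eq: "a(i := j) = b(i := k)"
    have "a x = b x" for x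
      using a insert.hyps(2) fun_cong[OF eq, of x] by (cases "x = i") (auto simp: supported_def)
    then show "j = k \<and> a = b" using fun_cong[OF eq, of i] by auto
  qed
  have finD: "finite (D j t)" for j t
  proof -
    have "(\<lambda>a. a(i := j)) ` D j t \<subseteq> level W (S - S') (t + (if i \<in> W then j else 0))"
      using in_D by blast
    moreover have "inj_on (\<lambda>a. a(i := j)) (D j t)"
      using inj[of "{j}"] in_D by (auto simp: inj_on_def)
    ultimately show ?thesis using insert.prems(4) by (meson finite_imageD finite_subset)
  qed
  have polyD: "eventually_poly (\<lambda>t. card (D j t))" for j
    unfolding D_def
    by (rule insert.IH) (use sl_up insert.prems finD[unfolded D_def] in auto)
  have drop: "a(i := 0) \<in> supported I" if "a \<in> S" for a
    using that insert.prems(1) by (auto simp: up_closed_def supported_def)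
  show ?case
  proof (cases "i \<in> W")
    case True
    have lev: "level W (S - S') t = (\<lambda>(j, a). a(i := j)) ` (SIGMA j:{..t}. D j (t - j))" for t
    proof (intro equalityI subsetI)
      fix a assume a: "a \<in> level W (S - S') t"
      have "a i \<le> t" using a True finW by (auto simp: level_def intro: member_le_sum)
      moreover have "a(i := 0) \<in> D (a i) (t - a i)"
        using a drop[of a] \<open>a i \<le> t\<close> True by (auto simp: in_D level_def)
      ultimately show "a \<in> (\<lambda>(j, a). a(i := j)) ` (SIGMA j:{..t}. D j (t - j))"
        by (intro image_eqI[of _ _ "(a i, a(i := 0))"]) auto
    next
      fix a assume "a \<in> (\<lambda>(j, a). a(i := j)) ` (SIGMA j:{..t}. D j (t - j))"
      then show "a \<in> level W (S - S') t" using True by (auto simp: in_D)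
    qed
    have card: "card (level W (S - S') t) = (\<Sum>j\<le>t. card (D j (t - j)))" for t
      unfolding lev
      by (subst card_image, rule inj_on_subset[OF inj[of UNIV]]) (auto simp: in_D finD)
    have eq: "(\<Sum>j\<le>t. card (D j (t - j)))
        = (\<Sum>j<m. card (D j (t - j))) + (\<Sum>s\<le>t - m. card (D m s))" if "m \<le> t" for t
    proof -
      have "{..t} = {..<m} \<union> {m..t}" using that by auto
      then have "(\<Sum>j\<le>t. card (D j (t - j)))
        = (\<Sum>j<m. card (D j (t - j))) + (\<Sum>j=m..t. card (D j (t - j)))"
        by (simp add: sum.union_disjoint ivl_disj_int)
      also have "(\<Sum>j=m..t. card (D j (t - j))) = (\<Sum>j=m..t. card (D m (t - j)))"
        by (intro sum.cong refl) (metis atLeastAtMost_iff stable)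
      also have "\<dots> = (\<Sum>s\<le>t - m. card (D m s))"
        by (rule sum.reindex_bij_witness[of _ "\<lambda>s. t - s" "\<lambda>j. t - j"])
          (use that in auto)
      finally show ?thesis .
    qed
    have "eventually_poly (\<lambda>t. (\<Sum>j<m. if j \<le> t then card (D j (t - j)) else 0)
        + (if m \<le> t then \<Sum>s\<le>t - m. card (D m s) else 0))"
    proof (rule eventually_poly_add)
      show "eventually_poly (\<lambda>t. \<Sum>j<m. if j \<le> t then card (D j (t - j)) else 0)"
        using eventually_poly_shift[OF polyD] by (intro eventually_poly_sum) auto
      show "eventually_poly (\<lambda>t. if m \<le> t then \<Sum>s\<le>t - m. card (D m s) else 0)"
        by (rule eventually_poly_shift[OF eventually_poly_partial_sums[OF polyD]])
    qed
    then show ?thesis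
    proof (rule eventually_poly_cong)
      show "\<forall>\<^sub>F t in sequentially. card (level W (S - S') t)
          = (\<Sum>j<m. if j \<le> t then card (D j (t - j)) else 0)
            + (if m \<le> t then \<Sum>s\<le>t - m. card (D m s) else 0)"
        using eventually_ge_at_top[of m] by eventually_elim (simp add: card eq)
    qed
  next
    case False
    \<comment> \<open>From m on all slices agree, so the exponent of i could be changed to any j >=
      m without leaving the level, which would then be infinite.\<close>
    have small: "a i < m" if a: "a \<in> level W (S - S') t" for a t
    proof (rule ccontr)
      assume "\<not> a i < m"
      then have "D (a i) = D j" if "j \<ge> m" for j using stable that by (metis not_le)
      moreover have "a(i := 0) \<in> D (a i) t"
        using a drop[of a] False by (auto simp: in_D level_def)
      ultimately have "a(i := j) \<in> level W (S - S') t" if "j \<ge> m" for j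
        using that False by (auto simp: in_D)
      then have "(\<lambda>j. a(i := j)) ` {m..} \<subseteq> level W (S - S') t" by auto
      then have "finite ((\<lambda>j. a(i := j)) ` {m..})"
        using insert.prems(4) finite_subset by blast
      moreover have "inj_on (\<lambda>j. a(i := j)) {m..}"
        by (rule inj_onI) (metis fun_upd_same)
      ultimately show False using finite_imageD infinite_Ici by blast
    qed
    have lev: "level W (S - S') t = (\<lambda>(j, a). a(i := j)) ` (SIGMA j:{..<m}. D j t)" for t
    proof (intro equalityI subsetI)
      fix a assume a: "a \<in> level W (S - S') t"
      have "a(i := 0) \<in> D (a i) t"
        using a drop[of a] False by (auto simp: in_D level_def)
      then show "a \<in> (\<lambda>(j, a). a(i := j)) ` (SIGMA j:{..<m}. D j t)"
        using small[OF a] by (intro image_eqI[of _ _ "(a i, a(i := 0))"]) auto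
    next
      fix a assume "a \<in> (\<lambda>(j, a). a(i := j)) ` (SIGMA j:{..<m}. D j t)"
      then show "a \<in> level W (S - S') t" using False by (auto simp: in_D)
    qed
    have "card (level W (S - S') t) = (\<Sum>j<m. card (D j t))" for t
      unfolding lev
      by (subst card_image, rule inj_on_subset[OF inj[of UNIV]]) (auto simp: in_D finD)
    then show ?thesis by (simp add: eventually_poly_sum polyD)
  qed
qed

text \<open>Unique factorization, with one prime per variable. The key stands in for a monomial
  order: it is multiplicative, hence compatible with products of monomials, and its values are
  naturals, so least elements exist.\<close>

lemma monomial_key:
  assumes "finite I"
  obtains key :: "('i \<Rightarrow> nat) \<Rightarrow> nat"
  where "inj_on key (supported I)" "\<And>a b. key (\<lambda>i. a i + b i) = key a * key b" "\<And>a. key a > 0"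
proof -
  obtain f :: "nat \<Rightarrow> nat" where f: "inj f" "range f \<subseteq> {p. prime p}"
    using infinite_countable_subset[OF primes_infinite] by blast
  obtain g :: "'i \<Rightarrow> nat" where g: "inj_on g I"
    using finite_imp_inj_to_nat_seg[OF assms] by blast
  define p where "p = f \<circ> g"
  have pI: "inj_on p I" unfolding p_def using f(1) g by (auto intro: comp_inj_on inj_on_subset)
  have prime: "prime (p i)" for i using f(2) by (auto simp: p_def)
  define key where "key a = (\<Prod>i\<in>I. p i ^ a i)" for a
  have mult: "multiplicity (p i) (key a) = a i" if "i \<in> I" for i and a :: "'i \<Rightarrow> nat"
  proof -
    have "key a = (\<Prod>q\<in>p ` I. q ^ a (inv_into I p q))"
      unfolding key_def using pI by (subst prod.reindex) auto
    then show ?thesis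
      using multiplicity_prod_prime_powers[of "p ` I" "p i" "\<lambda>q. a (inv_into I p q)"] assms prime that pI
      by auto
  qed
  have "inj_on key (supported I)"
  proof (rule inj_onI, rule ext)
    fix a b i assume "a \<in> supported I" "b \<in> supported I" "key a = key b"
    then show "a i = b i" using mult[of i a] mult[of i b] by (cases "i \<in> I") (auto simp: supported_def)
  qed
  moreover have "key (\<lambda>i. a i + b i) = key a * key b" for a b
    by (simp add: key_def power_add prod.distrib)
  moreover have "key a > 0" for a
    unfolding key_def using prime by (intro prod_pos ballI zero_less_power prime_gt_0_nat)
  ultimately show ?thesis by (rule that)
qed

section \<open>Exponents of the monomials in the powers of an edge ideal\<close>

text \<open>Exponents of the monomials divisible by a product of t edges, in which e occurs
  \<open>a e\<close> times: the monomials of the t-th power of the edge ideal. Unlike the recursion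
  for \<open>ideal_power\<close>, this closed form can be restricted to a part of the edges.\<close>

definition edge_power :: "'v set set \<Rightarrow> nat \<Rightarrow> ('v \<Rightarrow> nat) set" where
  "edge_power E t = {w. \<exists>a. sum a E = t \<and> (\<forall>v. (\<Sum>e\<in>{e\<in>E. v \<in> e}. a e) \<le> w v)}"

lemma edge_power_mono: "w \<in> edge_power E t \<Longrightarrow> w \<le> w' \<Longrightarrow> w' \<in> edge_power E t"
  unfolding edge_power_def le_fun_def by (blast intro: order_trans)

lemma edge_power_0 [simp]: "edge_power E 0 = UNIV"
  unfolding edge_power_def by (auto intro: exI[of _ "\<lambda>_. 0"])

lemma edge_power_add:
  assumes "w \<in> edge_power E s" "x \<in> edge_power E t"
  shows "(\<lambda>v. w v + x v) \<in> edge_power E (s + t)"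
proof -
  obtain a b where "sum a E = s" "\<forall>v. (\<Sum>e\<in>{e\<in>E. v \<in> e}. a e) \<le> w v"
    "sum b E = t" "\<forall>v. (\<Sum>e\<in>{e\<in>E. v \<in> e}. b e) \<le> x v"
    using assms unfolding edge_power_def by blast
  then show ?thesis unfolding edge_power_def
    by (auto intro!: exI[of _ "\<lambda>e. a e + b e"] simp: sum.distrib add_mono)
qed

text \<open>Splitting off one edge of positive multiplicity matches the closed form with the
  recursion for \<open>ideal_power\<close>.\<close>

lemma edge_power_Suc:
  assumes "finite E"
  shows "w \<in> edge_power E (Suc t) \<longleftrightarrow>
    (\<exists>e\<in>E. \<exists>x\<in>edge_power E t. w = (\<lambda>v. x v + of_bool (v \<in> e)))"
proof
  assume "w \<in> edge_power E (Suc t)"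
  then obtain a where a: "sum a E = Suc t" "\<And>v. (\<Sum>e\<in>{e\<in>E. v \<in> e}. a e) \<le> w v"
    unfolding edge_power_def by blast
  obtain e where e: "e \<in> E" "a e > 0" using a(1) by (metis gr_zeroI sum.neutral nat.distinct(1))
  define b where "b = a(e := a e - 1)"
  have sum_b: "sum a A = sum b A + of_bool (e \<in> A)" if "finite A" for A
  proof -
    have "sum a A = (\<Sum>f\<in>A. b f + of_bool (f = e))"
      using e by (intro sum.cong) (auto simp: b_def)
    also have "\<dots> = sum b A + of_bool (e \<in> A)"
      using that by (simp add: sum.distrib of_bool_def sum.delta)
    finally show ?thesis .
  qed
  have le: "(\<Sum>f\<in>{f\<in>E. v \<in> f}. b f) + of_bool (v \<in> e) \<le> w v" for v
    using a(2)[of v] e sum_b[of "{f\<in>E. v \<in> f}"] assms by simp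
  define x where "x v = w v - of_bool (v \<in> e)" for v
  have "x \<in> edge_power E t"
    unfolding edge_power_def
  proof (intro CollectI exI[of _ b] conjI allI)
    show "sum b E = t" using sum_b[OF assms] a(1) e by simp
    show "(\<Sum>f\<in>{f\<in>E. v \<in> f}. b f) \<le> x v" for v using le[of v] by (simp add: x_def)
  qed
  moreover have "w = (\<lambda>v. x v + of_bool (v \<in> e))"
  proof
    show "w v = x v + of_bool (v \<in> e)" for v
      using add_leD2[OF le[of v]] by (simp add: x_def)
  qed
  ultimately show "\<exists>e\<in>E. \<exists>x\<in>edge_power E t. w = (\<lambda>v. x v + of_bool (v \<in> e))" using e by blast
next
  assume "\<exists>e\<in>E. \<exists>x\<in>edge_power E t. w = (\<lambda>v. x v + of_bool (v \<in> e))"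
  then obtain e x where e: "e \<in> E" "x \<in> edge_power E t" "w = (\<lambda>v. x v + of_bool (v \<in> e))" by blast
  have "(\<lambda>v. of_bool (v \<in> e)) \<in> edge_power E 1"
    unfolding edge_power_def using e(1) assms
    by (auto intro!: exI[of _ "\<lambda>f. of_bool (f = e)"] simp: of_bool_def sum.delta)
  from edge_power_add[OF e(2) this] show "w \<in> edge_power E (Suc t)" using e(3) by simp
qed

lemma edge_power_antimono:
  assumes "finite E" "s \<le> t"
  shows "edge_power E t \<subseteq> edge_power E s"
proof (rule lift_Suc_antimono_le[of "edge_power E", OF _ assms(2)])
  show "edge_power E (Suc n) \<subseteq> edge_power E n" for n
  proof
    fix w assume "w \<in> edge_power E (Suc n)"
    then obtain e x where "x \<in> edge_power E n" "w = (\<lambda>v. x v + of_bool (v \<in> e))"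
      unfolding edge_power_Suc[OF assms(1)] by blast
    then show "w \<in> edge_power E n" using edge_power_mono[of x E n w] by (simp add: le_fun_def)
  qed
qed

text \<open>A product of t edges contains each node at most t times, so exponents above t cannot
  help divisibility.\<close>

lemma edge_power_saturated:
  assumes "finite E" "w(v := w v + k) \<in> edge_power E t" "t \<le> w v"
  shows "w \<in> edge_power E t"
proof -
  obtain a where a: "sum a E = t" "\<And>u. (\<Sum>e\<in>{e\<in>E. u \<in> e}. a e) \<le> (w(v := w v + k)) u"
    using assms(2) unfolding edge_power_def by blast
  have "(\<Sum>e\<in>{e\<in>E. v \<in> e}. a e) \<le> sum a E" using assms(1) by (intro sum_mono2) auto
  then have "(\<Sum>e\<in>{e\<in>E. u \<in> e}. a e) \<le> w u" for u
    using a(2)[of u] a(1) assms(3) by (cases "u = v") auto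
  then show ?thesis unfolding edge_power_def using a(1) by blast
qed

text \<open>Edges are non-empty, so each one uses up at least one unit of total degree. This makes
  the order of a monomial finite.\<close>

lemma edge_power_le_sum:
  assumes "finite V" "finite E" "\<forall>e\<in>E. e \<noteq> {} \<and> e \<subseteq> V" "w \<in> edge_power E t"
  shows "t \<le> sum w V"
  using assms(4)
proof (induction t arbitrary: w)
  case (Suc t)
  then obtain e x where e: "e \<in> E" "x \<in> edge_power E t" "w = (\<lambda>v. x v + of_bool (v \<in> e))"
    using edge_power_Suc[OF assms(2)] by blast
  obtain u where u: "u \<in> e" "u \<in> V" using e(1) assms(3) by blast
  then have "1 \<le> (\<Sum>v\<in>V. of_bool (v \<in> e) :: nat)"
    using member_le_sum[of u V "\<lambda>v. of_bool (v \<in> e) :: nat"] assms(1) by simp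
  then show ?case using Suc.IH[OF e(2)] unfolding e(3) sum.distrib by linarith
qed simp

text \<open>Being killed by a power of the maximal ideal is tested here with a power of each single
  node, which for monomials amounts to the same.\<close>

definition torsion_exps :: "'v set \<Rightarrow> 'v set set \<Rightarrow> nat \<Rightarrow> ('v \<Rightarrow> nat) set" where
  "torsion_exps V E t =
     {w\<in>supported V. w \<in> edge_power E t \<and> w \<notin> edge_power E (Suc t) \<and>
        (\<forall>v\<in>V. \<exists>k. w(v := w v + k) \<in> edge_power E (Suc t))}"

text \<open>Saturation at t + 1: if the exponent of v exceeded t, a further power of v would gain
  nothing, and w would already lie in the next power of the ideal.\<close>

lemma torsion_exps_le:
  assumes "finite E" "w \<in> torsion_exps V E t" "v \<in> V"
  shows "w v \<le> t"
  using assms edge_power_saturated[OF assms(1), of w v _ "Suc t"]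
  by (force simp: torsion_exps_def not_le)

lemma card_bounded_exponents:
  assumes "finite V"
  shows "finite {w\<in>supported V. \<forall>v\<in>V. w v < T}" "card {w\<in>supported V. \<forall>v\<in>V. w v < T} = T ^ card V"
proof -
  have "bij_betw (\<lambda>w. restrict w V) {w\<in>supported V. \<forall>v\<in>V. w v < T} (V \<rightarrow>\<^sub>E {..<T})"
    by (rule bij_betw_byWitness[where f' = "\<lambda>f v. if v \<in> V then f v else 0"])
      (auto simp: supported_def fun_eq_iff PiE_def extensional_def)
  then show "finite {w\<in>supported V. \<forall>v\<in>V. w v < T}"
      "card {w\<in>supported V. \<forall>v\<in>V. w v < T} = T ^ card V"
    using assms by (auto simp: bij_betw_finite finite_PiE bij_betw_same_card card_funcsetE)
qed

lemma finite_torsion_exps: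
  assumes "finite V" "finite E"
  shows "finite (torsion_exps V E t)"
proof (rule finite_subset)
  show "torsion_exps V E t \<subseteq> {w\<in>supported V. \<forall>v\<in>V. w v < Suc t}"
    using torsion_exps_le[OF assms(2), of _ V t]
    by (auto simp: less_Suc_eq_le) (auto simp: torsion_exps_def)
qed (rule card_bounded_exponents[OF assms(1)])

text \<open>A monomial is counted at most once, at its order, and only inside a box of side T. This
  crude bound is what caps the degree of the counting polynomial.\<close>

lemma sum_card_torsion_exps_le:
  assumes "finite V" "finite E"
  shows "(\<Sum>t<T. card (torsion_exps V E t)) \<le> T ^ card V"
proof -
  have disj: "torsion_exps V E s \<inter> torsion_exps V E t = {}" if "s < t" for s t
    using edge_power_antimono[OF assms(2), of "Suc s" t] that by (auto simp: torsion_exps_def)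
  have "(\<Sum>t<T. card (torsion_exps V E t)) = card (\<Union>t<T. torsion_exps V E t)"
    using disj finite_torsion_exps[OF assms]
    by (intro card_UN_disjoint[symmetric]) (auto, metis disjoint_iff nat_neq_iff)
  also have "\<dots> \<le> card {w\<in>supported V. \<forall>v\<in>V. w v < T}"
    using torsion_exps_le[OF assms(2), of _ V]
    by (intro card_mono card_bounded_exponents[OF assms(1)])
      (auto intro: le_less_trans, auto simp: torsion_exps_def)
  finally show ?thesis using card_bounded_exponents[OF assms(1)] by simp
qed

text \<open>The torsion exponents of all degrees index a monomial basis of a subquotient of the
  polynomial ring in the nodes and one variable per edge. Each of them is represented by the
  exponent vector of least key mapping to it; the other vectors form a monomial ideal.\<close>

lemma eventually_poly_torsion:
  assumes "finite V" "finite E" "\<forall>e\<in>E. e \<subseteq> V"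
  shows "eventually_poly (\<lambda>t. card (torsion_exps V E t))"
proof -
  define I where "I = Inl ` V \<union> Inr ` E"
  define W :: "('a + 'a set) set" where "W = Inr ` E"
  \<comment> \<open>The exponent of the image under the substitution that keeps the nodes and sends
    an edge variable to the product of its nodes.\<close>
  define total where "total b v = b (Inl v) + (\<Sum>e\<in>{e\<in>E. v \<in> e}. b (Inr e))"
    for b :: "'a + 'a set \<Rightarrow> nat" and v
  have finI: "finite I" using assms by (simp add: I_def)
  obtain key :: "('a + 'a set \<Rightarrow> nat) \<Rightarrow> nat" where
    key: "inj_on key (supported I)" "\<And>a b. key (\<lambda>i. a i + b i) = key a * key b" "\<And>a. key a > 0"
    using monomial_key[OF finI] by blast
  have sumW: "sum b W = (\<Sum>e\<in>E. b (Inr e))" for b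
    unfolding W_def by (simp add: sum.reindex)
  have total_add: "total (\<lambda>i. b i + c i) v = total b v + total c v" for b c v
    by (simp add: total_def sum.distrib)
  have total_supp: "total b \<in> supported V" if "b \<in> supported I" for b
  proof -
    have "b (Inl v) = 0" if "v \<notin> V" for v
      using \<open>b \<in> supported I\<close> that by (auto simp: supported_def I_def)
    moreover have "(\<Sum>e\<in>{e\<in>E. v \<in> e}. b (Inr e)) = 0" if "v \<notin> V" for v
      using assms(3) that by (intro sum.neutral) blast
    ultimately show ?thesis by (simp add: supported_def total_def)
  qed
  have total_power: "total b \<in> edge_power E (sum b W)" for b
    unfolding edge_power_def by (auto intro!: exI[of _ "b \<circ> Inr"] simp: total_def sumW)
  define S where "S = {b\<in>supported I. \<forall>v\<in>V. \<exists>k.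
      (total b)(v := total b v + k) \<in> edge_power E (Suc (sum b W))}"
  \<comment> \<open>The first alternative removes images of order above the level, the second every
    vector that is not the least of its fibre. Both persist under adding a vector because
    \<open>total\<close> is additive and \<open>key\<close> is multiplicative and positive.\<close>
  define S' where "S' = {b\<in>supported I. total b \<in> edge_power E (Suc (sum b W)) \<or>
      (\<exists>c\<in>supported I. total c = total b \<and> sum c W = sum b W \<and> key c < key b)}"
  have decomp: "\<exists>z\<in>supported I. c = (\<lambda>i. b i + z i)"
    if "b \<le> c" "c \<in> supported I" for b c :: "'a + 'a set \<Rightarrow> nat"
    using that by (intro bexI[of _ "\<lambda>i. c i - b i"]) (auto simp: le_fun_def supported_def)
  have upS: "up_closed I S"
    unfolding up_closed_def
  proof (intro conjI ballI impI)
    fix b c assume b: "b \<in> S" and c: "c \<in> supported I" "b \<le> c"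
    obtain z where z: "z \<in> supported I" "c = (\<lambda>i. b i + z i)" using decomp c by blast
    have "\<exists>k. (total c)(v := total c v + k) \<in> edge_power E (Suc (sum c W))" if v: "v \<in> V" for v
    proof -
      obtain k where k: "(total b)(v := total b v + k) \<in> edge_power E (Suc (sum b W))"
        using b v by (auto simp: S_def)
      have "(total c)(v := total c v + k) = (\<lambda>u. ((total b)(v := total b v + k)) u + total z u)"
        by (auto simp: z(2) total_add fun_eq_iff)
      then show ?thesis
        using edge_power_add[OF k total_power[of z]] z(2) by (auto simp: sum.distrib intro!: exI[of _ k])
    qed
    then show "c \<in> S" using c by (simp add: S_def)
  qed (auto simp: S_def)
  have upS': "up_closed I S'"
    unfolding up_closed_def
  proof (intro conjI ballI impI)
    fix b c assume b: "b \<in> S'" and c: "c \<in> supported I" "b \<le> c"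
    obtain z where z: "z \<in> supported I" "c = (\<lambda>i. b i + z i)" using decomp c by blast
    from b consider "total b \<in> edge_power E (Suc (sum b W))"
      | d where "d \<in> supported I" "total d = total b" "sum d W = sum b W" "key d < key b"
      by (auto simp: S'_def)
    then show "c \<in> S'"
    proof cases
      case 1
      have "total c = (\<lambda>v. total b v + total z v)" by (auto simp: z(2) total_add)
      then have "total c \<in> edge_power E (Suc (sum c W))"
        using edge_power_add[OF 1 total_power[of z]] z(2) by (simp add: sum.distrib)
      then show ?thesis using c by (simp add: S'_def)
    next
      case 2
      have "(\<lambda>i. d i + z i) \<in> supported I" using 2(1) z(1) by (auto simp: supported_def)
      moreover have "total (\<lambda>i. d i + z i) = total c"
        using 2(2) by (auto simp: z(2) total_add fun_eq_iff)
      moreover have "sum (\<lambda>i. d i + z i) W = sum c W" using 2(3) z(2) by (simp add: sum.distrib)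
      moreover have "key (\<lambda>i. d i + z i) < key c" using 2(4) z(2) key(2,3) by simp
      ultimately show ?thesis using c unfolding S'_def by blast
    qed
  qed (auto simp: S'_def)
  have bij: "bij_betw total (level W (S - S') t) (torsion_exps V E t)" for t
    unfolding bij_betw_def
  proof (intro conjI inj_onI)
    fix b c assume b: "b \<in> level W (S - S') t" and c: "c \<in> level W (S - S') t"
      and eq: "total b = total c"
    have "b \<in> supported I" "c \<in> supported I" using b c by (auto simp: level_def S_def)
    moreover have "\<not> key b < key c" "\<not> key c < key b" using b c eq calculation by (auto simp: level_def S'_def S_def)
    ultimately show "b = c" using key(1) by (meson inj_onD linorder_neqE_nat)
  next
    show "total ` level W (S - S') t = torsion_exps V E t"
    proof (intro equalityI subsetI)
      fix w assume "w \<in> total ` level W (S - S') t"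
      then show "w \<in> torsion_exps V E t"
        using total_power total_supp by (auto simp: level_def S_def S'_def torsion_exps_def)
    next
      fix w assume w: "w \<in> torsion_exps V E t"
      then obtain a where a: "sum a E = t" "\<And>v. (\<Sum>e\<in>{e\<in>E. v \<in> e}. a e) \<le> w v"
        by (auto simp: torsion_exps_def edge_power_def)
      define F where "F = {b\<in>supported I. total b = w \<and> sum b W = t}"
      \<comment> \<open>The node variables take up the slack between \<open>w\<close> and the chosen
        product of edges, which makes \<open>total b0\<close> equal to \<open>w\<close>.\<close>
      define b0 where "b0 i = (case i of Inl v \<Rightarrow> w v - (\<Sum>e\<in>{e\<in>E. v \<in> e}. a e)
          | Inr e \<Rightarrow> if e \<in> E then a e else 0)" for i
      have "b0 \<in> F"
        using w a by (auto simp: F_def b0_def I_def supported_def total_def sumW fun_eq_iff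
            torsion_exps_def split: sum.splits)
      then obtain b where b: "b \<in> F" "\<And>c. c \<in> F \<Longrightarrow> key b \<le> key c"
        using ex_has_least_nat[of "\<lambda>b. b \<in> F" b0 key] by blast
      then have "b \<in> level W (S - S') t"
        using w by (auto simp: F_def level_def S_def S'_def torsion_exps_def not_less)
      then show "w \<in> total ` level W (S - S') t" using b(1) by (auto simp: F_def)
    qed
  qed
  have "eventually_poly (\<lambda>t. card (level W (S - S') t))"
  proof (rule eventually_poly_level[OF finI upS upS'])
    show "W \<subseteq> I" by (auto simp: W_def I_def)
    show "finite (level W (S - S') t)" for t
      using bij_betw_finite[OF bij] finite_torsion_exps[OF assms(1,2)] by simp
  qed
  then show ?thesis using bij_betw_same_card[OF bij] by simp
qed

section \<open>Growth of the torsion\<close>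

lemma inverse_power_tendsto_0: "n > 0 \<Longrightarrow> (\<lambda>t. 1 / real t ^ n) \<longlonglongrightarrow> 0"
  using tendsto_power[OF lim_1_over_n, where n = n] by (simp add: power_one_over zero_power)

text \<open>Only an upper bound on the degree enters, so the coefficient at n may vanish; the limit
  is then 0.\<close>

lemma poly_over_power_tendsto:
  fixes p :: "real poly"
  assumes "degree p \<le> n"
  shows "(\<lambda>t. poly p (real t) / real t ^ n) \<longlonglongrightarrow> coeff p n"
  using assms
proof (induction n arbitrary: p)
  case 0
  then obtain c where "p = [:c:]" by (metis degree_0_id le_zero_eq degree_eq_zeroE)
  then show ?case by simp
next
  case (Suc n)
  obtain a q where p: "p = pCons a q" by (cases p)
  have "degree q \<le> n" using Suc.prems p by (cases "q = 0") auto
  then have "(\<lambda>t. poly q (real t) / real t ^ n) \<longlonglongrightarrow> coeff q n" by (rule Suc.IH)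
  moreover have "(\<lambda>t. a * (1 / real t ^ Suc n)) \<longlonglongrightarrow> a * 0"
    by (intro tendsto_intros inverse_power_tendsto_0) simp
  ultimately have "(\<lambda>t. a * (1 / real t ^ Suc n) + poly q (real t) / real t ^ n) \<longlonglongrightarrow> a * 0 + coeff q n"
    by (intro tendsto_add)
  moreover have "\<forall>\<^sub>F t in sequentially. a * (1 / real t ^ Suc n) + poly q (real t) / real t ^ n
      = poly p (real t) / real t ^ Suc n"
    using eventually_gt_at_top[of 0] by eventually_elim (simp add: p field_simps)
  ultimately show ?case by (auto simp: p intro: Lim_transform_eventually)
qed

text \<open>If the degree were d > n, the T values between T and 2 T would each be at least a
  constant times T^(n+1), and their sum would outgrow the bound (2 T)^(n+1).\<close>

lemma eventually_poly_growth:
  assumes "eventually_poly f" "\<And>T. (\<Sum>t<T. f t) \<le> T ^ Suc n"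
  shows "convergent (\<lambda>t. real (f t) / real t ^ n)"
proof -
  obtain p :: "real poly" where p: "\<forall>\<^sub>F t in sequentially. real (f t) = poly p (real t)"
    using assms(1) unfolding eventually_poly_def by blast
  have lim: "(\<lambda>t. real (f t) / real t ^ m) \<longlonglongrightarrow> coeff p m" if "degree p \<le> m" for m
  proof (rule Lim_transform_eventually[OF poly_over_power_tendsto[OF that]])
    show "\<forall>\<^sub>F t in sequentially. poly p (real t) / real t ^ m = real (f t) / real t ^ m"
      using p by eventually_elim simp
  qed
  have "degree p \<le> n"
  proof (rule ccontr)
    define d where "d = degree p"
    define c where "c = coeff p d"
    assume "\<not> degree p \<le> n"
    then have d: "n < d" by (simp add: d_def)
    have l: "(\<lambda>t. real (f t) / real t ^ d) \<longlonglongrightarrow> c" using lim[of d] by (simp add: d_def c_def)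
    have "c \<ge> 0" by (rule LIMSEQ_le_const[OF l]) auto
    moreover have "c \<noteq> 0" using d by (auto simp: c_def d_def)
    ultimately have c: "c > 0" by simp
    have "\<forall>\<^sub>F t in sequentially. real (f t) / real t ^ d > c / 2"
      using c by (intro order_tendstoD(1)[OF l]) simp
    then obtain N where N: "\<And>t. t \<ge> N \<Longrightarrow> real (f t) / real t ^ d > c / 2"
      unfolding eventually_sequentially by blast
    \<comment> \<open>Chosen so that c / 2 times T exceeds 2^(n+1), the factor lost in passing from
      T to 2 T.\<close>
    obtain K where K: "real K > 2 * 2 ^ Suc n / c" using reals_Archimedean2 by blast
    define T where "T = Suc (max N K)"
    have T: "T \<ge> N" "T > 0" "real T > 2 * 2 ^ Suc n / c" using K by (auto simp: T_def)
    have ft: "real (f t) \<ge> c / 2 * real T ^ Suc n" if t: "t \<ge> T" for t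
    proof -
      have "real T ^ Suc n \<le> real t ^ Suc n" using t by (intro power_mono) auto
      also have "\<dots> \<le> real t ^ d" using d t T by (intro power_increasing) auto
      finally have "c / 2 * real T ^ Suc n \<le> c / 2 * real t ^ d" using c by simp
      also have "\<dots> \<le> real (f t)" using N[of t] t T by (simp add: field_simps)
      finally show ?thesis .
    qed
    have "real T * (c / 2 * real T ^ Suc n) = (\<Sum>t=T..<2*T. c / 2 * real T ^ Suc n)"
      by simp
    also have "\<dots> \<le> (\<Sum>t=T..<2*T. real (f t))" using ft by (intro sum_mono) auto
    also have "\<dots> \<le> (\<Sum>t<2*T. real (f t))" by (intro sum_mono2) auto
    also have "\<dots> \<le> real ((2 * T) ^ Suc n)"
      using assms(2)[of "2 * T"] by (metis of_nat_le_iff of_nat_sum)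
    also have "\<dots> = 2 ^ Suc n * real T ^ Suc n" by (simp add: power_mult_distrib)
    finally have "real T * c / 2 * real T ^ Suc n \<le> 2 ^ Suc n * real T ^ Suc n"
      by (simp add: mult_ac)
    then have "real T * c / 2 \<le> 2 ^ Suc n"
      by (rule mult_right_le_imp_le) (use T in auto)
    then show False using T(3) c by (simp add: field_simps)
  qed
  then show ?thesis using lim by (auto simp: convergent_def)
qed

lemma convergent_torsion:
  assumes "finite V" "V \<noteq> {}" "finite E" "\<forall>e\<in>E. e \<subseteq> V"
  shows "convergent (\<lambda>t. real (card (torsion_exps V E t)) / real t ^ (card V - 1))"
proof -
  obtain n where n: "card V = Suc n" using assms(1,2) by (cases "card V") auto
  show ?thesis
    using eventually_poly_growth[OF eventually_poly_torsion[OF assms(1,3,4)], of n]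
      sum_card_torsion_exps_le[OF assms(1,3)] by (simp add: n)
qed

section \<open>Disjoint unions\<close>

text \<open>No edge of one part meets a node of the other, so multiplicities on the union restrict
  to either part; conversely, multiplicities on the parts are extended by zero and added.\<close>

lemma edge_power_disjoint_union:
  assumes "finite E" "finite E'" "\<forall>e\<in>E. e \<noteq> {} \<and> e \<subseteq> V" "\<forall>e\<in>E'. e \<noteq> {} \<and> e \<subseteq> V'"
    "V \<inter> V' = {}" "x \<in> supported V" "y \<in> supported V'"
  shows "(\<lambda>v. x v + y v) \<in> edge_power (E \<union> E') t \<longleftrightarrow>
    (\<exists>i j. i + j = t \<and> x \<in> edge_power E i \<and> y \<in> edge_power E' j)"
proof
  have EE: "E \<inter> E' = {}"
  proof (rule equals0I)
    fix e assume "e \<in> E \<inter> E'"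
    then have "e \<noteq> {}" "e \<subseteq> V" "e \<subseteq> V'" using assms(3,4) by auto
    then show False using assms(5) by blast
  qed
  assume "(\<lambda>v. x v + y v) \<in> edge_power (E \<union> E') t"
  then obtain a where a: "sum a (E \<union> E') = t"
    "\<And>v. (\<Sum>e\<in>{e\<in>E \<union> E'. v \<in> e}. a e) \<le> x v + y v" unfolding edge_power_def by blast
  have "(\<Sum>e\<in>{e\<in>E. v \<in> e}. a e) \<le> x v" for v
  proof (cases "v \<in> V")
    case True
    then have "{e\<in>E \<union> E'. v \<in> e} = {e\<in>E. v \<in> e}" "y v = 0"
      using assms(4,5,7) by (auto simp: supported_def)
    then show ?thesis using a(2)[of v] by simp
  next
    case False
    then have "{e\<in>E. v \<in> e} = {}" using assms(3) by auto
    then show ?thesis by (simp only: sum.empty)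
  qed
  moreover have "(\<Sum>e\<in>{e\<in>E'. v \<in> e}. a e) \<le> y v" for v
  proof (cases "v \<in> V'")
    case True
    then have "{e\<in>E \<union> E'. v \<in> e} = {e\<in>E'. v \<in> e}" "x v = 0"
      using assms(3,5,6) by (auto simp: supported_def)
    then show ?thesis using a(2)[of v] by simp
  next
    case False
    then have "{e\<in>E'. v \<in> e} = {}" using assms(4) by auto
    then show ?thesis by (simp only: sum.empty)
  qed
  moreover have "sum a E + sum a E' = t" using a(1) sum.union_disjoint[OF assms(1,2) EE, of a] by simp
  ultimately show "\<exists>i j. i + j = t \<and> x \<in> edge_power E i \<and> y \<in> edge_power E' j"
    unfolding edge_power_def by blast
next
  have ext: "edge_power A i \<subseteq> edge_power (A \<union> B) i" if fin: "finite A" "finite B" for A B :: "'a set set" and i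
  proof
    fix w assume "w \<in> edge_power A i"
    then obtain a where a: "sum a A = i" "\<And>v. (\<Sum>e\<in>{e\<in>A. v \<in> e}. a e) \<le> w v"
      unfolding edge_power_def by blast
    define b where "b e = (if e \<in> A then a e else 0)" for e
    have "sum b (A \<union> B) = sum a A"
      using fin by (intro sum.mono_neutral_cong_right) (auto simp: b_def)
    moreover have "(\<Sum>e\<in>{e\<in>A \<union> B. v \<in> e}. b e) = (\<Sum>e\<in>{e\<in>A. v \<in> e}. a e)" for v
      using fin by (intro sum.mono_neutral_cong_right) (auto simp: b_def)
    ultimately show "w \<in> edge_power (A \<union> B) i" unfolding edge_power_def using a by auto
  qed
  assume "\<exists>i j. i + j = t \<and> x \<in> edge_power E i \<and> y \<in> edge_power E' j"
  then show "(\<lambda>v. x v + y v) \<in> edge_power (E \<union> E') t"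
    using ext[OF assms(1,2)] ext[OF assms(2,1)] edge_power_add by (metis Un_commute subsetD)
qed

text \<open>The order of a monomial exists because the powers decrease, the power 0 contains
  everything, and the total degree bounds the exponent.\<close>

lemma edge_power_order:
  assumes "finite V" "finite E" "\<forall>e\<in>E. e \<noteq> {} \<and> e \<subseteq> V"
  obtains i where "\<And>s. x \<in> edge_power E s \<longleftrightarrow> s \<le> i"
proof
  define i where "i = (GREATEST t. x \<in> edge_power E t)"
  have bound: "\<And>t. x \<in> edge_power E t \<Longrightarrow> t \<le> sum x V"
    by (rule edge_power_le_sum[OF assms])
  then have "x \<in> edge_power E i"
    unfolding i_def using GreatestI_nat[of "\<lambda>t. x \<in> edge_power E t" 0, OF _ bound] by simp
  moreover have "s \<le> i" if "x \<in> edge_power E s" for s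
    
    unfolding i_def using Greatest_le_nat[of "\<lambda>t. x \<in> edge_power E t", OF that bound] .
  ultimately show "x \<in> edge_power E s \<longleftrightarrow> s \<le> i" for s
    using edge_power_antimono[OF assms(2), of s i] by blast
qed

text \<open>If x and y have orders i and j, their product has order i + j. Raising the exponent of a
  node of one part leaves the order of the other factor unchanged, so the order of the product rises
  exactly when that of the changed factor does.\<close>

lemma torsion_exps_disjoint_union:
  assumes V: "finite V" "finite E" "\<forall>e\<in>E. e \<noteq> {} \<and> e \<subseteq> V"
    and V': "finite V'" "finite E'" "\<forall>e\<in>E'. e \<noteq> {} \<and> e \<subseteq> V'" and disj: "V \<inter> V' = {}"
    and x: "x \<in> supported V" and y: "y \<in> supported V'"
  shows "(\<lambda>v. x v + y v) \<in> torsion_exps (V \<union> V') (E \<union> E') t \<longleftrightarrow>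
    (\<exists>i\<le>t. x \<in> torsion_exps V E i \<and> y \<in> torsion_exps V' E' (t - i))"
proof -
  obtain i where i: "\<And>s. x \<in> edge_power E s \<longleftrightarrow> s \<le> i" using edge_power_order[OF V] by blast
  obtain j where j: "\<And>s. y \<in> edge_power E' s \<longleftrightarrow> s \<le> j" using edge_power_order[OF V'] by blast
  note split = edge_power_disjoint_union[OF V(2) V'(2) V(3) V'(3) disj]
  have supp: "(\<lambda>v. x v + y v) \<in> supported (V \<union> V')" using x y by (auto simp: supported_def)
  have xy: "(\<lambda>v. x v + y v) \<in> edge_power (E \<union> E') s \<longleftrightarrow> s \<le> i + j" for s
  proof
    show "s \<le> i + j" if "(\<lambda>v. x v + y v) \<in> edge_power (E \<union> E') s"
      using that unfolding split[OF x y] i j by auto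
    show "(\<lambda>v. x v + y v) \<in> edge_power (E \<union> E') s" if "s \<le> i + j"
      unfolding split[OF x y] i j
      \<comment> \<open>Take from x as many edges as its order allows, and the rest from y.\<close>
      by (rule exI[of _ "min s i"], rule exI[of _ "s - min s i"]) (use that in auto)
  qed
  have xv: "(\<lambda>v. x v + y v)(u := x u + y u + k) \<in> edge_power (E \<union> E') (Suc (i + j)) \<longleftrightarrow>
      x(u := x u + k) \<in> edge_power E (Suc i)" if u: "u \<in> V" for u k
  proof -
    have eq: "(\<lambda>v. x v + y v)(u := x u + y u + k) = (\<lambda>v. (x(u := x u + k)) v + y v)" by auto
    have "x(u := x u + k) \<in> supported V" using x u by (auto simp: supported_def)
    note s = split[OF this y]
    show ?thesis
    proof
      assume "x(u := x u + k) \<in> edge_power E (Suc i)"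
      then show "(\<lambda>v. x v + y v)(u := x u + y u + k) \<in> edge_power (E \<union> E') (Suc (i + j))"
        unfolding eq s j by (intro exI[of _ "Suc i"] exI[of _ "j"]) simp
    next
      assume "(\<lambda>v. x v + y v)(u := x u + y u + k) \<in> edge_power (E \<union> E') (Suc (i + j))"
      then obtain i' j' where ij: "i' + j' = Suc (i + j)" "j' \<le> j" "x(u := x u + k) \<in> edge_power E i'"
        unfolding eq s j by blast
      then have "Suc i \<le> i'" by simp
      then show "x(u := x u + k) \<in> edge_power E (Suc i)" using edge_power_antimono[OF V(2)] ij(3) by blast
    qed
  qed
  have yv: "(\<lambda>v. x v + y v)(u := x u + y u + k) \<in> edge_power (E \<union> E') (Suc (i + j)) \<longleftrightarrow>
      y(u := y u + k) \<in> edge_power E' (Suc j)" if u: "u \<in> V'" for u k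
  proof -
    have eq: "(\<lambda>v. x v + y v)(u := x u + y u + k) = (\<lambda>v. x v + (y(u := y u + k)) v)" by auto
    have "y(u := y u + k) \<in> supported V'" using y u by (auto simp: supported_def)
    note s = split[OF x this]
    show ?thesis
    proof
      assume "y(u := y u + k) \<in> edge_power E' (Suc j)"
      then show "(\<lambda>v. x v + y v)(u := x u + y u + k) \<in> edge_power (E \<union> E') (Suc (i + j))"
        unfolding eq s i by (intro exI[of _ "i"] exI[of _ "Suc j"]) simp
    next
      assume "(\<lambda>v. x v + y v)(u := x u + y u + k) \<in> edge_power (E \<union> E') (Suc (i + j))"
      then obtain i' j' where ij: "i' + j' = Suc (i + j)" "i' \<le> i" "y(u := y u + k) \<in> edge_power E' j'"
        unfolding eq s i by blast
      then have "Suc j \<le> j'" by simp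
      then show "y(u := y u + k) \<in> edge_power E' (Suc j)" using edge_power_antimono[OF V'(2)] ij(3) by blast
    qed
  qed
  have "(\<lambda>v. x v + y v) \<in> torsion_exps (V \<union> V') (E \<union> E') t \<longleftrightarrow> t = i + j \<and>
      (\<forall>v\<in>V. \<exists>k. x(v := x v + k) \<in> edge_power E (Suc i)) \<and>
      (\<forall>v\<in>V'. \<exists>k. y(v := y v + k) \<in> edge_power E' (Suc j))"
  proof (cases "t = i + j")
    case True
    show ?thesis unfolding torsion_exps_def mem_Collect_eq xy True ball_Un
      using supp by (simp add: xv yv)
  qed (auto simp: torsion_exps_def xy)
  also have "\<dots> \<longleftrightarrow> (\<exists>i\<le>t. x \<in> torsion_exps V E i \<and> y \<in> torsion_exps V' E' (t - i))"
  proof -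
    have "x \<in> torsion_exps V E k \<longleftrightarrow> k = i \<and> (\<forall>v\<in>V. \<exists>k. x(v := x v + k) \<in> edge_power E (Suc i))" for k
      using x by (cases "k = i") (auto simp: torsion_exps_def i)
    moreover have "y \<in> torsion_exps V' E' k \<longleftrightarrow>
        k = j \<and> (\<forall>v\<in>V'. \<exists>k. y(v := y v + k) \<in> edge_power E' (Suc j))" for k
      using y by (cases "k = j") (auto simp: torsion_exps_def j)
    ultimately show ?thesis by auto
  qed
  finally show ?thesis .
qed

text \<open>A vector on the union is determined by its restrictions to the two node sets, and the
  first restriction fixes the degree i, so the pairs for different i are disjoint.\<close>

lemma card_torsion_exps_disjoint_union:
  assumes V: "finite V" "finite E" "\<forall>e\<in>E. e \<noteq> {} \<and> e \<subseteq> V"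
    and V': "finite V'" "finite E'" "\<forall>e\<in>E'. e \<noteq> {} \<and> e \<subseteq> V'" and disj: "V \<inter> V' = {}"
  shows "card (torsion_exps (V \<union> V') (E \<union> E') t) =
    (\<Sum>i\<le>t. card (torsion_exps V E i) * card (torsion_exps V' E' (t - i)))"
proof -
  define D where "D i = torsion_exps V E i \<times> torsion_exps V' E' (t - i)" for i
  define add where "add = (\<lambda>(x :: 'a \<Rightarrow> nat, y :: 'a \<Rightarrow> nat) v. x v + y v)"
  have inj: "inj_on add (supported V \<times> supported V')"
  proof (rule inj_onI, clarify)
    fix x y x' y' assume s: "x \<in> supported V" "y \<in> supported V'" "x' \<in> supported V" "y' \<in> supported V'"
      and eq: "add (x, y) = add (x', y')"
    have "x v = x' v \<and> y v = y' v" for v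
      using s disj fun_cong[OF eq, of v] by (cases "v \<in> V"; cases "v \<in> V'") (auto simp: supported_def add_def)
    then show "x = x' \<and> y = y'" by blast
  qed
  have sub: "D i \<subseteq> supported V \<times> supported V'" for i by (auto simp: D_def torsion_exps_def)
  note iff = torsion_exps_disjoint_union[OF V V' disj]
  have "torsion_exps (V \<union> V') (E \<union> E') t = add ` (\<Union>i\<le>t. D i)"
  proof (intro equalityI subsetI)
    fix w assume w: "w \<in> torsion_exps (V \<union> V') (E \<union> E') t"
    define x where "x v = (if v \<in> V then w v else 0)" for v
    define y where "y v = (if v \<in> V then 0 else w v)" for v
    have s: "x \<in> supported V" "y \<in> supported V'" and eq: "w = (\<lambda>v. x v + y v)"
      using w by (auto simp: x_def y_def supported_def torsion_exps_def)
    have "(x, y) \<in> (\<Union>i\<le>t. D i)" using w iff[OF s] unfolding eq D_def by auto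
    then show "w \<in> add ` (\<Union>i\<le>t. D i)"
      by (intro image_eqI[of _ _ "(x, y)"]) (simp_all add: add_def eq)
  next
    fix w assume "w \<in> add ` (\<Union>i\<le>t. D i)"
    then obtain x y i where xy: "i \<le> t" "(x, y) \<in> D i" "w = (\<lambda>v. x v + y v)" by (auto simp: add_def)
    then show "w \<in> torsion_exps (V \<union> V') (E \<union> E') t"
      using iff[of x y t] sub[of i] by (auto simp: D_def)
  qed
  then have "card (torsion_exps (V \<union> V') (E \<union> E') t) = card (\<Union>i\<le>t. D i)"
    using sub by (metis card_image inj_on_subset[OF inj] UN_least)
  also have "\<dots> = (\<Sum>i\<le>t. card (D i))"
  proof (rule card_UN_disjoint)
    show "\<forall>i\<in>{..t}. finite (D i)"
      using finite_torsion_exps[OF V(1,2)] finite_torsion_exps[OF V'(1,2)] by (simp add: D_def)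
    have "torsion_exps V E i \<inter> torsion_exps V E j = {}" if "i < j" for i j
      using edge_power_antimono[OF V(2), of "Suc i" j] that by (auto simp: torsion_exps_def)
    then show "\<forall>i\<in>{..t}. \<forall>j\<in>{..t}. i \<noteq> j \<longrightarrow> D i \<inter> D j = {}"
      unfolding D_def by (metis Sigma_empty1 Times_Int_Times nat_neq_iff Int_commute)
  qed simp
  finally show ?thesis by (simp add: D_def card_cartesian_product)
qed

section \<open>Limits of convolutions\<close>

text \<open>Both sides are the coefficient of X^t in (1 - X)^-(p+1) (1 - X)^-(q+1). The proof
  applies Pascal's rule to the second binomial, with an inner induction on t.\<close>

lemma vandermonde_rising:
  "(\<Sum>i\<le>t. (i + p choose p) * (t - i + q choose q)) = t + p + q + 1 choose (p + q + 1)"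
proof (induction q arbitrary: t)
  case 0
  then show ?case using choose_rising_sum(1)[of p t] by (simp add: add_ac)
next
  case (Suc q)
  note IH = Suc.IH
  show ?case
  proof (induction t)
    case 0
    then show ?case by simp
  next
    case (Suc t)
    have pascal: "Suc t - i + Suc q choose Suc q = (Suc t - i + q choose q) + (t - i + Suc q choose Suc q)"
      if "i \<le> t" for i
      using that by (simp add: Suc_diff_le)
    have "(\<Sum>i\<le>Suc t. (i + p choose p) * (Suc t - i + Suc q choose Suc q))
        = (\<Sum>i\<le>t. (i + p choose p) * (Suc t - i + Suc q choose Suc q)) + (Suc t + p choose p)"
      by simp
    also have "(\<Sum>i\<le>t. (i + p choose p) * (Suc t - i + Suc q choose Suc q))
        = (\<Sum>i\<le>t. (i + p choose p) * (Suc t - i + q choose q))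
        + (\<Sum>i\<le>t. (i + p choose p) * (t - i + Suc q choose Suc q))"
      unfolding sum.distrib[symmetric]
    proof (intro sum.cong refl)
      fix i assume "i \<in> {..t}"
      then show "(i + p choose p) * (Suc t - i + Suc q choose Suc q)
          = (i + p choose p) * (Suc t - i + q choose q) + (i + p choose p) * (t - i + Suc q choose Suc q)"
        by (simp only: pascal atMost_iff add_mult_distrib2)
    qed
    finally have "(\<Sum>i\<le>Suc t. (i + p choose p) * (Suc t - i + Suc q choose Suc q))
      = (\<Sum>i\<le>Suc t. (i + p choose p) * (Suc t - i + q choose q))
        + (\<Sum>i\<le>t. (i + p choose p) * (t - i + Suc q choose Suc q))"
      by simp
    also have "\<dots> = (Suc t + p + q + 1 choose (p + q + 1)) + (t + p + Suc q + 1 choose (p + Suc q + 1))"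
      unfolding IH Suc.IH ..
    also have "\<dots> = Suc t + p + Suc q + 1 choose (p + Suc q + 1)" by simp
    finally show ?case .
  qed
qed

text \<open>Each step multiplies by (t + p + 1) / (p + 1). The rising form is positive for every t,
  so it can be divided by without exceptions.\<close>

lemma rising_binomial_asymptotics:
  "(\<lambda>t. real (t + p choose p) / real t ^ p) \<longlonglongrightarrow> 1 / fact p"
proof (induction p)
  case (Suc p)
  have "(\<lambda>t. 1 + real (Suc p) * (1 / real t)) \<longlonglongrightarrow> 1 + real (Suc p) * 0"
    by (intro tendsto_intros lim_1_over_n)
  then have "(\<lambda>t. real (t + p choose p) / real t ^ p * (1 + real (Suc p) * (1 / real t)) / real (Suc p))
      \<longlonglongrightarrow> 1 / fact p * (1 + real (Suc p) * 0) / real (Suc p)"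
    by (intro tendsto_mult tendsto_divide Suc.IH tendsto_const) auto
  moreover have "\<forall>\<^sub>F t in sequentially.
      real (t + p choose p) / real t ^ p * (1 + real (Suc p) * (1 / real t)) / real (Suc p)
      = real (t + Suc p choose Suc p) / real t ^ Suc p"
    using eventually_gt_at_top[of 0]
  proof eventually_elim
    case (elim t)
    have "Suc p * (Suc (t + p) choose Suc p) = Suc (t + p) * (t + p choose p)"
      by (rule Suc_times_binomial)
    then have "real (Suc p) * real (t + Suc p choose Suc p) = real (Suc (t + p)) * real (t + p choose p)"
      by (metis add_Suc_right of_nat_mult)
    then have "real (t + Suc p choose Suc p) = real (Suc (t + p)) * real (t + p choose p) / real (Suc p)"
      by (simp add: nonzero_eq_divide_eq mult.commute del: binomial_Suc_Suc)
    moreover have "real (Suc (t + p)) = real t * (1 + real (Suc p) * (1 / real t))"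
      using elim by (simp add: field_simps)
    ultimately have eq: "real (t + Suc p choose Suc p)
        = real t * (1 + real (Suc p) * (1 / real t)) * real (t + p choose p) / real (Suc p)"
      by (simp only:)
    show ?case unfolding eq using elim by (simp add: mult.commute del: of_nat_Suc)
  qed
  ultimately show ?case by (auto intro: Lim_transform_eventually simp: fact_Suc mult.commute)
qed simp

text \<open>The terms of \<open>vandermonde_rising\<close> divided by their sum: a probability
  distribution on i <= t, which turns a normalized convolution into a weighted average.\<close>

definition cweight :: "nat \<Rightarrow> nat \<Rightarrow> nat \<Rightarrow> nat \<Rightarrow> real" where
  "cweight p q t i = real (i + p choose p) * real (t - i + q choose q) / real (t + p + q + 1 choose (p + q + 1))"

lemma cweight_nonneg: "cweight p q t i \<ge> 0"
  by (simp add: cweight_def)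

lemma sum_cweight: "(\<Sum>i\<le>t. cweight p q t i) = 1"
proof -
  have "(\<Sum>i\<le>t. real (i + p choose p) * real (t - i + q choose q)) = real (t + p + q + 1 choose (p + q + 1))"
    unfolding vandermonde_rising[symmetric] by simp
  moreover have "t + p + q + 1 choose (p + q + 1) > 0" by (intro zero_less_binomial) simp
  ultimately show ?thesis
    unfolding cweight_def sum_divide_distrib[symmetric] by (simp del: binomial_Suc_Suc)
qed

text \<open>For fixed i the numerator grows like t^q and the denominator like t^(p+q+1).\<close>

lemma cweight_tendsto_0: "(\<lambda>t. cweight p q t i) \<longlonglongrightarrow> 0"
proof -
  define r where "r = p + q + 1"
  have "(\<lambda>t. real (i + p choose p) * ((real (t + q choose q) / real t ^ q)
      / (real (t + r choose r) / real t ^ r) * (1 / real t ^ Suc p)))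
      \<longlonglongrightarrow> real (i + p choose p) * ((1 / fact q) / (1 / fact r) * 0)"
    by (intro tendsto_intros rising_binomial_asymptotics inverse_power_tendsto_0) auto
  moreover have "\<forall>\<^sub>F t in sequentially. real (i + p choose p) * ((real (t + q choose q) / real t ^ q)
      / (real (t + r choose r) / real t ^ r) * (1 / real t ^ Suc p))
      = real (i + p choose p) * real (t + q choose q) / real (t + r choose r)"
    using eventually_gt_at_top[of 0]
  proof eventually_elim
    case (elim t)
    have "real t ^ r = real t ^ q * real t ^ Suc p" by (simp add: r_def power_add)
    then show ?case using elim by (simp add: field_simps)
  qed
  ultimately have lim: "(\<lambda>t. real (i + p choose p) * real (t + q choose q) / real (t + r choose r)) \<longlonglongrightarrow> 0"
    by (auto intro: Lim_transform_eventually)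
  show ?thesis
  proof (rule tendsto_sandwich[OF _ _ tendsto_const lim])
    show "\<forall>\<^sub>F t in sequentially. 0 \<le> cweight p q t i" by (simp add: cweight_nonneg)
    \<comment> \<open>Replacing t - i by t only enlarges the second binomial.\<close>
    have "cweight p q t i \<le> real (i + p choose p) * real (t + q choose q) / real (t + r choose r)" for t
      unfolding cweight_def r_def add.assoc
      by (intro divide_right_mono mult_left_mono of_nat_mono binomial_right_mono) auto
    then show "\<forall>\<^sub>F t in sequentially. cweight p q t i
        \<le> real (i + p choose p) * real (t + q choose q) / real (t + r choose r)" by simp
  qed
qed

lemma cweight_flip: "i \<le> t \<Longrightarrow> cweight p q t (t - i) = cweight q p t i"
  by (simp add: cweight_def add_ac mult.commute del: binomial_Suc_Suc)

text \<open>The Silverman-Toeplitz argument: the first N terms receive vanishing weight, and the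
  others, where \<open>\<phi>\<close> is small, have total weight at most 1.\<close>

lemma toeplitz_cweight:
  assumes "\<phi> \<longlonglongrightarrow> (0::real)"
  shows "(\<lambda>t. \<Sum>i\<le>t. cweight p q t i * \<bar>\<phi> i\<bar>) \<longlonglongrightarrow> 0"
proof (rule LIMSEQ_I)
  fix e :: real assume e: "e > 0"
  obtain N where N: "\<And>i. i \<ge> N \<Longrightarrow> \<bar>\<phi> i\<bar> < e / 2"
    using LIMSEQ_D[OF assms, of "e / 2"] e by auto
  have "(\<lambda>t. \<Sum>i<N. cweight p q t i * \<bar>\<phi> i\<bar>) \<longlonglongrightarrow> (\<Sum>i<N. 0 * \<bar>\<phi> i\<bar>)"
    by (intro tendsto_intros cweight_tendsto_0)
  then have lim0: "(\<lambda>t. \<Sum>i<N. cweight p q t i * \<bar>\<phi> i\<bar>) \<longlonglongrightarrow> 0" by simp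
  obtain M where M: "\<And>t. t \<ge> M \<Longrightarrow> \<bar>\<Sum>i<N. cweight p q t i * \<bar>\<phi> i\<bar>\<bar> < e / 2"
    using LIMSEQ_D[OF lim0, of "e / 2"] e by auto
  show "\<exists>t0. \<forall>t\<ge>t0. norm ((\<Sum>i\<le>t. cweight p q t i * \<bar>\<phi> i\<bar>) - 0) < e"
  proof (intro exI[of _ "max N M"] allI impI)
    fix t assume t: "t \<ge> max N M"
    have "{..t} = {..<N} \<union> {N..t}" using t by auto
    then have "(\<Sum>i\<le>t. cweight p q t i * \<bar>\<phi> i\<bar>)
        = (\<Sum>i<N. cweight p q t i * \<bar>\<phi> i\<bar>) + (\<Sum>i=N..t. cweight p q t i * \<bar>\<phi> i\<bar>)"
      by (simp add: sum.union_disjoint ivl_disj_int)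
    moreover have "(\<Sum>i<N. cweight p q t i * \<bar>\<phi> i\<bar>) < e / 2" using M[of t] t by simp
    moreover have "(\<Sum>i=N..t. cweight p q t i * \<bar>\<phi> i\<bar>) \<le> e / 2"
    proof -
      have "(\<Sum>i=N..t. cweight p q t i * \<bar>\<phi> i\<bar>) \<le> (\<Sum>i=N..t. cweight p q t i * (e / 2))"
        using N by (intro sum_mono mult_left_mono cweight_nonneg) (auto intro: less_imp_le)
      also have "\<dots> \<le> (\<Sum>i\<le>t. cweight p q t i * (e / 2))"
        using e by (intro sum_mono2) (auto simp: cweight_nonneg)
      also have "\<dots> = e / 2" unfolding sum_distrib_right[symmetric] sum_cweight by simp
      finally show ?thesis .
    qed
    moreover have "(\<Sum>i\<le>t. cweight p q t i * \<bar>\<phi> i\<bar>) \<ge> 0"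
      by (intro sum_nonneg mult_nonneg_nonneg cweight_nonneg) simp
    ultimately show "norm ((\<Sum>i\<le>t. cweight p q t i * \<bar>\<phi> i\<bar>) - 0) < e" by simp
  qed
qed

lemma toeplitz_cweight_bounded:
  assumes "\<phi> \<longlonglongrightarrow> (0::real)" "\<And>i. \<bar>\<psi> i\<bar> \<le> K"
  shows "(\<lambda>t. \<Sum>i\<le>t. cweight p q t i * (\<phi> i * \<psi> (t - i))) \<longlonglongrightarrow> 0"
proof (rule tendsto_rabs_zero_cancel, rule tendsto_sandwich[OF _ _ tendsto_const])
  have "(\<lambda>t. K * (\<Sum>i\<le>t. cweight p q t i * \<bar>\<phi> i\<bar>)) \<longlonglongrightarrow> K * 0"
    by (intro tendsto_intros toeplitz_cweight assms)
  then show "(\<lambda>t. K * (\<Sum>i\<le>t. cweight p q t i * \<bar>\<phi> i\<bar>)) \<longlonglongrightarrow> 0" by simp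
  have "\<bar>\<Sum>i\<le>t. cweight p q t i * (\<phi> i * \<psi> (t - i))\<bar> \<le> K * (\<Sum>i\<le>t. cweight p q t i * \<bar>\<phi> i\<bar>)" for t
  proof -
    have "\<bar>\<Sum>i\<le>t. cweight p q t i * (\<phi> i * \<psi> (t - i))\<bar>
        \<le> (\<Sum>i\<le>t. \<bar>cweight p q t i * (\<phi> i * \<psi> (t - i))\<bar>)" by (rule sum_abs)
    also have "\<dots> \<le> (\<Sum>i\<le>t. cweight p q t i * (\<bar>\<phi> i\<bar> * K))"
      by (intro sum_mono) (auto simp: abs_mult cweight_nonneg intro!: mult_left_mono assms)
    finally show ?thesis by (simp add: sum_distrib_left mult_ac)
  qed
  then show "\<forall>\<^sub>F t in sequentially. \<bar>\<Sum>i\<le>t. cweight p q t i * (\<phi> i * \<psi> (t - i))\<bar>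
      \<le> K * (\<Sum>i\<le>t. cweight p q t i * \<bar>\<phi> i\<bar>)" by simp
qed simp

text \<open>F G - A B = (F - A) G + A (G - B). The first term is a null sequence times a bounded
  one; the second is of that kind after reversing the sum, which exchanges p and q.\<close>

lemma cweight_tendsto:
  assumes "F \<longlonglongrightarrow> (A::real)" "G \<longlonglongrightarrow> B"
  shows "(\<lambda>t. \<Sum>i\<le>t. cweight p q t i * (F i * G (t - i))) \<longlonglongrightarrow> A * B"
proof -
  obtain K where K: "\<And>i. \<bar>G i\<bar> \<le> K"
    using convergent_imp_Bseq[OF convergentI[OF assms(2)]] by (auto simp: Bseq_def)
  have F0: "(\<lambda>i. F i - A) \<longlonglongrightarrow> 0" and G0: "(\<lambda>i. G i - B) \<longlonglongrightarrow> 0"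
    using assms by (simp_all add: LIM_zero)
  have lim1: "(\<lambda>t. \<Sum>i\<le>t. cweight p q t i * ((F i - A) * G (t - i))) \<longlonglongrightarrow> 0"
    by (rule toeplitz_cweight_bounded[OF F0 K])
  have lim2: "(\<lambda>t. \<Sum>i\<le>t. cweight q p t i * ((G i - B) * 1)) \<longlonglongrightarrow> 0"
    by (rule toeplitz_cweight_bounded[OF G0, of "\<lambda>_. 1" 1]) simp
  have flip: "(\<Sum>i\<le>t. cweight q p t i * ((G i - B) * 1))
      = (\<Sum>i\<le>t. cweight p q t i * (G (t - i) - B))" for t
    by (rule sum.reindex_bij_witness[of _ "\<lambda>i. t - i" "\<lambda>i. t - i"]) (auto simp: cweight_flip)
  have "(\<Sum>i\<le>t. cweight p q t i * (F i * G (t - i)))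
      = (\<Sum>i\<le>t. cweight p q t i * ((F i - A) * G (t - i)))
        + A * (\<Sum>i\<le>t. cweight p q t i * (G (t - i) - B)) + A * B" for t
  proof -
    have "A * B = (\<Sum>i\<le>t. cweight p q t i * (A * B))"
      unfolding sum_distrib_right[symmetric] sum_cweight by simp
    then show ?thesis
      by (simp add: sum_distrib_left sum.distrib[symmetric] algebra_simps)
  qed
  moreover have "(\<lambda>t. (\<Sum>i\<le>t. cweight p q t i * ((F i - A) * G (t - i)))
      + A * (\<Sum>i\<le>t. cweight p q t i * (G (t - i) - B)) + A * B) \<longlonglongrightarrow> 0 + A * 0 + A * B"
    using lim2 unfolding flip by (intro tendsto_intros lim1)
  ultimately show ?thesis by simp
qed

text \<open>Dividing by binomials in place of powers of t makes the convolution an average with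
  limit a p! b q!. The factor 1 / (p + q + 1)! comes from changing the overall denominator back to a
  power.\<close>

lemma convolution_tendsto:
  assumes "(\<lambda>t. f t / real t ^ p) \<longlonglongrightarrow> a" "(\<lambda>t. g t / real t ^ q) \<longlonglongrightarrow> b"
  shows "(\<lambda>t. (\<Sum>i\<le>t. f i * g (t - i)) / real t ^ (p + q + 1))
    \<longlonglongrightarrow> a * b * fact p * fact q / fact (p + q + 1)"
proof -
  have norm: "(\<lambda>t. h t / real (t + r choose r)) \<longlonglongrightarrow> c * fact r"
    if "(\<lambda>t. h t / real t ^ r) \<longlonglongrightarrow> c" for h :: "nat \<Rightarrow> real" and r c
  proof -
    have "(\<lambda>t. (h t / real t ^ r) / (real (t + r choose r) / real t ^ r)) \<longlonglongrightarrow> c / (1 / fact r)"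
      by (intro tendsto_divide that rising_binomial_asymptotics) simp
    moreover have "\<forall>\<^sub>F t in sequentially. (h t / real t ^ r) / (real (t + r choose r) / real t ^ r)
        = h t / real (t + r choose r)"
      using eventually_gt_at_top[of 0] by eventually_elim simp
    ultimately show ?thesis by (auto intro: Lim_transform_eventually)
  qed
  define r where "r = p + q + 1"
  have pos: "real (i + k choose k) > 0" for i k by (simp add: zero_less_binomial)
  have "(\<lambda>t. (\<Sum>i\<le>t. cweight p q t i * (f i / real (i + p choose p) * (g (t - i) / real (t - i + q choose q))))
      * (real (t + r choose r) / real t ^ r)) \<longlonglongrightarrow> (a * fact p) * (b * fact q) * (1 / fact r)"
    by (intro tendsto_mult rising_binomial_asymptotics cweight_tendsto norm assms)
  moreover have "(\<Sum>i\<le>t. cweight p q t i * (f i / real (i + p choose p) * (g (t - i) / real (t - i + q choose q))))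
      * (real (t + r choose r) / real t ^ r) = (\<Sum>i\<le>t. f i * g (t - i)) / real t ^ r" for t
  proof -
    have eq: "cweight p q t i * (f i / real (i + p choose p) * (g (t - i) / real (t - i + q choose q)))
        = f i * g (t - i) / real (t + r choose r)" for i
      using pos[of i p] pos[of "t - i" q]
      by (simp add: cweight_def r_def add.assoc del: binomial_Suc_Suc)
    show ?thesis unfolding eq sum_divide_distrib[symmetric] using pos[of t r] by simp
  qed
  ultimately have "(\<lambda>t. (\<Sum>i\<le>t. f i * g (t - i)) / real t ^ r)
      \<longlonglongrightarrow> (a * fact p) * (b * fact q) * (1 / fact r)" by (simp only:)
  then show ?thesis unfolding r_def by (simp only: mult_ac times_divide_eq_right mult_1_left)
qed

section \<open>Monomial ideals in the localized polynomial ring\<close>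

definition mons :: "'v set \<Rightarrow> ('v \<Rightarrow>\<^sub>0 nat) set" where
  "mons V = {m. keys m \<subseteq> V}"

definition upset :: "'v set \<Rightarrow> ('v \<Rightarrow>\<^sub>0 nat) set \<Rightarrow> bool" where
  "upset V X \<longleftrightarrow> X \<subseteq> mons V \<and> (\<forall>m\<in>X. \<forall>w\<in>mons V. m + w \<in> X)"

text \<open>The span over the field of the monomials in \<open>X\<close>, an ideal of the polynomial
  ring when \<open>X\<close> is an \<open>upset\<close>. Describing it by supports makes membership
  a termwise matter.\<close>

definition mspan :: "('v \<Rightarrow>\<^sub>0 nat) set \<Rightarrow> ('v, 'k::field) mpoly_rep set" where
  "mspan X = {p. keys p \<subseteq> X}"

lemma zero_in_mons [simp]: "0 \<in> mons V"
  by (simp add: mons_def)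

lemma keys_add_nat: "keys (m + w) = keys m \<union> keys w"
  for m w :: "'v \<Rightarrow>\<^sub>0 nat"
  by (auto simp: in_keys_iff lookup_add)

lemma add_in_mons [simp]: "m + w \<in> mons V \<longleftrightarrow> m \<in> mons V \<and> w \<in> mons V"
  by (auto simp: mons_def keys_add_nat)

lemma upset_empty [simp]: "upset V {}"
  by (simp add: upset_def)

lemma upsetD: "upset V X \<Longrightarrow> m \<in> X \<Longrightarrow> w \<in> mons V \<Longrightarrow> m + w \<in> X"
  by (simp add: upset_def)

lemma upset_subset: "upset V X \<Longrightarrow> X \<subseteq> mons V"
  by (simp add: upset_def)

lemma lookup_in_supported: "lookup m \<in> supported V \<longleftrightarrow> m \<in> mons V"
  by (auto simp: supported_def mons_def in_keys_iff)

text \<open>Injectivity and key 0 = 1 force the keys of non-constant monomials above 1, so the key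
  grows strictly along proper multiples.\<close>

lemma mons_key:
  assumes "finite V"
  obtains key :: "('v \<Rightarrow>\<^sub>0 nat) \<Rightarrow> nat"
  where "inj_on key (mons V)" "\<And>a b. key (a + b) = key a * key b" "\<And>a. key a > 0"
    "\<And>a b. a \<in> mons V \<Longrightarrow> a \<noteq> 0 \<Longrightarrow> key b < key (a + b)"
proof -
  obtain key :: "('v \<Rightarrow> nat) \<Rightarrow> nat" where
    key: "inj_on key (supported V)" "\<And>a b. key (\<lambda>i. a i + b i) = key a * key b" "\<And>a. key a > 0"
    using monomial_key[OF assms] by blast
  define f where "f m = key (lookup m)" for m :: "'v \<Rightarrow>\<^sub>0 nat"
  have inj: "inj_on f (mons V)"
    unfolding f_def
    by (rule inj_onI) (metis inj_onD[OF key(1)] lookup_in_supported poly_mapping_eq_iff)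
  have add: "f (a + b) = f a * f b" for a b
    unfolding f_def key(2)[symmetric] by (rule arg_cong[of _ _ key]) (simp add: fun_eq_iff lookup_add)
  have pos: "f a > 0" for a unfolding f_def by (rule key)
  have "f 0 * f 0 = f 0 * 1" by (subst add[symmetric]) simp
  then have f0: "f 0 = 1" by (rule nat_mult_eq_cancel1[THEN iffD1, OF pos])
  have "f b < f (a + b)" if "a \<in> mons V" "a \<noteq> 0" for a b
  proof -
    have "f a \<noteq> f 0" using inj that by (auto dest: inj_onD)
    then have "f a > 1" using pos[of a] f0 by linarith
    then show ?thesis unfolding add using pos[of b] by simp
  qed
  then show ?thesis using that[of f] inj add pos by blast
qed

lemma mspan_subset: "X \<subseteq> Y \<Longrightarrow> mspan X \<subseteq> mspan Y"
  by (auto simp: mspan_def)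

lemma mspan_0 [simp]: "0 \<in> mspan X"
  by (simp add: mspan_def)

lemma mspan_empty: "mspan {} = {0}"
  by (auto simp: mspan_def)

lemma mspan_add [intro]: "p \<in> mspan X \<Longrightarrow> q \<in> mspan X \<Longrightarrow> p + q \<in> mspan X"
  unfolding mspan_def using keys_add[of p q] by blast

lemma mspan_uminus [intro]: "p \<in> mspan X \<Longrightarrow> - p \<in> mspan X"
  by (auto simp: mspan_def in_keys_iff)

lemma mspan_diff [intro]: "p \<in> mspan X \<Longrightarrow> q \<in> mspan X \<Longrightarrow> p - q \<in> mspan X"
  using mspan_add[of p X "- q"] by (auto simp: mspan_uminus)

lemma mspan_sum: "(\<And>i. i \<in> I \<Longrightarrow> p i \<in> mspan X) \<Longrightarrow> sum p I \<in> mspan X"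
  by (induction I rule: infinite_finite_induct) (auto simp: mspan_add)

lemma mspan_mult:
  assumes "p \<in> mspan X" "q \<in> mspan Y" "\<And>x y. x \<in> X \<Longrightarrow> y \<in> Y \<Longrightarrow> x + y \<in> Z"
  shows "p * q \<in> mspan Z"
  using assms keys_mult[of p q] unfolding mspan_def by blast

lemma mspan_single: "m \<in> X \<Longrightarrow> single m c \<in> mspan X"
  by (simp add: mspan_def)

lemma poly_mapping_sum_single:
  "p = (\<Sum>m\<in>keys p. single m (lookup p m))"
  by (rule poly_mapping_eqI) (auto simp: lookup_sum lookup_single when_def sum.delta in_keys_iff)

lemma carrier_polynomial_ring: "carrier (polynomial_ring V) = mspan (mons V)"
  by (auto simp: polynomial_ring_def mspan_def mons_def)

text \<open>Splitting off the terms at u and v leaves products whose supports avoid u + v. It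
  replaces arguments with leading terms; the coefficients at u and v may be zero.\<close>

lemma lookup_mult_unique:
  fixes p q :: "('v, 'k::field) mpoly_rep"
  assumes "\<And>a b. a \<in> keys p \<Longrightarrow> b \<in> keys q \<Longrightarrow> a + b = u + v \<Longrightarrow> a = u \<and> b = v"
  shows "lookup (p * q) (u + v) = lookup p u * lookup q v"
proof -
  define p' where "p' = p - single u (lookup p u)"
  define q' where "q' = q - single v (lookup q v)"
  have p': "keys p' = keys p - {u}"
    and q': "keys q' = keys q - {v}"
    by (auto simp: p'_def q'_def in_keys_iff lookup_minus lookup_single when_def split: if_splits)
  have eq: "p * q = single (u + v) (lookup p u * lookup q v)
      + (single u (lookup p u) * q' + p' * q)"
    unfolding mult_single[symmetric] p'_def q'_def by (simp add: algebra_simps)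
  have "u + v \<notin> keys (p' * q)"
    using keys_mult[of p' q] p' assms by fastforce
  moreover have "u + v \<notin> keys (single u (lookup p u) * q')"
    using keys_mult[of "single u (lookup p u)" q'] q' by (auto split: if_splits)
  ultimately show ?thesis unfolding eq by (simp add: lookup_add in_keys_iff)
qed

text \<open>Take u of least key among the exponents of b outside \<open>X\<close>. In s b, a pair of
  exponents with sum u has its second entry outside \<open>X\<close>, hence of key at least that of
  u, so only the constant term of s contributes and u survives. Monomial ideals are thus recovered
  from their localizations.\<close>

lemma mspan_contract:
  fixes s b :: "('v, 'k::field) mpoly_rep"
  assumes "finite V" "upset V X" "s \<in> mspan (mons V)" "lookup s 0 \<noteq> 0"
    "b \<in> mspan (mons V)" "s * b \<in> mspan X"
  shows "b \<in> mspan X"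
proof (rule ccontr)
  obtain key :: "('v \<Rightarrow>\<^sub>0 nat) \<Rightarrow> nat" where
    key: "\<And>a b. a \<in> mons V \<Longrightarrow> a \<noteq> 0 \<Longrightarrow> key b < key (a + b)"
    using mons_key[OF assms(1)] by metis
  assume "b \<notin> mspan X"
  then obtain u0 where u0: "u0 \<in> keys b - X" by (auto simp: mspan_def)
  then obtain u where u: "u \<in> keys b - X"
    "\<And>w. w \<in> keys b - X \<Longrightarrow> key u \<le> key w"
    using ex_has_least_nat[of "\<lambda>u. u \<in> keys b - X" u0 key] by blast
  have "lookup (s * b) (0 + u) = lookup s 0 * lookup b u"
  proof (rule lookup_mult_unique)
    fix x y assume x: "x \<in> keys s" and y: "y \<in> keys b" and eq: "x + y = 0 + u"
    have xV: "x \<in> mons V" using x assms(3) by (auto simp: mspan_def)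
    have "y \<notin> X"
      using upsetD[OF assms(2) _ xV, of y] eq u by (auto simp: add.commute)
    then have "key (x + y) \<le> key y" using u(2)[of y] y eq by simp
    then have "x = 0" using key[OF xV, of y] by auto
    then show "x = 0 \<and> y = u" using eq by simp
  qed
  then have "u \<in> keys (s * b)" using u assms(4) by (simp add: in_keys_iff)
  then show False using assms(6) u by (auto simp: mspan_def)
qed

lemma upset_meeting: "upset V {m\<in>mons V. keys m \<inter> W \<noteq> {}}"
  by (auto simp: upset_def keys_add_nat)

lemma mspan_top_outside:
  assumes "r \<notin> mspan X"
  obtains u where "u \<in> keys r" "u \<notin> X"
    "\<And>w. w \<in> keys r \<Longrightarrow> w \<notin> X \<Longrightarrow> key w \<le> (key u :: nat)"
proof -
  have K: "finite (key ` (keys r - X))" "key ` (keys r - X) \<noteq> {}"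
    using assms by (auto simp: mspan_def)
  obtain u where u: "u \<in> keys r - X" "Max (key ` (keys r - X)) = key u"
    using Max_in[OF K] unfolding image_iff by blast
  have "key w \<le> key u" if "w \<in> keys r" "w \<notin> X" for w
    unfolding u(2)[symmetric] by (rule Max_ge[OF K(1)]) (use that in auto)
  then show thesis using that u(1) by blast
qed

text \<open>\<open>X\<close> belongs to the ideal generated by the variables of \<open>V\<close> in
  \<open>W\<close>, and sums of exponents outside \<open>X\<close> stay outside. The terms of
  greatest key outside \<open>X\<close> in p and in q have a product that no other pair of terms
  reaches.\<close>

lemma mspan_prime:
  fixes p q :: "('v, 'k::field) mpoly_rep"
  assumes "finite V" "p \<in> mspan (mons V)" "q \<in> mspan (mons V)"
    "X = {m\<in>mons V. keys m \<inter> W \<noteq> {}}" "p * q \<in> mspan X"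
  shows "p \<in> mspan X \<or> q \<in> mspan X"
proof (rule ccontr)
  obtain key :: "('v \<Rightarrow>\<^sub>0 nat) \<Rightarrow> nat" where
    key: "inj_on key (mons V)" "\<And>a b. key (a + b) = key a * key b" "\<And>a. key a > 0"
    using mons_key[OF assms(1)] by metis
  have X_add: "a + b \<in> X \<longleftrightarrow> a \<in> X \<or> b \<in> X" if "a \<in> mons V" "b \<in> mons V" for a b
    using that unfolding assms(4) by (auto simp: keys_add_nat)
  assume "\<not> (p \<in> mspan X \<or> q \<in> mspan X)"
  then have pq: "p \<notin> mspan X" "q \<notin> mspan X" by simp_all
  obtain u where u: "u \<in> keys p" "u \<notin> X"
    "\<And>w. w \<in> keys p \<Longrightarrow> w \<notin> X \<Longrightarrow> key w \<le> key u"
    using mspan_top_outside[OF pq(1), of key] by metis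
  obtain v where v: "v \<in> keys q" "v \<notin> X"
    "\<And>w. w \<in> keys q \<Longrightarrow> w \<notin> X \<Longrightarrow> key w \<le> key v"
    using mspan_top_outside[OF pq(2), of key] by metis
  have V: "a \<in> mons V" if "a \<in> keys p \<or> a \<in> keys q" for a
    using assms(2,3) that unfolding mspan_def by blast
  have uv: "u + v \<notin> X" using X_add[OF V V, of u v] u v by simp
  have "lookup (p * q) (u + v) = lookup p u * lookup q v"
  proof (rule lookup_mult_unique)
    fix a b assume a: "a \<in> keys p" and b: "b \<in> keys q" and eq: "a + b = u + v"
    have "a \<notin> X" "b \<notin> X" using X_add[OF V V, of a b] a b eq uv by auto
    then have le: "key a \<le> key u" "key b \<le> key v" using u(3)[OF a] v(3)[OF b] by auto
    \<comment> \<open>Neither key exceeds its maximum and their product equals the product of the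
      maxima, so both maxima are attained.\<close>
    have "key a * key b = key u * key v" using eq key(2) by metis
    then have "\<not> key a < key u"
      using mult_less_le_imp_less[of "key a" "key u" "key b" "key v"] le(2) key(3)[of b] by auto
    then have "key a = key u" using le(1) by simp
    then have "a = u" using inj_onD[OF key(1)] V a u(1) by blast
    then show "a = u \<and> b = v" using eq by simp
  qed
  then have "u + v \<in> keys (p * q)" using u(1) v(1) by (simp add: in_keys_iff)
  then show False using assms(5) uv by (auto simp: mspan_def)
qed

section \<open>Ideals of the polynomial ring generated by monomials\<close>

lemma (in cring) cring_idealI:
  assumes "I \<subseteq> carrier R" "\<zero> \<in> I" "\<And>a b. a \<in> I \<Longrightarrow> b \<in> I \<Longrightarrow> a \<oplus> b \<in> I"
    "\<And>a x. a \<in> I \<Longrightarrow> x \<in> carrier R \<Longrightarrow> x \<otimes> a \<in> I"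
  shows "ideal I R"
proof (rule idealI)
  show "ring R" by (rule ring_axioms)
  have "\<ominus> a \<in> I" if "a \<in> I" for a
    using assms(4)[OF that, of "\<ominus> \<one>"] that assms(1) by (auto simp: l_minus)
  then show "subgroup I (add_monoid R)"
    using assms by (intro add.group_incl_imp_subgroup add.subgroupI) (auto simp: a_inv_def[symmetric])
  show "\<And>a x. a \<in> I \<Longrightarrow> x \<in> carrier R \<Longrightarrow> a \<otimes> x \<in> I"
    using assms(1,4) by (metis m_comm subsetD)
qed (rule assms(4))

lemma sum_image_in_ideal:
  assumes "\<zero>\<^bsub>R\<^esub> \<in> I" "\<And>i. i \<in> F \<Longrightarrow> f (p i) \<in> I" "\<And>x y. f x \<in> I \<Longrightarrow> f y \<in> I \<Longrightarrow> f (x + y) \<in> I" "f 0 = \<zero>\<^bsub>R\<^esub>"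
  shows "f (sum p F) \<in> I"
  using assms by (induction F rule: infinite_finite_induct) auto

lemma cring_polynomial_ring: "cring (polynomial_ring V :: ('v, 'k::field) mpoly_rep ring)"
proof (rule cringI)
  let ?P = "polynomial_ring V :: ('v, 'k) mpoly_rep ring"
  have mult: "p * q \<in> mspan (mons V)" if "p \<in> mspan (mons V)" "q \<in> mspan (mons V)"
    for p q :: "('v, 'k) mpoly_rep"
    using that by (rule mspan_mult) simp
  show "abelian_group ?P"
  proof (rule abelian_groupI, unfold carrier_polynomial_ring)
    fix p :: "('v, 'k) mpoly_rep" assume "p \<in> mspan (mons V)"
    then show "\<exists>q\<in>mspan (mons V). q \<oplus>\<^bsub>?P\<^esub> p = \<zero>\<^bsub>?P\<^esub>"
      by (intro bexI[of _ "- p"]) (auto simp: polynomial_ring_def)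
  qed (auto simp: polynomial_ring_def algebra_simps)
  show "comm_monoid ?P"
    by (rule comm_monoidI, unfold carrier_polynomial_ring)
      (auto simp: polynomial_ring_def mult algebra_simps, simp add: mspan_def)
qed (auto simp: polynomial_ring_def algebra_simps)

definition up_monos :: "'v set \<Rightarrow> ('v \<Rightarrow>\<^sub>0 nat) set \<Rightarrow> ('v \<Rightarrow>\<^sub>0 nat) set" where
  "up_monos V B = {b + w |b w. b \<in> B \<and> w \<in> mons V}"

lemma upset_up: "B \<subseteq> mons V \<Longrightarrow> upset V (up_monos V B)"
  by (force simp: upset_def up_monos_def add.assoc)

lemma up_monos_superset: "B \<subseteq> up_monos V B"
  by (force simp: up_monos_def intro: exI[of _ 0])

lemma genideal_polynomial_ring:
  fixes B :: "('v \<Rightarrow>\<^sub>0 nat) set"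
  assumes "B \<subseteq> mons V"
  shows "genideal (polynomial_ring V :: ('v, 'k::field) mpoly_rep ring) ((\<lambda>m. single m 1) ` B)
    = mspan (up_monos V B)" (is "genideal ?P _ = _")
proof
  interpret P: cring ?P by (rule cring_polynomial_ring)
  let ?G = "(\<lambda>m. single m (1::'k)) ` B"
  have GP: "?G \<subseteq> carrier ?P"
    using assms by (auto simp: carrier_polynomial_ring mspan_def)
  have up: "upset V (up_monos V B)" by (rule upset_up[OF assms])
  show "genideal ?P ?G \<subseteq> mspan (up_monos V B)"
  proof (rule P.genideal_minimal)
    show "ideal (mspan (up_monos V B)) ?P"
    proof (rule P.cring_idealI)
      show "mspan (up_monos V B) \<subseteq> carrier ?P"
        unfolding carrier_polynomial_ring by (rule mspan_subset[OF upset_subset[OF up]])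
      fix a x :: "('v, 'k) mpoly_rep" assume "a \<in> mspan (up_monos V B)" "x \<in> carrier ?P"
      then have "a * x \<in> mspan (up_monos V B)"
        unfolding carrier_polynomial_ring
        by (rule mspan_mult) (rule upsetD[OF up])
      then show "x \<otimes>\<^bsub>?P\<^esub> a \<in> mspan (up_monos V B)" by (simp add: polynomial_ring_def mult.commute)
    qed (auto simp: polynomial_ring_def)
    show "?G \<subseteq> mspan (up_monos V B)"
      using up_monos_superset[of B V] by (auto intro: mspan_single)
  qed
  interpret I: ideal "genideal ?P ?G" ?P by (rule P.genideal_ideal[OF GP])
  show "mspan (up_monos V B) \<subseteq> genideal ?P ?G"
  proof
    fix p :: "('v, 'k) mpoly_rep" assume p: "p \<in> mspan (up_monos V B)"
    have single: "single m c \<in> genideal ?P ?G" if m: "m \<in> up_monos V B" for m c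
    proof -
      obtain b w where bw: "m = b + w" "b \<in> B" "w \<in> mons V" using m by (auto simp: up_monos_def)
      have "single w c \<otimes>\<^bsub>?P\<^esub> single b 1 \<in> genideal ?P ?G"
        using bw P.genideal_self[OF GP]
        by (intro I.I_l_closed) (auto simp: carrier_polynomial_ring intro: mspan_single)
      then show ?thesis by (simp add: polynomial_ring_def mult_single bw(1) add.commute)
    qed
    have "(\<Sum>m\<in>keys p. single m (lookup p m)) \<in> genideal ?P ?G"
    proof (rule sum_image_in_ideal[of ?P _ _ "\<lambda>x. x"])
      show "\<zero>\<^bsub>?P\<^esub> \<in> genideal ?P ?G" by simp
      show "x + y \<in> genideal ?P ?G" if "x \<in> genideal ?P ?G" "y \<in> genideal ?P ?G" for x y
        using I.a_closed[OF that] by (simp add: polynomial_ring_def)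
    qed (use p single in \<open>auto simp: mspan_def polynomial_ring_def\<close>)
    then show "p \<in> genideal ?P ?G" using poly_mapping_sum_single[of p] by simp
  qed
qed

text \<open>The multiples of single nodes are exactly the non-constant monomials, so avoiding the
  ideal of the origin means having a constant term.\<close>

lemma outside_origin_eq:
  fixes V :: "'v set"
  shows "outside_origin V = {s \<in> mspan (mons V). lookup s 0 \<noteq> (0::'k::field)}"
proof -
  let ?B = "(\<lambda>v. single v (1::nat)) ` V"
  have B: "?B \<subseteq> mons V" by (auto simp: mons_def)
  have up: "up_monos V ?B = mons V - {0}"
  proof (intro equalityI subsetI)
    fix m assume "m \<in> up_monos V ?B"
    then obtain v w where vw: "m = single v 1 + w" "v \<in> V" "w \<in> mons V"
      by (auto simp: up_monos_def)
    then have "lookup m v \<noteq> 0" by (simp add: lookup_add)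
    then show "m \<in> mons V - {0}" using vw by (auto simp: mons_def keys_add_nat)
  next
    fix m assume m: "m \<in> mons V - {0}"
    then obtain v where v: "v \<in> keys m" by (metis DiffE ex_in_conv keys_eq_empty singletonI)
    have eq: "m = single v 1 + (m - single v 1)"
      using v by (intro poly_mapping_eqI) (auto simp: lookup_add lookup_minus lookup_single when_def in_keys_iff)
    then have "m - single v 1 \<in> mons V" using m add_in_mons by (metis DiffE)
    moreover have "v \<in> V" using v m by (auto simp: mons_def)
    ultimately show "m \<in> up_monos V ?B" using eq unfolding up_monos_def by blast
  qed
  have "genideal (polynomial_ring V) (indet ` V) = mspan (mons V - {0} :: ('v \<Rightarrow>\<^sub>0 nat) set)"
    using genideal_polynomial_ring[OF B] unfolding up indet_def image_image .
  then show ?thesis unfolding outside_origin_def carrier_polynomial_ring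
    by (auto simp: mspan_def in_keys_iff) (metis Diff_iff in_keys_iff insertI1 subsetD)
qed

lemma polynomial_ring_simps [simp]:
  "a \<otimes>\<^bsub>polynomial_ring V\<^esub> b = a * b" "a \<oplus>\<^bsub>polynomial_ring V\<^esub> b = a + b"
  "\<one>\<^bsub>polynomial_ring V\<^esub> = 1" "\<zero>\<^bsub>polynomial_ring V\<^esub> = 0"
  by (simp_all add: polynomial_ring_def)

section \<open>The polynomial ring localized at the origin\<close>

locale local_polynomial_ring =
  fixes V :: "'v set" and K :: "'k::field itself"
  assumes finite_V: "finite V"
begin

abbreviation A :: "('v, 'k) mpoly_rep set" where "A \<equiv> mspan (mons V)"

abbreviation P :: "('v, 'k) mpoly_rep ring" where "P \<equiv> polynomial_ring V"

abbreviation R :: "(('v, 'k) mpoly_rep \<times> ('v, 'k) mpoly_rep) set ring" where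
  "R \<equiv> local_ring K V"

definition S :: "('v, 'k) mpoly_rep set" where
  "S = {s \<in> A. lookup s 0 \<noteq> 0}"

definition fr :: "('v, 'k) mpoly_rep \<Rightarrow> ('v, 'k) mpoly_rep \<Rightarrow> (('v, 'k) mpoly_rep \<times> ('v, 'k) mpoly_rep) set" where
  "fr = fraction (polynomial_ring V) (outside_origin V)"

lemma outside_origin_S: "outside_origin V = S"
  by (simp add: S_def outside_origin_eq)

lemma A_closed [simp, intro]:
  "p \<in> A \<Longrightarrow> q \<in> A \<Longrightarrow> p * q \<in> A" "p \<in> A \<Longrightarrow> q \<in> A \<Longrightarrow> p + q \<in> A" "1 \<in> A"
  "p \<in> A \<Longrightarrow> - p \<in> A" "p \<in> A \<Longrightarrow> q \<in> A \<Longrightarrow> p - q \<in> A"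
  by (auto intro: mspan_mult) (simp add: mspan_def)

lemma S_A: "s \<in> S \<Longrightarrow> s \<in> A"
  by (simp add: S_def)

lemma S_one [simp]: "1 \<in> S"
  by (simp add: S_def lookup_one)

lemma S_mult [simp, intro]:
  assumes "s \<in> S" "t \<in> S"
  shows "s * t \<in> S"
proof -
  have "lookup (s * t) (0 + 0) = lookup s 0 * lookup t 0"
  proof (rule lookup_mult_unique)
    fix a b :: "'v \<Rightarrow>\<^sub>0 nat" assume "a + b = 0 + 0"
    then have "lookup a v + lookup b v = 0" for v
      by (metis add.right_neutral lookup_add lookup_zero)
    then show "a = 0 \<and> b = 0" by (auto intro: poly_mapping_eqI)
  qed
  then show ?thesis using assms by (simp add: S_def)
qed

lemma contract:
  "upset V X \<Longrightarrow> s \<in> S \<Longrightarrow> b \<in> A \<Longrightarrow> s * b \<in> mspan X \<Longrightarrow> b \<in> mspan X"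
  using mspan_contract[OF finite_V, of X s b] by (simp add: S_def)

text \<open>The case of the empty \<open>upset\<close>: multiplication by an element of
  \<open>S\<close> is injective. Equality of fractions therefore reduces to
  cross-multiplication.\<close>

lemma S_cancel:
  assumes "u \<in> S" "a \<in> A" "b \<in> A"
  shows "u * a = u * b \<longleftrightarrow> a = b"
  using contract[OF upset_empty assms(1), of "a - b"] assms
  by (auto simp: mspan_empty algebra_simps)

lemma frac_rel_iff: "((a, s), (b, t)) \<in> frac_rel P (outside_origin V) \<longleftrightarrow>
    a \<in> A \<and> s \<in> S \<and> b \<in> A \<and> t \<in> S \<and> t * a = s * b"
proof -
  have "(\<exists>u\<in>S. u * (t * a) = u * (s * b)) \<longleftrightarrow> t * a = s * b" if "a \<in> A" "s \<in> S" "b \<in> A" "t \<in> S"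
    using S_cancel[of _ "t * a" "s * b"] that S_one by (blast intro: S_A)
  then show ?thesis unfolding frac_rel_def outside_origin_S carrier_polynomial_ring by auto
qed

lemma equiv_frac_rel: "equiv (A \<times> S) (frac_rel P (outside_origin V))"
proof (rule equivI)
  show "frac_rel P (outside_origin V) \<subseteq> (A \<times> S) \<times> (A \<times> S)"
    by (auto simp: frac_rel_iff)
  show "refl_on (A \<times> S) (frac_rel P (outside_origin V))"
    by (auto simp: refl_on_def frac_rel_iff)
  show "sym (frac_rel P (outside_origin V))"
    by (auto simp: sym_def frac_rel_iff)
  show "trans (frac_rel P (outside_origin V))"
  proof (rule transI, clarsimp simp: frac_rel_iff)
    fix a s b t c u
    assume H: "s \<in> S" "t \<in> S" "u \<in> S" "a \<in> A" "c \<in> A" "t * a = s * b" "u * b = t * c"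
    have "t * (u * a) = u * (t * a)" by (simp add: mult_ac)
    also have "\<dots> = s * (u * b)" using H(6) by (simp add: mult_ac)
    also have "\<dots> = t * (s * c)" using H(7) by (simp add: mult_ac)
    finally show "u * a = s * c" using S_cancel[of t "u * a" "s * c"] H by (auto intro: S_A)
  qed
qed

lemma fr_eq_iff:
  assumes "a \<in> A" "s \<in> S" "b \<in> A" "t \<in> S"
  shows "fr a s = fr b t \<longleftrightarrow> t * a = s * b"
  unfolding fr_def fraction_def
  using eq_equiv_class_iff[OF equiv_frac_rel, of "(a, s)" "(b, t)"] assms by (simp add: frac_rel_iff)

lemma in_fr_iff:
  assumes "a \<in> A" "s \<in> S"
  shows "(b, t) \<in> fr a s \<longleftrightarrow> b \<in> A \<and> t \<in> S \<and> t * a = s * b"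
  unfolding fr_def fraction_def using assms by (auto simp: frac_rel_iff)

lemma carrier_R: "carrier R = {fr a s |a s. a \<in> A \<and> s \<in> S}"
  unfolding local_ring_def localization_def outside_origin_S[symmetric]
  by (auto simp: quotient_def fr_def fraction_def carrier_polynomial_ring)

lemma fr_closed [simp, intro]: "a \<in> A \<Longrightarrow> s \<in> S \<Longrightarrow> fr a s \<in> carrier R"
  by (auto simp: carrier_R)

lemma one_R: "\<one>\<^bsub>R\<^esub> = fr 1 1" and zero_R: "\<zero>\<^bsub>R\<^esub> = fr 0 1"
  by (simp_all add: local_ring_def localization_def fr_def)

text \<open>The operations of \<open>localization\<close> are unions over all representatives. If
  every choice of representatives yields the same class, the union is that class.\<close>

lemma UN_fr_eq:
  assumes "a \<in> A" "s \<in> S" "b \<in> A" "t \<in> S"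
    and "\<And>a' s' b' t'. a' \<in> A \<Longrightarrow> s' \<in> S \<Longrightarrow> b' \<in> A \<Longrightarrow> t' \<in> S \<Longrightarrow>
      s' * a = s * a' \<Longrightarrow> t' * b = t * b' \<Longrightarrow> f a' s' b' t' = c"
  shows "(\<Union>(a', s')\<in>fr a s. \<Union>(b', t')\<in>fr b t. f a' s' b' t') = c"
proof -
  have "(\<Union>(b', t')\<in>fr b t. f a' s' b' t') = c" if "(a', s') \<in> fr a s" for a' s'
  proof (rule UN_constant_eq[of "(b, t)"])
    show "(b, t) \<in> fr b t" using assms by (simp add: in_fr_iff)
    show "\<forall>x\<in>fr b t. (case x of (b', t') \<Rightarrow> f a' s' b' t') = c"
      using that assms by (auto simp: in_fr_iff)
  qed
  moreover have "(a, s) \<in> fr a s" using assms by (simp add: in_fr_iff)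
  ultimately show ?thesis by (intro UN_constant_eq[of "(a, s)"] ballI) (simp_all only: split_paired_all case_prod_conv)
qed

lemma mult_R:
  assumes "a \<in> A" "s \<in> S" "b \<in> A" "t \<in> S"
  shows "fr a s \<otimes>\<^bsub>R\<^esub> fr b t = fr (a * b) (s * t)"
  unfolding local_ring_def localization_def monoid.simps polynomial_ring_simps fr_def[symmetric]
proof (rule UN_fr_eq[OF assms])
  fix a' s' b' t'
  assume H: "a' \<in> A" "s' \<in> S" "b' \<in> A" "t' \<in> S" "s' * a = s * a'" "t' * b = t * b'"
  have "(s * t) * (a' * b') = (s * a') * (t * b')" by (simp add: mult_ac)
  also have "\<dots> = (s' * t') * (a * b)" unfolding H(5,6)[symmetric] by (simp add: mult_ac)
  finally show "fr (a' * b') (s' * t') = fr (a * b) (s * t)" using H assms by (simp add: fr_eq_iff)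
qed

lemma add_R:
  assumes "a \<in> A" "s \<in> S" "b \<in> A" "t \<in> S"
  shows "fr a s \<oplus>\<^bsub>R\<^esub> fr b t = fr (a * t + b * s) (s * t)"
  unfolding local_ring_def localization_def ring_record_simps polynomial_ring_simps fr_def[symmetric]
proof (rule UN_fr_eq[OF assms])
  fix a' s' b' t'
  assume H: "a' \<in> A" "s' \<in> S" "b' \<in> A" "t' \<in> S" "s' * a = s * a'" "t' * b = t * b'"
  have "(s * t) * (a' * t' + b' * s') = (s * a') * (t * t') + (t * b') * (s * s')"
    by (simp add: algebra_simps)
  also have "\<dots> = (s' * t') * (a * t + b * s)"
    unfolding H(5,6)[symmetric] by (simp add: algebra_simps)
  finally show "fr (a' * t' + b' * s') (s' * t') = fr (a * t + b * s) (s * t)"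
    using H assms by (simp add: fr_eq_iff S_A)
qed

lemma carrier_R_cases:
  assumes "x \<in> carrier R"
  obtains a s where "a \<in> A" "s \<in> S" "x = fr a s"
  using assms by (auto simp: carrier_R)

lemma cring_R: "cring R"
proof (rule cringI)
  show "abelian_group R"
  proof (rule abelian_groupI)
    fix x assume "x \<in> carrier R"
    then obtain a s where x: "a \<in> A" "s \<in> S" "x = fr a s" by (rule carrier_R_cases)
    then show "\<zero>\<^bsub>R\<^esub> \<oplus>\<^bsub>R\<^esub> x = x" by (simp add: zero_R add_R)
    show "\<exists>y\<in>carrier R. y \<oplus>\<^bsub>R\<^esub> x = \<zero>\<^bsub>R\<^esub>"
      by (rule bexI[of _ "fr (- a) s"]) (use x in \<open>auto simp: zero_R add_R fr_eq_iff S_A\<close>)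
  qed (auto elim!: carrier_R_cases simp: add_R zero_R fr_eq_iff S_A algebra_simps)
  show "comm_monoid R"
    by (rule comm_monoidI)
      (auto elim!: carrier_R_cases simp: mult_R one_R fr_eq_iff S_A algebra_simps)
  fix x y z assume "x \<in> carrier R" "y \<in> carrier R" "z \<in> carrier R"
  then obtain a s b t c u where xyz: "a \<in> A" "s \<in> S" "x = fr a s" "b \<in> A" "t \<in> S" "y = fr b t"
    "c \<in> A" "u \<in> S" "z = fr c u" by (metis carrier_R_cases)
  have "(s * u) * (t * u) * ((a * t + b * s) * c) = (s * t) * u * (a * c * (t * u) + b * c * (s * u))"
    by (simp add: algebra_simps)
  then show "(x \<oplus>\<^bsub>R\<^esub> y) \<otimes>\<^bsub>R\<^esub> z = x \<otimes>\<^bsub>R\<^esub> z \<oplus>\<^bsub>R\<^esub> y \<otimes>\<^bsub>R\<^esub> z"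
    using xyz by (simp add: mult_R add_R S_A fr_eq_iff)
qed

sublocale R: cring R by (rule cring_R)

section \<open>Monomial ideals of the local ring\<close>

definition ext :: "('v \<Rightarrow>\<^sub>0 nat) set \<Rightarrow> (('v, 'k) mpoly_rep \<times> ('v, 'k) mpoly_rep) set set" where
  "ext X = {fr a s |a s. a \<in> mspan X \<and> s \<in> S}"

lemma in_A: "upset V X \<Longrightarrow> a \<in> mspan X \<Longrightarrow> a \<in> A"
  using mspan_subset[OF upset_subset] by blast

lemma mspan_ideal: "upset V X \<Longrightarrow> a \<in> mspan X \<Longrightarrow> b \<in> A \<Longrightarrow> a * b \<in> mspan X"
  "upset V X \<Longrightarrow> a \<in> mspan X \<Longrightarrow> b \<in> A \<Longrightarrow> b * a \<in> mspan X"
  unfolding mult.commute[of b a] by (auto intro!: mspan_mult[of a X b] upsetD)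

text \<open>Denominators can be cancelled by \<open>contract\<close>, so the numerator of any
  representative decides. Extension is therefore faithful on monomial ideals.\<close>

lemma fr_in_ext_iff:
  assumes "upset V X" "a \<in> A" "s \<in> S"
  shows "fr a s \<in> ext X \<longleftrightarrow> a \<in> mspan X"
proof
  assume "fr a s \<in> ext X"
  then obtain b t where b: "b \<in> mspan X" "t \<in> S" "fr a s = fr b t" by (auto simp: ext_def)
  then have "t * a = s * b" using in_A[OF assms(1)] assms by (simp add: fr_eq_iff)
  then show "a \<in> mspan X"
    using contract[OF assms(1) b(2) assms(2)] mspan_ideal(2)[OF assms(1) b(1)] assms(3) S_A by simp
qed (use assms in \<open>auto simp: ext_def\<close>)

lemma ext_subset_carrier: "upset V X \<Longrightarrow> ext X \<subseteq> carrier R"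
  using in_A by (auto simp: ext_def)

lemma ext_mons: "ext (mons V) = carrier R"
  by (auto simp: ext_def carrier_R)

lemma ext_subset_iff:
  assumes "upset V X" "upset V Y"
  shows "ext X \<subseteq> ext Y \<longleftrightarrow> X \<subseteq> Y"
proof
  assume sub: "ext X \<subseteq> ext Y"
  show "X \<subseteq> Y"
  proof
    fix m assume m: "m \<in> X"
    then have mA: "single m 1 \<in> A"
      using upset_subset[OF assms(1)] by (auto intro: mspan_single)
    have "fr (single m 1) 1 \<in> ext X"
      using m mA by (simp add: fr_in_ext_iff[OF assms(1)] mspan_single)
    then show "m \<in> Y" using sub mA fr_in_ext_iff[OF assms(2) mA S_one] by (auto simp: mspan_def)
  qed
qed (auto simp: ext_def mspan_def)

lemma ideal_ext:
  assumes X: "upset V X"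
  shows "ideal (ext X) R"
proof (rule R.cring_idealI[OF ext_subset_carrier[OF X]])
  show "\<zero>\<^bsub>R\<^esub> \<in> ext X" using mspan_0[of X] S_one unfolding zero_R ext_def by blast
  fix x y assume x: "x \<in> ext X"
  then obtain a s where a: "a \<in> mspan X" "s \<in> S" "x = fr a s" by (auto simp: ext_def)
  { assume "y \<in> ext X"
    then obtain b t where b: "b \<in> mspan X" "t \<in> S" "y = fr b t" by (auto simp: ext_def)
    then show "x \<oplus>\<^bsub>R\<^esub> y \<in> ext X"
      using a in_A[OF X] mspan_ideal[OF X]
      by (simp add: add_R fr_in_ext_iff[OF X] S_A mspan_add) }
  { assume "y \<in> carrier R"
    then obtain b t where b: "b \<in> A" "t \<in> S" "y = fr b t" by (rule carrier_R_cases)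
    then show "y \<otimes>\<^bsub>R\<^esub> x \<in> ext X"
      using a in_A[OF X] mspan_ideal[OF X] by (simp add: mult_R fr_in_ext_iff[OF X]) }
qed

text \<open>A numerator in the span is a finite combination of monomials, and both the constants and
  1 / s are elements of the ring. So it is enough to test the monomials.\<close>

lemma ext_subset_ideal:
  assumes I: "ideal I R" and X: "X \<subseteq> mons V" and mem: "\<And>m. m \<in> X \<Longrightarrow> fr (single m 1) 1 \<in> I"
  shows "ext X \<subseteq> I"
proof
  interpret I: ideal I R by (rule I)
  fix x assume "x \<in> ext X"
  then obtain a s where a: "a \<in> mspan X" "s \<in> S" "x = fr a s" by (auto simp: ext_def)
  have XA: "mspan X \<subseteq> A" by (rule mspan_subset[OF X])
  have single: "single m c \<in> mspan X" if "m \<in> X" for m and c :: 'k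
    using that by (rule mspan_single)
  \<comment> \<open>The else branch is never reached, since sums of monomials from \<open>X\<close>
    lie in \<open>A\<close>.\<close>
  have "(if p \<in> A then fr p 1 else undefined) \<in> I" if p: "p = (\<Sum>m\<in>F. single m (c m))" "F \<subseteq> X" for F c p
    using that
  proof (induction F arbitrary: p rule: infinite_finite_induct)
    case (insert m F)
    have pA: "(\<Sum>m\<in>F. single m (c m)) \<in> A"
      using insert.prems single XA by (intro mspan_sum) auto
    have mA: "single m (c m) \<in> A" "single m (1::'k) \<in> A" using insert.prems single XA by auto
    have cA: "single 0 (c m) \<in> A" by (simp add: mspan_single)
    have "fr (single 0 (c m)) 1 \<otimes>\<^bsub>R\<^esub> fr (single m 1) 1 \<in> I"
      using insert.prems mem cA by (intro I.I_l_closed) auto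
    then have 1: "fr (single m (c m)) 1 \<in> I"
      using mA cA by (simp add: mult_R mult_single)
    have 2: "fr (\<Sum>m\<in>F. single m (c m)) 1 \<in> I"
      using insert.IH[OF refl] insert.prems pA by auto
    have "fr (single m (c m)) 1 \<oplus>\<^bsub>R\<^esub> fr (\<Sum>m\<in>F. single m (c m)) 1 \<in> I"
      using 1 2 by (rule I.a_closed)
    then show ?case using insert mA pA by (simp add: add_R)
  qed (use I.zero_closed in \<open>auto simp: zero_R\<close>)
  from this[OF poly_mapping_sum_single[of a]] have "fr a 1 \<in> I"
    using a(1) XA by (auto simp: mspan_def)
  moreover have "fr 1 s \<in> carrier R" using a by auto
  ultimately have "fr 1 s \<otimes>\<^bsub>R\<^esub> fr a 1 \<in> I" by (rule I.I_l_closed)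
  then show "x \<in> I" using a XA by (simp add: mult_R subset_iff)
qed

lemma genideal_R:
  assumes "B \<subseteq> mons V"
  shows "genideal R ((\<lambda>m. fr (single m 1) 1) ` B) = ext (up_monos V B)" (is "genideal R ?G = _")
proof
  have up: "upset V (up_monos V B)" by (rule upset_up[OF assms])
  have BA: "single m 1 \<in> A" if "m \<in> B" for m
    using assms that by (auto intro: mspan_single)
  have G: "?G \<subseteq> carrier R" using BA by auto
  show "genideal R ?G \<subseteq> ext (up_monos V B)"
    using up_monos_superset[of B V] BA
    by (intro R.genideal_minimal[OF ideal_ext[OF up]])
      (auto simp: fr_in_ext_iff[OF up] intro!: mspan_single)
  interpret I: ideal "genideal R ?G" R by (rule R.genideal_ideal[OF G])
  show "ext (up_monos V B) \<subseteq> genideal R ?G"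
  proof (rule ext_subset_ideal[OF I.is_ideal upset_subset[OF up]])
    fix m assume "m \<in> up_monos V B"
    then obtain b w where bw: "m = b + w" "b \<in> B" "w \<in> mons V" by (auto simp: up_monos_def)
    have wA: "single w 1 \<in> A" using bw by (simp add: mspan_single)
    have "fr (single w 1) 1 \<otimes>\<^bsub>R\<^esub> fr (single b 1) 1 \<in> genideal R ?G"
      using bw wA R.genideal_self[OF G] by (intro I.I_l_closed) auto
    then show "fr (single m 1) 1 \<in> genideal R ?G"
      using wA BA[OF bw(2)] by (simp add: mult_R mult_single bw(1) add.commute)
  qed
qed

text \<open>Multiplying monomials adds exponents, so a product of monomial ideals becomes a sumset.
  The powers of the edge ideal and of the maximal ideal are computed from this.\<close>

lemma ideal_prod_ext:
  assumes X: "upset V X" and Y: "upset V Y"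
  shows "ideal_prod R (ext X) (ext Y) = ext {x + y |x y. x \<in> X \<and> y \<in> Y}" (is "_ = ext ?Z")
    and "upset V {x + y |x y. x \<in> X \<and> y \<in> Y}"
proof -
  have sub: "X \<subseteq> mons V" "Y \<subseteq> mons V" using X Y by (auto simp: upset_def)
  show Z: "upset V ?Z"
    unfolding upset_def
  proof (intro conjI ballI)
    show "?Z \<subseteq> mons V" using sub by auto
    fix m w assume "m \<in> ?Z" and w: "w \<in> mons V"
    then obtain x y where "m = x + y" "x \<in> X" "y \<in> Y" by auto
    then show "m + w \<in> ?Z" using upsetD[OF Y _ w] by (auto simp: add.assoc)
  qed
  interpret Z: ideal "ext ?Z" R by (rule ideal_ext[OF Z])
  interpret P: ideal "ideal_prod R (ext X) (ext Y)" R
    by (rule R.ideal_prod_is_ideal[OF ideal_ext[OF X] ideal_ext[OF Y]])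
  show "ideal_prod R (ext X) (ext Y) = ext ?Z"
  proof
    show "ideal_prod R (ext X) (ext Y) \<subseteq> ext ?Z"
    proof
      fix z assume "z \<in> ideal_prod R (ext X) (ext Y)"
      then show "z \<in> ext ?Z"
      proof induction
        case (prod i j)
        then obtain a s b t where ab: "a \<in> mspan X" "s \<in> S" "i = fr a s"
          "b \<in> mspan Y" "t \<in> S" "j = fr b t" by (auto simp: ext_def)
        then have "a * b \<in> mspan ?Z" by (intro mspan_mult[of a X b Y]) auto
        then show ?case using ab in_A[OF X] in_A[OF Y] by (auto simp: mult_R ext_def)
      qed (rule Z.a_closed)
    qed
    show "ext ?Z \<subseteq> ideal_prod R (ext X) (ext Y)"
    proof (rule ext_subset_ideal[OF P.is_ideal upset_subset[OF Z]])
      fix m assume "m \<in> ?Z"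
      then obtain x y where xy: "m = x + y" "x \<in> X" "y \<in> Y" by auto
      have A: "single x 1 \<in> A" "single y 1 \<in> A"
        using xy sub by (auto intro: mspan_single)
      have "fr (single x 1) 1 \<otimes>\<^bsub>R\<^esub> fr (single y 1) 1
          \<in> ideal_prod R (ext X) (ext Y)"
        by (intro ideal_prod.prod) (use xy A in \<open>auto simp: fr_in_ext_iff X Y mspan_single\<close>)
      then show "fr (single m 1) 1 \<in> ideal_prod R (ext X) (ext Y)"
        using A by (simp add: mult_R mult_single xy(1))
    qed
  qed
qed

lemma upset_nonzero: "upset V (mons V - {0})"
proof -
  have "m + w \<noteq> 0" if "m \<noteq> 0" for m w :: "'v \<Rightarrow>\<^sub>0 nat"
    using that keys_add_nat[of m w] by (metis Un_empty keys_eq_empty)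
  then show ?thesis by (auto simp: upset_def)
qed

text \<open>A numerator with non-zero constant term makes a fraction invertible, so proper ideals
  avoid such numerators. This is the locality of the ring, and it gives the \<open>THE\<close> in
  \<open>max_ideal\<close> a unique candidate.\<close>

lemma proper_ideal_subset:
  assumes "ideal I R" "I \<noteq> carrier R"
  shows "I \<subseteq> ext (mons V - {0})"
proof
  interpret I: ideal I R by fact
  fix x assume x: "x \<in> I"
  then obtain a s where a: "a \<in> A" "s \<in> S" "x = fr a s" using I.Icarr by (blast elim: carrier_R_cases)
  have "a \<notin> S"
  proof
    assume aS: "a \<in> S"
    have "fr s a \<otimes>\<^bsub>R\<^esub> x \<in> I" using x aS a by (intro I.I_l_closed) (auto intro: S_A)
    moreover have "fr s a \<otimes>\<^bsub>R\<^esub> x = \<one>\<^bsub>R\<^esub>"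
      using aS a by (simp add: mult_R S_A one_R fr_eq_iff mult.commute)
    ultimately show False using I.one_imp_carrier assms(2) by simp
  qed
  then have "a \<in> mspan (mons V - {0})" using a by (auto simp: S_def mspan_def in_keys_iff)
  then show "x \<in> ext (mons V - {0})" using a by (auto simp: ext_def)
qed

lemma carrier_neq_ext:
  assumes "upset V X" "0 \<notin> X"
  shows "carrier R \<noteq> ext X"
proof -
  have "1 \<notin> (mspan X :: ('v, 'k) mpoly_rep set)" using assms(2) by (simp add: mspan_def)
  then have "fr 1 1 \<notin> ext X" by (simp add: fr_in_ext_iff[OF assms(1)])
  moreover have "fr 1 1 \<in> carrier R" by simp
  ultimately show ?thesis by metis
qed

lemma max_ideal_R: "max_ideal R = ext (mons V - {0})"
proof -
  have ne: "carrier R \<noteq> ext (mons V - {0})"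
    by (rule carrier_neq_ext[OF upset_nonzero]) simp
  have max: "maximalideal (ext (mons V - {0})) R"
  proof (rule maximalidealI[OF ideal_ext[OF upset_nonzero] ne])
    fix J assume "ideal J R" "ext (mons V - {0}) \<subseteq> J" "J \<subseteq> carrier R"
    then show "J = ext (mons V - {0}) \<or> J = carrier R" using proper_ideal_subset by blast
  qed
  moreover have "M = ext (mons V - {0})" if "maximalideal M R" for M
  proof -
    interpret M: maximalideal M R by (rule that)
    show ?thesis
      using M.I_maximal[OF ideal_ext[OF upset_nonzero]] proper_ideal_subset[OF M.is_ideal]
        M.I_notcarr ne ext_subset_carrier[OF upset_nonzero] by metis
  qed
  ultimately show ?thesis unfolding max_ideal_def by (rule the_equality)
qed

lemma primeideal_ext:
  assumes "X = {m\<in>mons V. keys m \<inter> W \<noteq> {}}"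
  shows "primeideal (ext X) R"
proof (rule primeidealI)
  have X: "upset V X" unfolding assms by (rule upset_meeting)
  show "ideal (ext X) R" by (rule ideal_ext[OF X])
  show "cring R" by (rule cring_R)
  show "carrier R \<noteq> ext X" by (rule carrier_neq_ext[OF X]) (simp add: assms)
  fix x y assume xy: "x \<in> carrier R" "y \<in> carrier R" "x \<otimes>\<^bsub>R\<^esub> y \<in> ext X"
  obtain a s where a: "a \<in> A" "s \<in> S" "x = fr a s" using xy(1) by (rule carrier_R_cases)
  obtain b t where b: "b \<in> A" "t \<in> S" "y = fr b t" using xy(2) by (rule carrier_R_cases)
  have "a * b \<in> mspan X" using xy(3) a b by (simp add: mult_R fr_in_ext_iff[OF X])
  then show "x \<in> ext X \<or> y \<in> ext X"
    using mspan_prime[OF finite_V a(1) b(1) assms] a b by (simp add: fr_in_ext_iff[OF X])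
qed

end

section \<open>Lengths\<close>

text \<open>Chains of submodules of the quotient P / N, lifted to the ring.\<close>

definition ideal_chain :: "('a, 'm) ring_scheme \<Rightarrow> 'a set \<Rightarrow> 'a set \<Rightarrow> nat \<Rightarrow> (nat \<Rightarrow> 'a set) \<Rightarrow> bool" where
  "ideal_chain R N P l D \<longleftrightarrow>
     (\<forall>i\<le>l. ideal (D i) R \<and> N \<subseteq> D i \<and> D i \<subseteq> P) \<and> (\<forall>i<l. D i \<subset> D (Suc i))"

text \<open>Submodules of P / N correspond to the ideals between N and P, with strict inclusions
  preserved. This moves the computation of lengths into the ring, where no cosets occur.\<close>

lemma (in cring) module_length_eq_ideal_chains:
  fixes M :: "('a, 'a set, 'n) module_scheme"
  assumes N: "ideal N R" and P: "ideal P R" and NP: "N \<subseteq> P"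
    and M: "carrier M = (\<lambda>x. N +> x) ` P" "\<zero>\<^bsub>M\<^esub> = N" "add M = set_add R"
      "\<And>a x. a \<in> carrier R \<Longrightarrow> x \<in> P \<Longrightarrow> a \<odot>\<^bsub>M\<^esub> (N +> x) = N +> (a \<otimes> x)"
  shows "module_length R M = Sup {enat l |l. \<exists>D. ideal_chain R N P l D}"
proof -
  interpret N: ideal N R by (rule N)
  interpret P: ideal P R by (rule P)
  have coset_eq: "N +> x = N +> y \<longleftrightarrow> x \<ominus> y \<in> N" if "x \<in> carrier R" "y \<in> carrier R" for x y
    using quotient_eq_iff_same_a_r_cos[OF N that] by simp
  have coset_zero: "N +> x = N \<longleftrightarrow> x \<in> N" if "x \<in> carrier R" for x
    using N.rcos_const_imp_mem[OF that] a_rcos_zero[OF N] by blast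
  have add: "(N +> x) \<oplus>\<^bsub>M\<^esub> (N +> y) = N +> (x \<oplus> y)" if "x \<in> carrier R" "y \<in> carrier R" for x y
    using N.a_rcos_sum[OF that] by (simp add: M(3))
  \<comment> \<open>Subgroups refer to the inverse in \<open>add_monoid M\<close>, which is a
    definite description. Its value is determined directly, since M is not known to be a group at
    this point.\<close>
  have inv: "inv\<^bsub>add_monoid M\<^esub> (N +> x) = N +> (\<ominus> x)" if x: "x \<in> P" for x
    unfolding m_inv_def
  proof (rule the_equality)
    have xR: "x \<in> carrier R" using x by (rule P.Icarr)
    show "N +> (\<ominus> x) \<in> carrier (add_monoid M) \<and>
      (N +> x) \<otimes>\<^bsub>add_monoid M\<^esub> (N +> (\<ominus> x)) = \<one>\<^bsub>add_monoid M\<^esub> \<and>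
      (N +> (\<ominus> x)) \<otimes>\<^bsub>add_monoid M\<^esub> (N +> x) = \<one>\<^bsub>add_monoid M\<^esub>"
      using x xR by (auto simp: M(1,2) add r_neg l_neg coset_zero)
    fix Y assume Y: "Y \<in> carrier (add_monoid M) \<and>
      (N +> x) \<otimes>\<^bsub>add_monoid M\<^esub> Y = \<one>\<^bsub>add_monoid M\<^esub> \<and> Y \<otimes>\<^bsub>add_monoid M\<^esub> (N +> x) = \<one>\<^bsub>add_monoid M\<^esub>"
    then obtain y where y: "y \<in> P" "Y = N +> y" by (auto simp: M(1))
    have yR: "y \<in> carrier R" using y(1) by (rule P.Icarr)
    have "N +> (y \<oplus> x) = N" using Y y(2) add[OF yR xR] by (simp add: M(2))
    then have "y \<oplus> x \<in> N" using coset_zero xR yR by simp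
    then have "y \<ominus> (\<ominus> x) \<in> N" using xR yR by (simp add: a_minus_def)
    then show "Y = N +> (\<ominus> x)" using coset_eq xR yR y(2) by simp
  qed
  have sub_of_ideal: "submodule ((\<lambda>x. N +> x) ` D) R M" if D: "ideal D R" "N \<subseteq> D" "D \<subseteq> P" for D
  proof (intro submodule.intro subgroup.intro submodule_axioms.intro)
    interpret D: ideal D R by (rule D)
    show "(\<lambda>x. N +> x) ` D \<subseteq> carrier (add_monoid M)" using D by (auto simp: M(1))
    show "\<one>\<^bsub>add_monoid M\<^esub> \<in> (\<lambda>x. N +> x) ` D"
      using D coset_zero[of \<zero>] by (auto simp: M(2) intro!: image_eqI[of _ _ \<zero>])
    show "X \<otimes>\<^bsub>add_monoid M\<^esub> Y \<in> (\<lambda>x. N +> x) ` D"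
      if "X \<in> (\<lambda>x. N +> x) ` D" "Y \<in> (\<lambda>x. N +> x) ` D" for X Y
      using that D.Icarr add by auto
    show "inv\<^bsub>add_monoid M\<^esub> X \<in> (\<lambda>x. N +> x) ` D" if "X \<in> (\<lambda>x. N +> x) ` D" for X
      using that D inv by auto
    show "a \<odot>\<^bsub>M\<^esub> X \<in> (\<lambda>x. N +> x) ` D" if "a \<in> carrier R" "X \<in> (\<lambda>x. N +> x) ` D" for a X
      using that D M(4) D.I_l_closed by auto
  qed
  define pull where "pull C = {x\<in>P. N +> x \<in> C}" for C
  have pull: "ideal (pull C) R" "N \<subseteq> pull C" "pull C \<subseteq> P" "C = (\<lambda>x. N +> x) ` pull C"
    if C: "submodule C R M" for C
  proof -
    interpret C: submodule C R M by (rule C)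
    have NC: "N \<in> C" using C.one_closed by (simp add: M(2))
    show "pull C \<subseteq> P" by (auto simp: pull_def)
    show "N \<subseteq> pull C"
    proof
      fix x assume x: "x \<in> N"
      then have "N +> x = N" using coset_zero N.Icarr by simp
      then show "x \<in> pull C" using x NP NC by (auto simp: pull_def)
    qed
    show "C = (\<lambda>x. N +> x) ` pull C" using C.subset by (auto simp: pull_def M(1))
    show "ideal (pull C) R"
    proof (rule cring_idealI)
      show "pull C \<subseteq> carrier R" using P.Icarr by (auto simp: pull_def)
      show "\<zero> \<in> pull C" using NC coset_zero[of \<zero>] by (auto simp: pull_def)
      fix x y assume x: "x \<in> pull C"
      { assume "y \<in> pull C"
        then show "x \<oplus> y \<in> pull C"
          using x C.m_closed[of "N +> x" "N +> y"] P.Icarr by (auto simp: pull_def add) }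
      { assume y: "y \<in> carrier R"
        then show "y \<otimes> x \<in> pull C"
          using x C.smult_closed[of y "N +> x"] P.I_l_closed by (auto simp: pull_def M(4)) }
    qed
  qed
  have "(\<exists>C. (\<forall>i\<le>l. submodule (C i) R M) \<and> (\<forall>i<l. C i \<subset> C (Suc i)))
      \<longleftrightarrow> (\<exists>D. ideal_chain R N P l D)" for l :: nat
  proof
    assume "\<exists>C. (\<forall>i\<le>l. submodule (C i) R M) \<and> (\<forall>i<l. C i \<subset> C (Suc i))"
    then obtain C where C: "\<And>i. i \<le> l \<Longrightarrow> submodule (C i) R M" "\<And>i. i < l \<Longrightarrow> C i \<subset> C (Suc i)" by blast
    have "pull (C i) \<subset> pull (C (Suc i))" if i: "i < l" for i
    proof -
      have "pull (C i) \<subseteq> pull (C (Suc i))" using C(2)[OF i] by (auto simp: pull_def)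
      moreover have "pull (C i) \<noteq> pull (C (Suc i))"
        using pull(4)[OF C(1), of i] pull(4)[OF C(1), of "Suc i"] C(2)[OF i] i by auto
      ultimately show ?thesis by blast
    qed
    then have "ideal_chain R N P l (\<lambda>i. pull (C i))"
      using pull C(1) by (simp add: ideal_chain_def)
    then show "\<exists>D. ideal_chain R N P l D" by blast
  next
    assume "\<exists>D. ideal_chain R N P l D"
    then obtain D where D: "\<And>i. i \<le> l \<Longrightarrow> ideal (D i) R \<and> N \<subseteq> D i \<and> D i \<subseteq> P"
      "\<And>i. i < l \<Longrightarrow> D i \<subset> D (Suc i)" by (auto simp: ideal_chain_def)
    have "(\<lambda>x. N +> x) ` D i \<subset> (\<lambda>x. N +> x) ` D (Suc i)" if i: "i < l" for i
    proof -
      interpret D: ideal "D i" R using D(1) i by simp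
      interpret D': ideal "D (Suc i)" R using D(1) i by simp
      obtain x where x: "x \<in> D (Suc i)" "x \<notin> D i" using D(2)[OF i] by blast
      \<comment> \<open>Elements with the same coset differ by an element of \<open>N\<close>, which
        lies in \<open>D i\<close>.\<close>
      have "N +> x \<notin> (\<lambda>x. N +> x) ` D i"
      proof
        assume "N +> x \<in> (\<lambda>x. N +> x) ` D i"
        then obtain y where y: "y \<in> D i" "N +> x = N +> y" by blast
        have xy: "x \<in> carrier R" "y \<in> carrier R" using x y D.Icarr D'.Icarr by auto
        then have "x \<ominus> y \<in> D i" using coset_eq y(2) D(1)[of i] i by auto
        then have "(x \<ominus> y) \<oplus> y \<in> D i" using y(1) by (rule D.a_closed)
        then show False using x(2) xy by (simp add: a_minus_def a_assoc l_neg)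
      qed
      then show ?thesis using D(2)[OF i] x(1) by blast
    qed
    then show "\<exists>C. (\<forall>i\<le>l. submodule (C i) R M) \<and> (\<forall>i<l. C i \<subset> C (Suc i))"
      using sub_of_ideal D(1) by (intro exI[of _ "\<lambda>i. (\<lambda>x. N +> x) ` D i"]) simp
  qed
  then show ?thesis unfolding module_length_def by simp
qed

text \<open>\<open>P\<close> is the preimage in \<open>L\<close> of the torsion of L / N, with the
  annihilation condition restated in the ring.\<close>

lemma (in cring) module_length_torsion_quotient:
  assumes N: "ideal N R" and L: "ideal L R" and P: "ideal P R" and NP: "N \<subseteq> P"
    and P_eq: "P = {x\<in>L. \<exists>k. \<forall>a\<in>ideal_power R J k. a \<otimes> x \<in> N}"
    and J: "\<And>k. ideal_power R J k \<subseteq> carrier R"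
  shows "module_length R (local_cohomology_zero R J
      (quotient_module (self_module R \<lparr>carrier := L\<rparr>) N)) = Sup {enat l |l. \<exists>D. ideal_chain R N P l D}"
proof (rule module_length_eq_ideal_chains[OF N P NP])
  interpret N: ideal N R by (rule N)
  interpret L: ideal L R by (rule L)
  let ?M0 = "self_module R \<lparr>carrier := L\<rparr>"
  let ?Q = "quotient_module ?M0 N"
  have coset: "N +>\<^bsub>?M0\<^esub> x = N +> x" for x
    by (simp add: a_r_coset_def r_coset_def self_module_def)
  have coset_zero: "N +> x = N \<longleftrightarrow> x \<in> N" if "x \<in> carrier R" for x
    using N.rcos_const_imp_mem[OF that] a_rcos_zero[OF N] by blast
  \<comment> \<open>Scalar multiplication of a coset is a union over its elements; all of them give
    the same coset because \<open>N\<close> absorbs multiples.\<close>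
  have smult: "a \<odot>\<^bsub>?Q\<^esub> (N +> x) = N +> (a \<otimes> x)" if a: "a \<in> carrier R" and x: "x \<in> carrier R" for a x
  proof -
    have "(\<Union>y\<in>N +> x. N +> (a \<otimes> y)) = N +> (a \<otimes> x)"
    proof (rule UN_constant_eq)
      show "x \<in> N +> x" by (rule N.a_rcos_self[OF x])
      show "\<forall>y\<in>N +> x. N +> (a \<otimes> y) = N +> (a \<otimes> x)"
      proof
        fix y assume "y \<in> N +> x"
        then obtain n where n: "n \<in> N" "y = n \<oplus> x" by (auto simp: a_r_coset_def')
        have nR: "n \<in> carrier R" using n(1) by (rule N.Icarr)
        have "a \<otimes> y \<ominus> a \<otimes> x = a \<otimes> n"
          using a x nR unfolding n(2) by (simp add: r_distr a_minus_def a_assoc r_neg)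
        then have "a \<otimes> y \<ominus> a \<otimes> x \<in> N" using N.I_l_closed[OF n(1) a] by simp
        then show "N +> (a \<otimes> y) = N +> (a \<otimes> x)"
          using quotient_eq_iff_same_a_r_cos[OF N, of "a \<otimes> y" "a \<otimes> x"] a x nR n(2) by simp
      qed
    qed
    then show ?thesis by (simp add: quotient_module_def coset) (simp add: self_module_def)
  qed
  have carQ: "carrier ?Q = (\<lambda>x. N +> x) ` L"
    by (auto simp: quotient_module_def A_RCOSETS_def RCOSETS_def a_r_coset_def r_coset_def self_module_def)
  have zeroQ: "\<zero>\<^bsub>?Q\<^esub> = N" by (simp add: quotient_module_def)
  show "carrier (local_cohomology_zero R J ?Q) = (\<lambda>x. N +> x) ` P"
  proof -
    have iff: "a \<odot>\<^bsub>?Q\<^esub> (N +> x) = \<zero>\<^bsub>?Q\<^esub> \<longleftrightarrow> a \<otimes> x \<in> N" if "a \<in> carrier R" "x \<in> L" for a x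
      using that smult coset_zero L.Icarr by (simp add: zeroQ)
    have "(\<forall>a\<in>ideal_power R J k. a \<odot>\<^bsub>?Q\<^esub> (N +> x) = \<zero>\<^bsub>?Q\<^esub>)
        \<longleftrightarrow> (\<forall>a\<in>ideal_power R J k. a \<otimes> x \<in> N)" if "x \<in> L" for k x
      using iff J that by (meson subsetD)
    moreover define killed where "killed X \<longleftrightarrow> (\<exists>k. \<forall>a\<in>ideal_power R J k. a \<odot>\<^bsub>?Q\<^esub> X = \<zero>\<^bsub>?Q\<^esub>)" for X
    ultimately have "P = {x\<in>L. killed (N +> x)}"
      unfolding P_eq by (intro Collect_cong conj_cong refl) simp
    moreover have "carrier (local_cohomology_zero R J ?Q) = {X\<in>(\<lambda>x. N +> x) ` L. killed X}"
      unfolding carQ[symmetric] by (simp add: local_cohomology_zero_def killed_def)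
    ultimately show ?thesis by auto
  qed
  show "\<zero>\<^bsub>local_cohomology_zero R J ?Q\<^esub> = N"
    by (simp add: local_cohomology_zero_def zeroQ)
  show "add (local_cohomology_zero R J ?Q) = set_add R"
    by (auto simp: local_cohomology_zero_def quotient_module_def set_add_def set_mult_def self_module_def fun_eq_iff)
  show "a \<odot>\<^bsub>local_cohomology_zero R J ?Q\<^esub> (N +> x) = N +> (a \<otimes> x)"
    if "a \<in> carrier R" "x \<in> P" for a x
    using smult that L.Icarr by (simp add: local_cohomology_zero_def P_eq)
qed

section \<open>Chains of ideals and linear algebra over the coefficient field\<close>

abbreviation mpoly_scale :: "'k \<Rightarrow> ('v, 'k::field) mpoly_rep \<Rightarrow> ('v, 'k) mpoly_rep" where
  "mpoly_scale c p \<equiv> single 0 c * p"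

lemma vector_space_mpoly: "vector_space (mpoly_scale :: 'k::field \<Rightarrow> ('v, 'k) mpoly_rep \<Rightarrow> _)"
  by standard (simp_all add: distrib_left distrib_right single_add mult.assoc[symmetric] mult_single)

text \<open>An element of \<open>U (Suc i)\<close> outside \<open>U i\<close> is outside the span of
  its predecessors, so the chosen elements are independent. Only they have to lie in a
  finite-dimensional span; the subspaces may be infinite-dimensional.\<close>

lemma (in vector_space) subspace_chain_length:
  assumes U: "\<And>i. i \<le> l \<Longrightarrow> subspace (U i)" and mono: "\<And>i. i < l \<Longrightarrow> U i \<subseteq> U (Suc i)"
    and b: "\<And>i. i < l \<Longrightarrow> b i \<in> U (Suc i) - U i" "\<And>i. i < l \<Longrightarrow> b i \<in> span B" and B: "finite B"
  shows "l \<le> card B"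
proof -
  have "independent (b ` {..<n}) \<and> card (b ` {..<n}) = n \<and> b ` {..<n} \<subseteq> U n" if "n \<le> l" for n
    using that
  proof (induction n)
    case (Suc n)
    then have IH: "independent (b ` {..<n})" "card (b ` {..<n}) = n" "b ` {..<n} \<subseteq> U n" by auto
    have bn: "b n \<in> U (Suc n)" "b n \<notin> U n" using b(1)[of n] Suc.prems by auto
    have "span (b ` {..<n}) \<subseteq> U n" by (rule span_minimal[OF IH(3) U]) (use Suc.prems in simp)
    then have notin: "b n \<notin> span (b ` {..<n})" using bn(2) by (rule contra_subsetD)
    have set: "b ` {..<Suc n} = insert (b n) (b ` {..<n})" by (simp add: lessThan_Suc)
    have "b n \<notin> b ` {..<n}" using notin span_base by (rule contrapos_nn)
    then have "card (b ` {..<Suc n}) = Suc n" unfolding set using IH(2) by simp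
    moreover have "independent (b ` {..<Suc n})" unfolding set using notin IH(1) by (rule independent_insertI)
    moreover have "b ` {..<Suc n} \<subseteq> U (Suc n)"
      unfolding set using IH(3) mono[of n] Suc.prems bn(1) by simp
    ultimately show ?case by simp
  qed (simp add: independent_empty)
  from this[of l] have "independent (b ` {..<l})" "card (b ` {..<l}) = l" by auto
  moreover have "b ` {..<l} \<subseteq> span B" using b(2) by auto
  ultimately show ?thesis using independent_span_bound[OF B] by metis
qed

lemma mspan_subset_span:
  fixes X :: "('v \<Rightarrow>\<^sub>0 nat) set"
  shows "(mspan X :: ('v, 'k::field) mpoly_rep set)
    \<subseteq> module.span mpoly_scale ((\<lambda>m. single m 1) ` X)"
proof
  interpret vector_space "mpoly_scale :: 'k \<Rightarrow> ('v, 'k) mpoly_rep \<Rightarrow> _" by (rule vector_space_mpoly)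
  fix p :: "('v, 'k) mpoly_rep" assume p: "p \<in> mspan X"
  have "single m c \<in> span ((\<lambda>m. single m 1) ` X)" if "m \<in> X" for m c
    using span_scale[OF span_base[of "single m 1"], of "(\<lambda>m. single m 1) ` X" c] that
    by (simp add: mult_single)
  then show "p \<in> span ((\<lambda>m. single m 1) ` X)"
    by (subst poly_mapping_sum_single) (use p in \<open>auto simp: mspan_def intro!: span_sum\<close>)
qed

context local_polynomial_ring
begin

lemma fr_scale:
  assumes "s \<in> S" "a \<in> A"
  shows "fr 1 s \<otimes>\<^bsub>R\<^esub> fr a 1 = fr a s" "fr s 1 \<otimes>\<^bsub>R\<^esub> fr a s = fr a 1"
  using assms by (simp_all add: mult_R S_A fr_eq_iff)

text \<open>Pulled back to polynomials, the ideals become subspaces that all contain the span of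
  \<open>X\<close>. Witnesses of strict inclusion can be reduced modulo that span to have support in
  \<open>Y - X\<close>, which bounds the length by a dimension over the field.\<close>

lemma ideal_chain_length_le:
  assumes X: "upset V X" and Y: "upset V Y" and XY: "X \<subseteq> Y" and fin: "finite (Y - X)"
    and D: "ideal_chain R (ext X) (ext Y) l D"
  shows "l \<le> card (Y - X)"
proof -
  interpret vector_space "mpoly_scale :: 'k \<Rightarrow> ('v, 'k) mpoly_rep \<Rightarrow> _" by (rule vector_space_mpoly)
  define U where "U i = {p\<in>A. fr p 1 \<in> D i}" for i
  have D': "ideal (D i) R" "ext X \<subseteq> D i" "D i \<subseteq> ext Y" if "i \<le> l" for i
    using D that by (auto simp: ideal_chain_def)
  have fr_add: "fr p 1 \<oplus>\<^bsub>R\<^esub> fr q 1 = fr (p + q) 1" if "p \<in> A" "q \<in> A" for p q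
    using that by (simp add: add_R)
  have cA: "single 0 c \<in> A" for c by (simp add: mspan_single)
  have U: "subspace (U i)" if i: "i \<le> l" for i
  proof -
    interpret Di: ideal "D i" R by (rule D'[OF i])
    show ?thesis
    proof (rule subspaceI)
      show "0 \<in> U i" using Di.zero_closed by (simp add: U_def zero_R)
      show "p + q \<in> U i" if "p \<in> U i" "q \<in> U i" for p q
        using that Di.a_closed[of "fr p 1" "fr q 1"] fr_add[of p q] unfolding U_def by auto
      show "mpoly_scale c p \<in> U i" if "p \<in> U i" for c p
        using Di.I_l_closed[of "fr p 1" "fr (single 0 c) 1"] that cA
        by (auto simp: U_def mult_R)
    qed
  qed
  have "\<exists>b. b \<in> U (Suc i) - U i \<and> b \<in> mspan (Y - X)" if i: "i < l" for i
  proof -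
    interpret Di: ideal "D i" R using D' i by simp
    interpret Di': ideal "D (Suc i)" R using D' i by simp
    have "D i \<subset> D (Suc i)" using D i by (simp add: ideal_chain_def)
    then obtain x where x: "x \<in> D (Suc i)" "x \<notin> D i" by blast
    then have "x \<in> ext Y" using D'[of "Suc i"] i by auto
    then obtain a s where a: "a \<in> mspan Y" "s \<in> S" "x = fr a s" by (auto simp: ext_def)
    have aA: "a \<in> A" using in_A[OF Y] a by simp
    \<comment> \<open>Denominators are units, so the numerator alone separates the two
      ideals.\<close>
    have a1: "fr a 1 \<in> D (Suc i)"
      using Di'.I_l_closed[OF x(1), of "fr s 1"] a aA fr_scale by (simp add: S_A)
    have a2: "fr a 1 \<notin> D i"
      using Di.I_l_closed[of "fr a 1" "fr 1 s"] a aA fr_scale x(2) by auto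
    \<comment> \<open>Reduction modulo \<open>X\<close>: the part \<open>c\<close> lies in every
      member of the chain, so \<open>b\<close> is as good a witness as \<open>a\<close>.\<close>
    define b where "b = (\<Sum>m\<in>keys a - X. single m (lookup a m))"
    define c where "c = (\<Sum>m\<in>keys a \<inter> X. single m (lookup a m))"
    have abc: "a = b + c"
      unfolding b_def c_def using poly_mapping_sum_single[of a]
      by (subst add.commute, subst sum.Int_Diff[symmetric]) auto
    have b: "b \<in> mspan (Y - X)"
      unfolding b_def using a(1) by (intro mspan_sum mspan_single) (auto simp: mspan_def)
    have c: "c \<in> mspan X" unfolding c_def by (intro mspan_sum mspan_single) auto
    have bA: "b \<in> A" and cA: "c \<in> A"
      using b c in_A[OF X] in_A[OF Y] mspan_subset[of "Y - X" Y] by auto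
    have "fr c 1 \<in> ext X" "fr (- c) 1 \<in> ext X"
      using c cA mspan_uminus[OF c] by (simp_all add: fr_in_ext_iff[OF X])
    then have cD: "fr c 1 \<in> D j" "fr (- c) 1 \<in> D j" if "j \<le> l" for j
      using D'(2)[OF that] by auto
    have "fr b 1 \<in> D (Suc i)"
      using Di'.a_closed[OF a1 cD(2)] i fr_add[OF aA, of "- c"] cA by (simp add: abc)
    moreover have "fr b 1 \<notin> D i"
    proof
      assume "fr b 1 \<in> D i"
      from Di.a_closed[OF this cD(1)] show False using a2 i fr_add[OF bA cA] by (simp add: abc)
    qed
    ultimately show ?thesis using b bA by (auto simp: U_def)
  qed
  then obtain b where b: "\<And>i. i < l \<Longrightarrow> b i \<in> U (Suc i) - U i" "\<And>i. i < l \<Longrightarrow> b i \<in> mspan (Y - X)"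
    by metis
  have "l \<le> card ((\<lambda>m. single m (1::'k)) ` (Y - X))"
  proof (rule subspace_chain_length[where U = U and b = b])
    show "subspace (U i)" if "i \<le> l" for i by (rule U[OF that])
    show "b i \<in> U (Suc i) - U i" if "i < l" for i by (rule b(1)[OF that])
    show "U i \<subseteq> U (Suc i)" if "i < l" for i
      using D that by (auto simp: U_def ideal_chain_def)
    show "b i \<in> span ((\<lambda>m. single m 1) ` (Y - X))" if "i < l" for i
      using b(2)[OF that] mspan_subset_span by blast
  qed (use fin in auto)
  also have "\<dots> \<le> card (Y - X)" by (rule card_image_le[OF fin])
  finally show ?thesis .
qed

text \<open>Adjoin to \<open>X\<close> the monomial of greatest key in \<open>Y - X\<close>. Its
  proper multiples have larger keys and lie in \<open>Y\<close>, hence already in \<open>X\<close>.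
  One monomial is gained at a time, so the bound on the length is attained.\<close>

lemma upset_chain:
  assumes "finite (Y - X)" "upset V X" "upset V Y" "X \<subseteq> Y"
  shows "\<exists>Z. (\<forall>i\<le>card (Y - X). upset V (Z i) \<and> X \<subseteq> Z i \<and> Z i \<subseteq> Y)
    \<and> (\<forall>i<card (Y - X). Z i \<subset> Z (Suc i))"
  using assms
proof (induction "card (Y - X)" arbitrary: X)
  case 0
  then show ?case by (intro exI[of _ "\<lambda>_. X"]) auto
next
  case (Suc n)
  obtain key :: "('v \<Rightarrow>\<^sub>0 nat) \<Rightarrow> nat" where
    key: "\<And>a b. a \<in> mons V \<Longrightarrow> a \<noteq> 0 \<Longrightarrow> key b < key (a + b)"
    using mons_key[OF finite_V] by metis
  have "Y - X \<noteq> {}" using Suc.hyps(2) by (metis card.empty nat.distinct(1))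
  then have ne: "key ` (Y - X) \<noteq> {}" "finite (key ` (Y - X))" using Suc.prems(1) by auto
  obtain m where m: "m \<in> Y - X" "Max (key ` (Y - X)) = key m"
    using Max_in[OF ne(2,1)] unfolding image_iff by blast
  have mmax: "key w \<le> key m" if "w \<in> Y - X" for w
    unfolding m(2)[symmetric] by (rule Max_ge[OF ne(2)]) (use that in auto)
  have up: "upset V (insert m X)"
    unfolding upset_def
  proof (intro conjI ballI)
    show "insert m X \<subseteq> mons V"
      using m(1) upset_subset[OF Suc.prems(2)] upset_subset[OF Suc.prems(3)] by auto
    fix u w assume u: "u \<in> insert m X" and w: "w \<in> mons V"
    show "u + w \<in> insert m X"
    proof (cases "u \<in> X \<or> w = 0")
      case True
      then show ?thesis using u w upsetD[OF Suc.prems(2)] by auto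
    next
      case False
      then have um: "u = m" using u by auto
      have "key m < key (m + w)" using key[OF w, of m] False by (simp add: add.commute)
      then have "m + w \<notin> Y - X" using mmax[of "m + w"] by auto
      moreover have "m + w \<in> Y" using m(1) w upsetD[OF Suc.prems(3)] by auto
      ultimately show ?thesis using um by auto
    qed
  qed
  have diff: "Y - insert m X = (Y - X) - {m}" by auto
  have card: "card (Y - insert m X) = n"
    unfolding diff using Suc.hyps(2) m(1) Suc.prems(1) by (simp add: card_Diff_singleton)
  obtain Z where Z: "\<And>i. i \<le> n \<Longrightarrow> upset V (Z i) \<and> insert m X \<subseteq> Z i \<and> Z i \<subseteq> Y"
    "\<And>i. i < n \<Longrightarrow> Z i \<subset> Z (Suc i)"
    using Suc.hyps(1)[of "insert m X"] card up Suc.prems m(1) diff by auto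
  define Z' where "Z' i = (case i of 0 \<Rightarrow> X | Suc j \<Rightarrow> Z j)" for i
  have "upset V (Z' i) \<and> X \<subseteq> Z' i \<and> Z' i \<subseteq> Y" if "i \<le> Suc n" for i
    using Z(1)[of "i - 1"] Suc.prems that by (cases i) (auto simp: Z'_def)
  moreover have "Z' i \<subset> Z' (Suc i)" if "i < Suc n" for i
    using Z(1)[of 0] Z(2)[of "i - 1"] that m(1) by (cases i) (auto simp: Z'_def)
  ultimately show ?case unfolding Suc.hyps(2)[symmetric] by (intro exI[of _ Z']) blast
qed

lemma Sup_ideal_chains_ext:
  assumes X: "upset V X" and Y: "upset V Y" and XY: "X \<subseteq> Y" and fin: "finite (Y - X)"
  shows "Sup {enat l |l. \<exists>D. ideal_chain R (ext X) (ext Y) l D} = enat (card (Y - X))"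
proof (rule antisym)
  show "Sup {enat l |l. \<exists>D. ideal_chain R (ext X) (ext Y) l D} \<le> enat (card (Y - X))"
    using ideal_chain_length_le[OF assms] by (intro Sup_least) auto
  obtain Z where Z: "\<And>i. i \<le> card (Y - X) \<Longrightarrow> upset V (Z i) \<and> X \<subseteq> Z i \<and> Z i \<subseteq> Y"
    "\<And>i. i < card (Y - X) \<Longrightarrow> Z i \<subset> Z (Suc i)"
    using upset_chain[OF fin X Y XY] by blast
  have "ext (Z i) \<subset> ext (Z (Suc i))" if i: "i < card (Y - X)" for i
  proof -
    have "ext (Z i) \<subseteq> ext (Z (Suc i))" "\<not> ext (Z (Suc i)) \<subseteq> ext (Z i)"
      using Z(1)[of i] Z(1)[of "Suc i"] Z(2)[OF i] i by (auto simp: ext_subset_iff)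
    then show ?thesis by blast
  qed
  moreover have "ideal (ext (Z i)) R \<and> ext X \<subseteq> ext (Z i) \<and> ext (Z i) \<subseteq> ext Y" if i: "i \<le> card (Y - X)" for i
    using Z(1)[OF i] X Y by (simp add: ideal_ext ext_subset_iff)
  ultimately have "ideal_chain R (ext X) (ext Y) (card (Y - X)) (\<lambda>i. ext (Z i))"
    unfolding ideal_chain_def by blast
  then show "enat (card (Y - X)) \<le> Sup {enat l |l. \<exists>D. ideal_chain R (ext X) (ext Y) l D}"
    by (intro Sup_upper) blast
qed

end

section \<open>The Krull dimension of the localized polynomial ring\<close>

text \<open>Each exponent is bounded instead of the total degree: the monomials then fill a box,
  whose size is a pure power.\<close>

definition exponents_le :: "nat \<Rightarrow> ('v, 'k::field) mpoly_rep \<Rightarrow> bool" where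
  "exponents_le d p \<longleftrightarrow> (\<forall>m\<in>keys p. \<forall>v. lookup m v \<le> d)"

lemma exponents_le_1: "exponents_le 0 1"
  by (simp add: exponents_le_def)

lemma exponents_le_mult:
  assumes "exponents_le c p" "exponents_le d q"
  shows "exponents_le (c + d) (p * q)"
  unfolding exponents_le_def
proof (intro ballI allI)
  fix m v assume "m \<in> keys (p * q)"
  then obtain a b where "m = a + b" "a \<in> keys p" "b \<in> keys q"
    using keys_mult[of p q] by blast
  then show "lookup m v \<le> c + d"
    using assms by (auto simp: exponents_le_def lookup_add intro: add_mono)
qed

lemma exponents_le_power: "exponents_le d p \<Longrightarrow> exponents_le (n * d) (p ^ n)"
  by (induction n) (auto simp: exponents_le_1 intro: exponents_le_mult)

lemma exponents_le_prod:
  "finite I \<Longrightarrow> (\<And>i. i \<in> I \<Longrightarrow> exponents_le (d i) (p i)) \<Longrightarrow> exponents_le (\<Sum>i\<in>I. d i) (\<Prod>i\<in>I. p i)"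
  by (induction I rule: finite_induct) (auto simp: exponents_le_1 intro: exponents_le_mult)

lemma ex_exponents_le:
  fixes p :: "('v, 'k::field) mpoly_rep"
  shows "\<exists>d. exponents_le d p"
proof -
  have "\<exists>d. \<forall>v. lookup m v \<le> d" for m :: "'v \<Rightarrow>\<^sub>0 nat"
  proof -
    have "lookup m v \<le> (\<Sum>v\<in>keys m. lookup m v)" for v
      by (cases "v \<in> keys m") (auto intro: member_le_sum simp: in_keys_iff)
    then show ?thesis by blast
  qed
  then obtain d where d: "\<And>m :: 'v \<Rightarrow>\<^sub>0 nat. \<And>v. lookup m v \<le> d m" by metis
  have "exponents_le (\<Sum>m\<in>keys p. d m) p"
    unfolding exponents_le_def
  proof (intro ballI allI)
    fix m v assume m: "m \<in> keys p"
    have "d m \<le> (\<Sum>m\<in>keys p. d m)" using m by (intro member_le_sum) auto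
    then show "lookup m v \<le> (\<Sum>m\<in>keys p. d m)" using d[of m v] by simp
  qed
  then show ?thesis by blast
qed

lemma card_bounded_mons:
  assumes "finite V"
  shows "finite {m\<in>mons V. \<forall>v\<in>V. lookup m v < T}"
    and "card {m\<in>mons V. \<forall>v\<in>V. lookup m v < T} \<le> T ^ card V"
proof -
  let ?B = "{m\<in>mons V. \<forall>v\<in>V. lookup m v < T}"
  have inj: "inj_on lookup ?B" by (auto intro: inj_onI poly_mapping_eqI)
  have img: "lookup ` ?B \<subseteq> {w\<in>supported V. \<forall>v\<in>V. w v < T}"
    by (auto simp: lookup_in_supported)
  show "finite ?B"
    using finite_imageD[OF finite_subset[OF img card_bounded_exponents(1)[OF assms]] inj] .
  show "card ?B \<le> T ^ card V"
    using card_inj_on_le[OF inj img card_bounded_exponents(1)[OF assms]] card_bounded_exponents(2)[OF assms]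
    by simp
qed

context local_polynomial_ring
begin

text \<open>Along a chain of primes, elements \<open>y\<^sub>i\<close> of the successive differences are algebraically
  independent: in a polynomial relation, divide by the largest possible power of \<open>y\<^sub>0\<close> and pass to
  the next prime, which contains \<open>y\<^sub>0\<close>.\<close>

lemma prime_chain_independent:
  fixes Q :: "nat \<Rightarrow> ('v, 'k) mpoly_rep set" and F :: "(nat \<Rightarrow> nat) set"
  assumes Q: "\<And>i p q. p \<in> Q i \<Longrightarrow> q \<in> Q i \<Longrightarrow> p - q \<in> Q i"
      "\<And>i p q. p \<in> Q i \<Longrightarrow> q \<in> A \<Longrightarrow> p * q \<in> Q i"
      "\<And>i p q. i \<le> l \<Longrightarrow> p \<in> A \<Longrightarrow> q \<in> A \<Longrightarrow> p * q \<in> Q i \<Longrightarrow> p \<in> Q i \<or> q \<in> Q i"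
      "\<And>i. i \<le> l \<Longrightarrow> 1 \<notin> Q i" "\<And>i. i < l \<Longrightarrow> Q i \<subseteq> Q (Suc i)"
    and y: "\<And>i. i < l \<Longrightarrow> y i \<in> A" "\<And>i. i < l \<Longrightarrow> y i \<in> Q (Suc i) - Q i"
    and F: "finite F" "F \<subseteq> supported {j..<l}" "\<And>e. e \<in> F \<Longrightarrow> c e \<noteq> 0" "j \<le> l"
    and mem: "(\<Sum>e\<in>F. single 0 (c e) * (\<Prod>i=j..<l. y i ^ e i)) \<in> Q j"
  shows "F = {}"
  using F mem
proof (induction "l - j" arbitrary: j F c)
  case 0
  \<comment> \<open>Here j = l and only the empty product is left; a non-zero constant is a unit,
    which the proper ideal \<open>Q j\<close> cannot contain.\<close>
  then have F0: "F \<subseteq> {\<lambda>_. 0}" by (auto simp: supported_def fun_eq_iff)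
  show ?case
  proof (rule ccontr)
    assume "F \<noteq> {}"
    then have F: "F = {\<lambda>_. 0}" using F0 by blast
    have "single 0 (c (\<lambda>_. 0)) \<in> Q j" using 0 F by simp
    moreover have "single 0 (1 / c (\<lambda>_. 0)) \<in> A" by (simp add: mspan_single)
    ultimately have "single 0 (c (\<lambda>_. 0)) * single 0 (1 / c (\<lambda>_. 0)) \<in> Q j"
      by (rule Q(2))
    moreover have "c (\<lambda>_. 0) \<noteq> 0" using 0(4) F by simp
    ultimately show False using Q(4)[OF 0(5)] by (simp add: mult_single)
  qed
next
  case (Suc n)
  have jl: "j < l" using Suc.hyps(2) by simp
  show ?case
  proof (rule ccontr)
    assume "F \<noteq> {}"
    define m where "m = Min ((\<lambda>e. e j) ` F)"
    have m_le: "m \<le> e j" if "e \<in> F" for e using Suc.prems(1) that by (simp add: m_def)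
    have "m \<in> (\<lambda>e. e j) ` F" unfolding m_def using Suc.prems(1) \<open>F \<noteq> {}\<close> by (intro Min_in) auto
    then have F0_ne: "{e\<in>F. e j = m} \<noteq> {}" by auto
    define F0 where "F0 = {e\<in>F. e j = m}"
    define rest where "rest e = single 0 (c e) * (\<Prod>i=Suc j..<l. y i ^ e i)" for e
    define T0 where "T0 = (\<Sum>e\<in>F0. rest e)"
    \<comment> \<open>Outside \<open>F0\<close> the exponent at j exceeds m, so the truncated
      subtraction is exact and one more factor \<open>y j\<close> can be taken out.\<close>
    define T1 where "T1 = (\<Sum>e\<in>F - F0. y j ^ (e j - Suc m) * rest e)"
    have powA: "p ^ k \<in> A" if "p \<in> A" for p k using that by (induction k) auto
    have prodA: "(\<Prod>i\<in>I. p i) \<in> A" if "\<And>i. i \<in> I \<Longrightarrow> p i \<in> A" for I :: "nat set" and p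
      using that by (induction I rule: infinite_finite_induct) auto
    have restA: "rest e \<in> A" for e
      unfolding rest_def by (intro A_closed(1) prodA powA mspan_single) (auto intro: y(1))
    have T0A: "T0 \<in> A" unfolding T0_def by (intro mspan_sum restA)
    have T1A: "T1 \<in> A" unfolding T1_def by (intro mspan_sum A_closed(1) powA restA y(1) jl)
    have split: "single 0 (c e) * (\<Prod>i=j..<l. y i ^ e i) = y j ^ e j * rest e" for e
      unfolding rest_def by (subst prod.atLeast_Suc_lessThan[OF jl]) (simp add: mult_ac)
    have "(\<Sum>e\<in>F. single 0 (c e) * (\<Prod>i=j..<l. y i ^ e i))
        = (\<Sum>e\<in>F0. y j ^ e j * rest e) + (\<Sum>e\<in>F - F0. y j ^ e j * rest e)"
      unfolding split using Suc.prems(1)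
      by (subst add.commute, intro sum.subset_diff) (auto simp: F0_def)
    also have "(\<Sum>e\<in>F0. y j ^ e j * rest e) = y j ^ m * T0"
      unfolding T0_def sum_distrib_left by (intro sum.cong) (auto simp: F0_def)
    also have "(\<Sum>e\<in>F - F0. y j ^ e j * rest e) = y j ^ m * (y j * T1)"
      unfolding T1_def sum_distrib_left
    proof (intro sum.cong refl)
      fix e assume e: "e \<in> F - F0"
      have "e j \<noteq> m" using e by (auto simp: F0_def)
      then have "e j = m + Suc (e j - Suc m)" using e m_le[of e] by auto
      then have "y j ^ e j = y j ^ m * (y j * y j ^ (e j - Suc m))"
        by (metis power_add power_Suc)
      then show "y j ^ e j * rest e = y j ^ m * (y j * (y j ^ (e j - Suc m) * rest e))"
        by (simp add: mult_ac)
    qed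
    finally have "y j ^ m * (T0 + y j * T1) \<in> Q j"
      using Suc.prems(5) by (simp add: distrib_left)
    \<comment> \<open>\<open>y j\<close> lies outside the prime \<open>Q j\<close>, so its powers
      can be cancelled.\<close>
    moreover have "p \<in> Q j" if "y j ^ k * p \<in> Q j" "p \<in> A" for k p
      using that
    proof (induction k)
      case (Suc k)
      then show ?case
        using Q(3)[of j "y j" "y j ^ k * p"] y[OF jl] jl powA by (auto simp: mult.assoc)
    qed simp
    ultimately have "T0 + y j * T1 \<in> Q j" using T0A T1A y(1)[OF jl] by blast
    then have "T0 + y j * T1 \<in> Q (Suc j)" using Q(5)[OF jl] by blast
    moreover have "y j * T1 \<in> Q (Suc j)" using Q(2) y(2)[OF jl] T1A by blast
    ultimately have "T0 \<in> Q (Suc j)" using Q(1)[of "T0 + y j * T1" "Suc j" "y j * T1"] by simp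
    \<comment> \<open>The exponent at j is m throughout \<open>F0\<close>, so erasing it loses
      nothing, and the coefficients are found again by writing m back.\<close>
    define g where "g e = e(j := 0)" for e :: "nat \<Rightarrow> nat"
    have inj: "inj_on g F0"
    proof (rule inj_onI, rule ext)
      fix e e' i assume e: "e \<in> F0" "e' \<in> F0" "g e = g e'"
      have "g e i = g e' i" using e(3) by simp
      then show "e i = e' i" using e(1,2) by (cases "i = j") (simp_all add: F0_def g_def)
    qed
    have restore: "(g e)(j := m) = e" if "e \<in> F0" for e using that by (auto simp: g_def F0_def)
    have "T0 = (\<Sum>e\<in>g ` F0. single 0 (c (e(j := m))) * (\<Prod>i=Suc j..<l. y i ^ e i))"
      unfolding sum.reindex[OF inj] T0_def rest_def o_def
      by (intro sum.cong refl arg_cong2[of _ _ _ _ "(*)"] prod.cong) (auto simp: restore, auto simp: g_def)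
    then have "(\<Sum>e\<in>g ` F0. single 0 (c (e(j := m))) * (\<Prod>i=Suc j..<l. y i ^ e i)) \<in> Q (Suc j)"
      using \<open>T0 \<in> Q (Suc j)\<close> by simp
    moreover have "g ` F0 \<subseteq> supported {Suc j..<l}"
      using Suc.prems(2) by (fastforce simp: F0_def g_def supported_def)
    moreover have "c (e(j := m)) \<noteq> 0" if "e \<in> g ` F0" for e
      using that restore Suc.prems(3) by (auto simp: F0_def)
    ultimately have "g ` F0 = {}"
      using Suc.hyps(1)[of "Suc j" "g ` F0" "\<lambda>e. c (e(j := m))"] Suc.hyps(2) Suc.prems(1) jl
      by (simp add: F0_def)
    then show False using F0_ne by (simp add: F0_def)
  qed
qed

text \<open>The N^l products of the l separating elements with exponents below N are independent,
  yet lie in the span of at most (N (D + 1))^n monomials, where n = \<open>card V\<close>. For l > n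
  this fails once N exceeds (D + 1)^n.\<close>

lemma prime_chain_length_le:
  assumes C: "\<And>i. i \<le> l \<Longrightarrow> primeideal (C i) R" and strict: "\<And>i. i < l \<Longrightarrow> C i \<subset> C (Suc i)"
  shows "l \<le> card V"
proof (rule ccontr)
  interpret vector_space "mpoly_scale :: 'k \<Rightarrow> ('v, 'k) mpoly_rep \<Rightarrow> _" by (rule vector_space_mpoly)
  \<comment> \<open>Contractions to the polynomial ring. The empty set past l makes closure under
    differences and multiples hold at every index, as \<open>prime_chain_independent\<close>
    demands.\<close>
  define Q where "Q i = (if i \<le> l then {p\<in>A. fr p 1 \<in> C i} else {})" for i
  have Qm: "p - q \<in> Q i" if "p \<in> Q i" "q \<in> Q i" for p q i
  proof (cases "i \<le> l")
    case True
    interpret primeideal "C i" R by (rule C[OF True])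
    have pq: "p \<in> A" "q \<in> A" "fr p 1 \<in> C i" "fr q 1 \<in> C i" using that True by (auto simp: Q_def)
    have "fr p 1 \<oplus>\<^bsub>R\<^esub> fr (- 1) 1 \<otimes>\<^bsub>R\<^esub> fr q 1 \<in> C i" using pq by (intro a_closed I_l_closed) auto
    then show ?thesis using pq True by (simp add: Q_def add_R mult_R)
  qed (use that in \<open>simp add: Q_def\<close>)
  have Qs: "p * q \<in> Q i" if "p \<in> Q i" "q \<in> A" for p q i
  proof (cases "i \<le> l")
    case True
    interpret primeideal "C i" R by (rule C[OF True])
    have pq: "p \<in> A" "fr p 1 \<in> C i" using that True by (auto simp: Q_def)
    have "fr p 1 \<otimes>\<^bsub>R\<^esub> fr q 1 \<in> C i" using pq that(2) by (intro I_r_closed) auto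
    then show ?thesis using pq that(2) True by (simp add: Q_def mult_R)
  qed (use that in \<open>simp add: Q_def\<close>)
  have Qp: "p \<in> Q i \<or> q \<in> Q i" if "i \<le> l" "p \<in> A" "q \<in> A" "p * q \<in> Q i" for p q i
  proof -
    interpret primeideal "C i" R by (rule C[OF that(1)])
    have "fr p 1 \<otimes>\<^bsub>R\<^esub> fr q 1 \<in> C i" using that by (simp add: Q_def mult_R)
    then show ?thesis using I_prime[of "fr p 1" "fr q 1"] that by (auto simp: Q_def)
  qed
  have Q1: "1 \<notin> Q i" if "i \<le> l" for i
  proof -
    interpret primeideal "C i" R by (rule C[OF that])
    show ?thesis using one_imp_carrier I_notcarr that by (auto simp: Q_def one_R)
  qed
  have Qsub: "Q i \<subseteq> Q (Suc i)" if "i < l" for i using strict[OF that] that by (auto simp: Q_def)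
  have "\<exists>y. y \<in> A \<and> y \<in> Q (Suc i) - Q i" if i: "i < l" for i
  proof -
    interpret Pi: primeideal "C i" R using C i by simp
    interpret Pi': primeideal "C (Suc i)" R using C i by simp
    obtain x where x: "x \<in> C (Suc i)" "x \<notin> C i" using strict[OF i] by blast
    obtain a s where a: "a \<in> A" "s \<in> S" "x = fr a s" using Pi'.Icarr[OF x(1)] by (rule carrier_R_cases)
    have "fr a 1 \<in> C (Suc i)"
      using Pi'.I_l_closed[OF x(1), of "fr s 1"] a fr_scale by (simp add: S_A)
    moreover have "fr a 1 \<notin> C i"
      using Pi.I_l_closed[of "fr a 1" "fr 1 s"] a fr_scale x(2) by auto
    ultimately show ?thesis using a(1) i by (auto simp: Q_def)
  qed
  then obtain y where y: "\<And>i. i < l \<Longrightarrow> y i \<in> A" "\<And>i. i < l \<Longrightarrow> y i \<in> Q (Suc i) - Q i" by metis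
  have "\<forall>i. \<exists>d. exponents_le d (y i)" using ex_exponents_le by blast
  then obtain d where d: "\<And>i. exponents_le (d i) (y i)" by metis
  define D where "D = (\<Sum>i<l. d i)"
  \<comment> \<open>One more than (D + 1)^n, the factor to be beaten in the final
    comparison.\<close>
  define N where "N = Suc (Suc D ^ card V)"
  define E where "E = {e\<in>supported {0..<l}. \<forall>i\<in>{0..<l}. e i < N}"
  define Y where "Y e = (\<Prod>i=0..<l. y i ^ e i)" for e :: "nat \<Rightarrow> nat"
  have E: "finite E" "card E = N ^ l" using card_bounded_exponents[of "{0..<l}" N] by (auto simp: E_def)
  have indep: "F = {}" if "F \<subseteq> E" "\<And>e. e \<in> F \<Longrightarrow> c e \<noteq> 0" "(\<Sum>e\<in>F. mpoly_scale (c e) (Y e)) = 0" for F c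
  proof (rule prime_chain_independent[of Q l y F 0 c, OF Qm Qs Qp Q1 Qsub y])
    show "finite F" using that(1) E(1) by (rule finite_subset)
    show "F \<subseteq> supported {0..<l}" using that(1) by (auto simp: E_def)
    interpret primeideal "C 0" R by (rule C) simp
    have "0 \<in> Q 0" using zero_closed by (simp add: Q_def zero_R)
    then show "(\<Sum>e\<in>F. single 0 (c e) * (\<Prod>i=0..<l. y i ^ e i)) \<in> Q 0"
      using that(3) by (simp add: Y_def)
  qed (use that in auto)
  \<comment> \<open>Two equal products would be a relation with the non-zero coefficients 1 and
    -1.\<close>
  have inj: "inj_on Y E"
  proof (rule inj_onI, rule ccontr)
    fix e e' assume e: "e \<in> E" "e' \<in> E" "Y e = Y e'" "e \<noteq> e'"
    have "{e, e'} = {}"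
    proof (rule indep[of "{e, e'}" "\<lambda>f. if f = e then 1 else - 1"])
      show "(\<Sum>f\<in>{e, e'}. mpoly_scale (if f = e then 1 else - 1) (Y f)) = 0"
        using e by (simp add: single_uminus)
    qed (use e in auto)
    then show False by simp
  qed
  have "independent (Y ` E)"
  proof -
    have "u v = 0" if sum: "(\<Sum>v\<in>Y ` E. mpoly_scale (u v) v) = 0" and v: "v \<in> Y ` E" for u v
    proof -
      have "(\<Sum>e\<in>{e\<in>E. u (Y e) \<noteq> 0}. mpoly_scale (u (Y e)) (Y e)) = (\<Sum>e\<in>E. mpoly_scale (u (Y e)) (Y e))"
        using E(1) by (intro sum.mono_neutral_left) auto
      also have "\<dots> = 0" using sum by (simp add: sum.reindex[OF inj])
      finally have "{e\<in>E. u (Y e) \<noteq> 0} = {}" by (intro indep) auto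
      then show ?thesis using v by auto
    qed
    then show ?thesis using E(1) by (auto simp: dependent_finite)
  qed
  define T where "T = Suc (N * D)"
  define B where "B = {m\<in>mons V. \<forall>v\<in>V. lookup m v < T}"
  have "Y ` E \<subseteq> span ((\<lambda>m. single m 1) ` B)"
  proof
    fix p assume "p \<in> Y ` E"
    then obtain e where e: "e \<in> E" "p = Y e" by blast
    have "exponents_le (\<Sum>i=0..<l. e i * d i) p"
      unfolding e(2) Y_def by (intro exponents_le_prod exponents_le_power d) simp
    moreover have "(\<Sum>i=0..<l. e i * d i) \<le> N * D"
      unfolding D_def sum_distrib_left atLeast0LessThan
      using e(1) by (intro sum_mono mult_right_mono) (auto simp: E_def intro: less_imp_le)
    ultimately have bound: "lookup m v < T" if "m \<in> keys p" for m v
      using that by (force simp: exponents_le_def T_def less_Suc_eq_le intro: order_trans)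
    have powA: "q ^ k \<in> A" if "q \<in> A" for q k using that by (induction k) auto
    have "(\<Prod>i\<in>I. y i ^ e i) \<in> A" if "I \<subseteq> {0..<l}" for I
      using that by (induction I rule: infinite_finite_induct) (auto intro: y(1) powA)
    then have "p \<in> A" unfolding e(2) Y_def by blast
    then have "p \<in> mspan B" using bound by (auto simp: mspan_def B_def)
    then show "p \<in> span ((\<lambda>m. single m 1) ` B)" using mspan_subset_span by blast
  qed
  then have "card (Y ` E) \<le> card ((\<lambda>m. single m (1::'k)) ` B)"
    using independent_span_bound[OF _ \<open>independent (Y ` E)\<close>] card_bounded_mons(1)[OF finite_V]
    by (simp add: B_def)
  also have "\<dots> \<le> card B" using card_bounded_mons(1)[OF finite_V] by (intro card_image_le) (simp add: B_def)
  also have "\<dots> \<le> T ^ card V" unfolding B_def by (rule card_bounded_mons(2)[OF finite_V])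
  also have "\<dots> \<le> (N * Suc D) ^ card V" by (intro power_mono) (auto simp: T_def N_def)
  finally have le: "N ^ l \<le> N ^ card V * Suc D ^ card V"
    by (simp only: card_image[OF inj] E power_mult_distrib)
  assume "\<not> l \<le> card V"
  have "N ^ card V * N = N ^ Suc (card V)" by simp
  also have "\<dots> \<le> N ^ l" using \<open>\<not> l \<le> card V\<close> by (intro power_increasing) (auto simp: N_def)
  also note le
  finally have "N ^ card V * N \<le> N ^ card V * Suc D ^ card V" .
  moreover have "N ^ card V > 0" by (simp add: N_def)
  ultimately have "N \<le> Suc D ^ card V" by (simp only: mult_le_cancel1)
  then show False by (simp add: N_def)
qed

lemma krull_dim_R: "krull_dim R = enat (card V)"
proof (rule antisym)
  show "krull_dim R \<le> enat (card V)"
    unfolding krull_dim_def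
  proof (rule Sup_least, clarify)
    fix l and C :: "nat \<Rightarrow> (('v, 'k) mpoly_rep \<times> ('v, 'k) mpoly_rep) set set"
    assume "\<forall>i\<le>l. primeideal (C i) R" "\<forall>i<l. C i \<subset> C (Suc i)"
    then show "enat l \<le> enat (card V)" using prime_chain_length_le[of l C] by simp
  qed
  obtain f where f: "bij_betw f {0..<card V} V" using ex_bij_betw_nat_finite[OF finite_V] by blast
  \<comment> \<open>Exponents of the prime generated by the first i variables; these primes form a
    chain of length \<open>card V\<close>.\<close>
  define X where "X i = {m\<in>mons V. keys m \<inter> f ` {..<i} \<noteq> {}}" for i
  have up: "upset V (X i)" for i unfolding X_def by (rule upset_meeting)
  have strict: "ext (X i) \<subset> ext (X (Suc i))" if i: "i < card V" for i
  proof -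
    have "X i \<subseteq> X (Suc i)" by (auto simp: X_def lessThan_Suc)
    moreover have "f i \<in> V" using f i by (auto simp: bij_betw_def)
    then have "single (f i) 1 \<in> X (Suc i)" by (simp add: X_def mons_def)
    moreover have "f i \<noteq> f j" if "j < i" for j
      using bij_betw_imp_inj_on[OF f] i that by (auto dest: inj_onD)
    then have "single (f i) 1 \<notin> X i" by (auto simp: X_def)
    ultimately have "X i \<subseteq> X (Suc i)" "\<not> X (Suc i) \<subseteq> X i" by blast+
    then show ?thesis using ext_subset_iff[OF up up] by blast
  qed
  have "primeideal (ext (X i)) R" for i by (rule primeideal_ext) (simp add: X_def)
  then show "enat (card V) \<le> krull_dim R"
    unfolding krull_dim_def using strict by (intro Sup_upper CollectI exI[of _ "card V"] conjI refl exI[of _ "\<lambda>i. ext (X i)"]) auto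
qed

end

section \<open>The j-multiplicity of an edge ideal\<close>

definition edge_monos :: "'v set \<Rightarrow> 'v set set \<Rightarrow> nat \<Rightarrow> ('v \<Rightarrow>\<^sub>0 nat) set" where
  "edge_monos V E t = {m\<in>mons V. lookup m \<in> edge_power E t}"

definition edge_exp :: "'v set \<Rightarrow> 'v \<Rightarrow>\<^sub>0 nat" where
  "edge_exp e = (\<Sum>v\<in>e. single v 1)"

lemma lookup_edge_exp:
  "finite e \<Longrightarrow> lookup (edge_exp e) v = of_bool (v \<in> e)"
  by (simp add: edge_exp_def lookup_sum lookup_single when_def of_bool_def)

lemma edge_exp_in_mons: "finite e \<Longrightarrow> e \<subseteq> V \<Longrightarrow> edge_exp e \<in> mons V"
  by (auto simp: mons_def in_keys_iff lookup_edge_exp split: if_splits)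

lemma prod_indet: "finite e \<Longrightarrow> (\<Prod>v\<in>e. indet v) = single (edge_exp e) (1::'k::field)"
  unfolding edge_exp_def
  by (induction e rule: finite_induct) (simp_all add: indet_def mult_single)

lemma upset_edge_monos: "upset V (edge_monos V E t)"
  by (auto simp: upset_def edge_monos_def lookup_add le_fun_def intro: edge_power_mono[where E = E and t = t])

lemma edge_monos_Suc:
  assumes "finite V" "finite E" "\<forall>e\<in>E. e \<subseteq> V"
  shows "m \<in> edge_monos V E (Suc t) \<longleftrightarrow> (\<exists>e\<in>E. \<exists>w\<in>edge_monos V E t. m = edge_exp e + w)"
proof
  have fin: "finite e" if "e \<in> E" for e using assms that finite_subset by blast
  show "\<exists>e\<in>E. \<exists>w\<in>edge_monos V E t. m = edge_exp e + w" if m: "m \<in> edge_monos V E (Suc t)"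
  proof -
    obtain e x where e: "e \<in> E" "x \<in> edge_power E t" "lookup m = (\<lambda>v. x v + of_bool (v \<in> e))"
      using m edge_power_Suc[OF assms(2)] by (auto simp: edge_monos_def)
    define w where "w = m - edge_exp e"
    have w: "lookup w = x"
      unfolding w_def using e fin by (auto simp: lookup_minus lookup_edge_exp fun_eq_iff)
    have eq: "m = edge_exp e + w"
      by (rule poly_mapping_eqI) (simp add: lookup_add w e(3) lookup_edge_exp fin[OF e(1)])
    have "m \<in> mons V" using m by (simp add: edge_monos_def)
    then have "w \<in> mons V" unfolding eq by simp
    then show ?thesis using e(1,2) w eq by (auto simp: edge_monos_def)
  qed
  show "m \<in> edge_monos V E (Suc t)" if m: "\<exists>e\<in>E. \<exists>w\<in>edge_monos V E t. m = edge_exp e + w"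
  proof -
    obtain e w where e: "e \<in> E" "w \<in> edge_monos V E t" "m = edge_exp e + w" using m by blast
    have "lookup m = (\<lambda>v. lookup w v + of_bool (v \<in> e))"
      using e(3) fin[OF e(1)] by (simp add: fun_eq_iff lookup_add lookup_edge_exp)
    then have "lookup m \<in> edge_power E (Suc t)"
      using edge_power_Suc[OF assms(2)] e by (auto simp: edge_monos_def)
    moreover have "m \<in> mons V"
      unfolding e(3) using e assms(3) fin by (simp add: edge_exp_in_mons edge_monos_def)
    ultimately show ?thesis by (simp add: edge_monos_def)
  qed
qed

lemma edge_monos_1:
  assumes "finite V" "finite E" "\<forall>e\<in>E. e \<subseteq> V"
  shows "edge_monos V E 1 = up_monos V (edge_exp ` E)"
  using edge_monos_Suc[OF assms, of _ 0] by (auto simp: up_monos_def edge_monos_def)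

lemma edge_monos_add:
  assumes "finite V" "finite E" "\<forall>e\<in>E. e \<subseteq> V"
  shows "{x + y |x y. x \<in> edge_monos V E 1 \<and> y \<in> edge_monos V E t} = edge_monos V E (Suc t)"
proof (intro equalityI subsetI)
  fix m assume "m \<in> {x + y |x y. x \<in> edge_monos V E 1 \<and> y \<in> edge_monos V E t}"
  then obtain x y where xy: "m = x + y" "x \<in> edge_monos V E 1" "y \<in> edge_monos V E t" by blast
  have "lookup m = (\<lambda>v. lookup x v + lookup y v)"
    by (simp add: xy(1) fun_eq_iff lookup_add)
  then show "m \<in> edge_monos V E (Suc t)"
    using edge_power_add[of "lookup x" E 1 "lookup y" t] xy
    by (simp add: edge_monos_def)
next
  fix m assume "m \<in> edge_monos V E (Suc t)"
  then obtain e w where e: "e \<in> E" "w \<in> edge_monos V E t" "m = edge_exp e + w"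
    using edge_monos_Suc[OF assms] by blast
  have "edge_exp e \<in> edge_monos V E 1"
    unfolding edge_monos_1[OF assms] using up_monos_superset e(1) by blast
  then show "m \<in> {x + y |x y. x \<in> edge_monos V E 1 \<and> y \<in> edge_monos V E t}" using e by blast
qed

lemma bij_betw_lookup:
  assumes "finite V"
  shows "bij_betw lookup (mons V) (supported V)"
  unfolding bij_betw_def
proof
  show "inj_on lookup (mons V)" by (auto intro: inj_onI poly_mapping_eqI)
  show "lookup ` mons V = supported V"
  proof (intro equalityI subsetI)
    fix w :: "'a \<Rightarrow> nat" assume w: "w \<in> supported V"
    have "finite {v. w v \<noteq> 0}" by (rule finite_subset[OF _ assms]) (use w in \<open>auto simp: supported_def\<close>)
    then have "lookup (Abs_poly_mapping w) = w" by simp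
    then show "w \<in> lookup ` mons V"
      using w lookup_in_supported by (metis image_eqI)
  qed (auto simp: lookup_in_supported)
qed

text \<open>The edge {v} receives multiplicity k, all others 0. This supplies pure powers of a node
  as members of the powers of the maximal ideal.\<close>

lemma edge_power_singletons:
  assumes "finite V" "v \<in> V" "k \<le> w v"
  shows "w \<in> edge_power ((\<lambda>v. {v}) ` V) k"
  unfolding edge_power_def
proof (intro CollectI exI[of _ "\<lambda>e. if e = {v} then k else 0"] conjI allI)
  show "(\<Sum>e\<in>(\<lambda>v. {v}) ` V. if e = {v} then k else 0) = k"
    using assms by (simp add: sum.reindex)
  fix u
  have "(\<Sum>e\<in>{e \<in> (\<lambda>v. {v}) ` V. u \<in> e}. if e = {v} then k else 0)
      \<le> (\<Sum>e\<in>{{u}}. if e = {v} then k else 0)"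
    by (intro sum_mono2) auto
  also have "\<dots> \<le> w u" using assms(3) by auto
  finally show "(\<Sum>e\<in>{e \<in> (\<lambda>v. {v}) ` V. u \<in> e}. if e = {v} then k else 0) \<le> w u" .
qed

context local_polynomial_ring
begin

lemma edge_ideal_eq_ext:
  assumes "finite E" "\<forall>e\<in>E. e \<subseteq> V"
  shows "genideal R ((\<lambda>e. fr (\<Prod>v\<in>e. indet v) 1) ` E) = ext (edge_monos V E 1)"
proof -
  have fin: "finite e" if "e \<in> E" for e using assms that finite_V finite_subset by blast
  have "(\<lambda>e. fr (\<Prod>v\<in>e. indet v) 1) ` E = (\<lambda>m. fr (single m 1) 1) ` edge_exp ` E"
    unfolding image_image using fin by (intro image_cong refl) (simp add: prod_indet)
  moreover have "edge_exp ` E \<subseteq> mons V"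
    using fin assms(2) by (auto intro: edge_exp_in_mons)
  ultimately show ?thesis
    using genideal_R[of "edge_exp ` E"] edge_monos_1[OF finite_V assms] by simp
qed

lemma ideal_power_ext:
  assumes "finite E" "\<forall>e\<in>E. e \<subseteq> V"
  shows "ideal_power R (ext (edge_monos V E 1)) t = ext (edge_monos V E t)"
proof (induction t)
  case 0
  have "edge_monos V E 0 = mons V" by (simp add: edge_monos_def)
  then show ?case by (simp add: ext_mons)
next
  case (Suc t)
  show ?case
    unfolding ideal_power.simps Suc.IH edge_monos_add[OF finite_V assms, symmetric]
    by (rule ideal_prod_ext) (rule upset_edge_monos)+
qed

text \<open>Seen as the edge ideal of the hypergraph of single nodes, the maximal ideal has its
  powers computed by \<open>ideal_power_ext\<close> too.\<close>

lemma max_ideal_edges: "max_ideal R = ext (edge_monos V ((\<lambda>v. {v}) ` V) 1)"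
proof -
  have "edge_monos V ((\<lambda>v. {v}) ` V) 1 = mons V - {0}"
  proof (intro equalityI subsetI)
    fix m assume "m \<in> edge_monos V ((\<lambda>v. {v}) ` V) 1"
    then obtain e w where e: "e \<in> (\<lambda>v. {v}) ` V" "w \<in> mons V" "m = edge_exp e + w"
      using edge_monos_Suc[OF finite_V, of "(\<lambda>v. {v}) ` V" m 0] finite_V by (auto simp: edge_monos_def)
    then obtain v where v: "e = {v}" "v \<in> V" by blast
    have "lookup m v \<noteq> 0" using e(3) v by (simp add: lookup_add lookup_edge_exp)
    then have "m \<noteq> 0" by auto
    moreover have "m \<in> mons V" using e v by (simp add: edge_exp_in_mons)
    ultimately show "m \<in> mons V - {0}" by simp
  next
    fix m assume m: "m \<in> mons V - {0}"
    then obtain v where v: "v \<in> keys m" by (metis DiffE ex_in_conv keys_eq_empty singletonI)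
    have "v \<in> V" using m v by (auto simp: mons_def)
    have "lookup m \<in> edge_power ((\<lambda>v. {v}) ` V) 1"
      using v by (intro edge_power_singletons[OF finite_V \<open>v \<in> V\<close>]) (simp add: in_keys_iff Suc_le_eq)
    then show "m \<in> edge_monos V ((\<lambda>v. {v}) ` V) 1" using m by (simp add: edge_monos_def)
  qed
  then show ?thesis by (simp add: max_ideal_R)
qed

text \<open>Unlike \<open>torsion_exps\<close>, this keeps the monomials of the next power: it
  describes the preimage of the torsion, hence is an \<open>upset\<close>.\<close>

definition torsion_monos :: "'v set set \<Rightarrow> nat \<Rightarrow> ('v \<Rightarrow>\<^sub>0 nat) set" where
  "torsion_monos E t = {m\<in>edge_monos V E t.
     \<forall>v\<in>V. \<exists>k. m + single v k \<in> edge_monos V E (Suc t)}"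

lemma upset_torsion_monos: "upset V (torsion_monos E t)"
  unfolding upset_def
proof (intro conjI ballI)
  show "torsion_monos E t \<subseteq> mons V" by (auto simp: torsion_monos_def edge_monos_def)
  fix m w assume m: "m \<in> torsion_monos E t" and w: "w \<in> mons V"
  have "\<exists>k. (m + w) + single v k \<in> edge_monos V E (Suc t)" if v: "v \<in> V" for v
  proof -
    obtain k where "m + single v k \<in> edge_monos V E (Suc t)"
      using m v by (auto simp: torsion_monos_def)
    from upsetD[OF upset_edge_monos this w] show ?thesis by (metis add.assoc add.commute)
  qed
  then show "m + w \<in> torsion_monos E t"
    using m upsetD[OF upset_edge_monos _ w, of m E t] by (simp add: torsion_monos_def)
qed

lemma edge_monos_Suc_subset_torsion:
  assumes "finite E"
  shows "edge_monos V E (Suc t) \<subseteq> torsion_monos E t"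
proof
  fix m assume m: "m \<in> edge_monos V E (Suc t)"
  then have "m + single v 0 \<in> edge_monos V E (Suc t)" for v by simp
  moreover have "m \<in> edge_monos V E t"
    using m edge_power_antimono[OF assms, of t "Suc t"] by (auto simp: edge_monos_def)
  ultimately show "m \<in> torsion_monos E t" unfolding torsion_monos_def by blast
qed

lemma bij_betw_torsion_exps:
  assumes "finite E"
  shows "bij_betw lookup (torsion_monos E t - edge_monos V E (Suc t)) (torsion_exps V E t)"
proof -
  have upd: "lookup (m + single v k)
      = (lookup m)(v := lookup m v + k)" for m :: "'v \<Rightarrow>\<^sub>0 nat" and v k
    by (auto simp: fun_eq_iff lookup_add lookup_single when_def)
  have single: "single v k \<in> mons V" if "v \<in> V" for v and k :: nat
    using that by (auto simp: mons_def)
  have iff: "m \<in> torsion_monos E t - edge_monos V E (Suc t)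
      \<longleftrightarrow> lookup m \<in> torsion_exps V E t" for m
    by (auto simp: torsion_monos_def torsion_exps_def edge_monos_def upd single lookup_in_supported)
  have "lookup ` (torsion_monos E t - edge_monos V E (Suc t)) = torsion_exps V E t"
  proof (intro equalityI subsetI)
    fix w assume w: "w \<in> torsion_exps V E t"
    then have "w \<in> lookup ` mons V"
      using bij_betw_lookup[OF finite_V] by (auto simp: bij_betw_def torsion_exps_def)
    then show "w \<in> lookup ` (torsion_monos E t - edge_monos V E (Suc t))"
      using w iff by blast
  qed (use iff in blast)
  then show ?thesis by (auto simp: bij_betw_def intro: inj_onI poly_mapping_eqI)
qed

text \<open>In one direction, multiplication by a pure power of v shifts each exponent separately,
  so every term of the numerator passes the test. In the other, only finitely many exponents are
  required, and a monomial of large degree has a large exponent at some node.\<close>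

lemma ext_torsion_monos:
  assumes E: "finite E" "\<forall>e\<in>E. e \<subseteq> V"
  shows "ext (torsion_monos E t) = {x\<in>ext (edge_monos V E t).
    \<exists>k. \<forall>a\<in>ideal_power R (max_ideal R) k. a \<otimes>\<^bsub>R\<^esub> x \<in> ext (edge_monos V E (Suc t))}"
proof -
  let ?M = "edge_monos V ((\<lambda>v. {v}) ` V)"
  have max: "ideal_power R (max_ideal R) k = ext (?M k)" for k
    unfolding max_ideal_edges using finite_V by (intro ideal_power_ext) auto
  note up = upset_edge_monos[of V E]
  have mem: "(\<exists>k. \<forall>a\<in>ext (?M k). a \<otimes>\<^bsub>R\<^esub> fr p s \<in> ext (edge_monos V E (Suc t)))
      \<longleftrightarrow> p \<in> mspan (torsion_monos E t)"
    if p: "p \<in> mspan (edge_monos V E t)" and s: "s \<in> S" for p s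
  proof
    have pA: "p \<in> A" using in_A[OF up p] .
    assume "\<exists>k. \<forall>a\<in>ext (?M k). a \<otimes>\<^bsub>R\<^esub> fr p s \<in> ext (edge_monos V E (Suc t))"
    then obtain k where k: "\<And>a. a \<in> ext (?M k) \<Longrightarrow> a \<otimes>\<^bsub>R\<^esub> fr p s \<in> ext (edge_monos V E (Suc t))" by blast
    have "m + single v k \<in> edge_monos V E (Suc t)"
      if m: "m \<in> keys p" and v: "v \<in> V" for m v
    proof -
      define u where "u = single v k"
      have "lookup u \<in> edge_power ((\<lambda>v. {v}) ` V) k"
        by (rule edge_power_singletons[OF finite_V v]) (simp add: u_def)
      moreover have "u \<in> mons V" using v by (auto simp: u_def mons_def)
      ultimately have u: "u \<in> ?M k" "u \<in> mons V" by (auto simp: edge_monos_def)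
      have uA: "single u 1 \<in> A" using u by (simp add: mspan_single)
      have "fr (single u 1) 1 \<in> ext (?M k)"
        using u uA by (simp add: fr_in_ext_iff[OF upset_edge_monos] mspan_single)
      from k[OF this] have "single u 1 * p \<in> mspan (edge_monos V E (Suc t))"
        using uA pA s by (simp add: mult_R fr_in_ext_iff[OF up])
      moreover have "lookup (single u 1 * p) (u + m)
          = lookup (single u (1::'k)) u * lookup p m"
        by (rule lookup_mult_unique) (auto split: if_splits)
      then have "u + m \<in> keys (single u 1 * p)"
        using m by (simp add: in_keys_iff)
      ultimately show ?thesis by (auto simp: mspan_def u_def add.commute)
    qed
    then show "p \<in> mspan (torsion_monos E t)"
      using p by (auto simp: mspan_def torsion_monos_def)
  next
    have pA: "p \<in> A" using in_A[OF up p] .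
    assume "p \<in> mspan (torsion_monos E t)"
    then have "\<forall>m\<in>keys p. \<forall>v\<in>V. \<exists>k. m + single v k \<in> edge_monos V E (Suc t)"
      by (auto simp: mspan_def torsion_monos_def)
    then obtain k where k: "\<And>m v. m \<in> keys p \<Longrightarrow> v \<in> V \<Longrightarrow>
        m + single v (k m v) \<in> edge_monos V E (Suc t)" by metis
    \<comment> \<open>A common bound for the powers required by the finitely many terms and
      nodes.\<close>
    define B where "B = (\<Sum>m\<in>keys p. \<Sum>v\<in>V. k m v)"
    have B: "k m v \<le> B" if "m \<in> keys p" "v \<in> V" for m v
    proof -
      have "k m v \<le> (\<Sum>v\<in>V. k m v)" using that finite_V by (intro member_le_sum) auto
      also have "\<dots> \<le> B" unfolding B_def using that by (intro member_le_sum) auto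
      finally show ?thesis .
    qed
    have sum_in: "m + z \<in> edge_monos V E (Suc t)"
      if m: "m \<in> keys p" and z: "z \<in> ?M (Suc (card V * B))" for m z
    proof -
      \<comment> \<open>Pigeonhole: total degree above \<open>card V * B\<close> forces exponent at
        least \<open>B\<close> at some node.\<close>
      have "Suc (card V * B) \<le> sum (lookup z) V"
        using z finite_V by (intro edge_power_le_sum[of V "(\<lambda>v. {v}) ` V"]) (auto simp: edge_monos_def)
      then obtain v where v: "v \<in> V" "lookup z v \<ge> B"
        using sum_bounded_above[of V "lookup z" B] by (force simp: not_le)
      define u where "u = z - single v (k m v)"
      have eq: "z = single v (k m v) + u"
        using v B[OF m v(1)] by (intro poly_mapping_eqI) (auto simp: u_def lookup_add lookup_minus lookup_single when_def)
      have "z \<in> mons V" using z by (simp add: edge_monos_def)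
      then have "u \<in> mons V" unfolding eq by simp
      from upsetD[OF up k[OF m v(1)] this] show ?thesis by (simp add: eq add.assoc)
    qed
    show "\<exists>k. \<forall>a\<in>ext (?M k). a \<otimes>\<^bsub>R\<^esub> fr p s \<in> ext (edge_monos V E (Suc t))"
    proof (intro exI ballI)
      fix a assume "a \<in> ext (?M (Suc (card V * B)))"
      then obtain q r where q: "q \<in> mspan (?M (Suc (card V * B)))" "r \<in> S" "a = fr q r"
        by (auto simp: ext_def)
      have "p \<in> mspan (keys p)" by (simp add: mspan_def)
      then have "p * q \<in> mspan (edge_monos V E (Suc t))"
        using q(1) sum_in by (rule mspan_mult)
      then show "a \<otimes>\<^bsub>R\<^esub> fr p s \<in> ext (edge_monos V E (Suc t))"
        using q pA s in_A[OF upset_edge_monos q(1)] by (auto simp: mult_R ext_def mult.commute)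
    qed
  qed
  have "x \<in> ext (torsion_monos E t) \<longleftrightarrow> x \<in> ext (edge_monos V E t) \<and>
      (\<exists>k. \<forall>a\<in>ext (?M k). a \<otimes>\<^bsub>R\<^esub> x \<in> ext (edge_monos V E (Suc t)))" for x
  proof
    assume "x \<in> ext (torsion_monos E t)"
    then obtain p s where p: "p \<in> mspan (torsion_monos E t)" "s \<in> S" "x = fr p s" by (auto simp: ext_def)
    have p': "p \<in> mspan (edge_monos V E t)"
      using p(1) by (auto simp: mspan_def torsion_monos_def)
    show "x \<in> ext (edge_monos V E t) \<and>
      (\<exists>k. \<forall>a\<in>ext (?M k). a \<otimes>\<^bsub>R\<^esub> x \<in> ext (edge_monos V E (Suc t)))"
      using mem[OF p' p(2)] p p' by (auto simp: ext_def)
  next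
    assume H: "x \<in> ext (edge_monos V E t) \<and>
      (\<exists>k. \<forall>a\<in>ext (?M k). a \<otimes>\<^bsub>R\<^esub> x \<in> ext (edge_monos V E (Suc t)))"
    then obtain p s where p: "p \<in> mspan (edge_monos V E t)" "s \<in> S" "x = fr p s" by (auto simp: ext_def)
    have "p \<in> mspan (torsion_monos E t)" using mem[OF p(1,2)] H p(3) by simp
    then show "x \<in> ext (torsion_monos E t)" using p by (auto simp: ext_def)
  qed
  then show ?thesis unfolding max by blast
qed

lemma module_length_power_quotient:
  assumes E: "finite E" "\<forall>e\<in>E. e \<subseteq> V"
  shows "module_length R (local_cohomology_zero R (max_ideal R)
      (power_quotient R (ext (edge_monos V E 1)) t)) = enat (card (torsion_exps V E t))"
proof -
  have pow: "ideal_power R (max_ideal R) k \<subseteq> carrier R" for k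
    unfolding max_ideal_edges
    by (subst ideal_power_ext) (auto simp: finite_V ext_subset_carrier[OF upset_edge_monos, THEN subsetD])
  have "module_length R (local_cohomology_zero R (max_ideal R)
      (power_quotient R (ext (edge_monos V E 1)) t))
      = Sup {enat l |l. \<exists>D. ideal_chain R (ext (edge_monos V E (Suc t))) (ext (torsion_monos E t)) l D}"
    unfolding power_quotient_def ideal_power_ext[OF E]
    using edge_monos_Suc_subset_torsion[OF E(1)]
    by (intro R.module_length_torsion_quotient ideal_ext upset_edge_monos upset_torsion_monos
        ext_torsion_monos E pow) (simp add: ext_subset_iff upset_edge_monos upset_torsion_monos)
  also have "\<dots> = enat (card (torsion_monos E t - edge_monos V E (Suc t)))"
    using edge_monos_Suc_subset_torsion[OF E(1)] bij_betw_finite[OF bij_betw_torsion_exps[OF E(1)]]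
      finite_torsion_exps[OF finite_V E(1)]
    by (intro Sup_ideal_chains_ext upset_edge_monos upset_torsion_monos) simp_all
  also have "\<dots> = enat (card (torsion_exps V E t))"
    using bij_betw_same_card[OF bij_betw_torsion_exps[OF E(1)]] by simp
  finally show ?thesis .
qed

end

text \<open>The real number behind the j-multiplicity, computed from exponents alone, so that limits
  and products can be handled before passing to the extended reals.\<close>

definition torsion_mult :: "'v set \<Rightarrow> 'v set set \<Rightarrow> real" where
  "torsion_mult V E =
     fact (card V - 1) * lim (\<lambda>t. real (card (torsion_exps V E t)) / real t ^ (card V - 1))"

lemma torsion_limit:
  assumes "finite V" "V \<noteq> {}" "finite E" "\<forall>e\<in>E. e \<subseteq> V"
  shows "(\<lambda>t. real (card (torsion_exps V E t)) / real t ^ (card V - 1))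
    \<longlonglongrightarrow> torsion_mult V E / fact (card V - 1)"
  using convergent_torsion[OF assms] by (simp add: torsion_mult_def convergent_LIMSEQ_iff)

lemma is_hypergraph_finite_edges: "is_hypergraph G \<Longrightarrow> finite (edges G)"
  unfolding is_hypergraph_def by (meson Pow_iff finite_Pow_iff finite_subset subsetI)

lemma j_multiplicity_edge_ideal:
  fixes G :: "'v hypergraph"
  assumes G: "is_hypergraph G"
  shows "j_multiplicity (local_ring TYPE('k::field) (nodes G)) (edge_ideal TYPE('k) G)
    = ereal (torsion_mult (nodes G) (edges G))"
proof -
  have fin: "finite (nodes G)" "nodes G \<noteq> {}" "finite (edges G)" "\<forall>e\<in>edges G. e \<subseteq> nodes G"
    using G is_hypergraph_finite_edges[OF G] by (auto simp: is_hypergraph_def)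
  interpret local_polynomial_ring "nodes G" "TYPE('k)" by standard (rule fin)
  let ?n = "card (nodes G) - 1"
  let ?f = "\<lambda>t. real (card (torsion_exps (nodes G) (edges G) t))"
  have I: "edge_ideal TYPE('k) G = ext (edge_monos (nodes G) (edges G) 1)"
    unfolding edge_ideal_def fr_def[symmetric] by (rule edge_ideal_eq_ext[OF fin(3,4)])
  have "(\<lambda>t. ereal (?f t / real t ^ ?n)) \<longlonglongrightarrow> ereal (torsion_mult (nodes G) (edges G) / fact ?n)"
    using torsion_limit[OF fin] by simp
  \<comment> \<open>At t = 0 division in the reals and in the extended reals may disagree, so
    equality is claimed only for t > 0.\<close>
  moreover have "\<forall>\<^sub>F t in sequentially. ereal (?f t / real t ^ ?n)
      = ereal_of_enat (enat (card (torsion_exps (nodes G) (edges G) t))) / ereal (real t ^ ?n)"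
    using eventually_gt_at_top[of 0] by eventually_elim simp
  ultimately have "(\<lambda>t. ereal_of_enat (enat (card (torsion_exps (nodes G) (edges G) t))) / ereal (real t ^ ?n))
      \<longlonglongrightarrow> ereal (torsion_mult (nodes G) (edges G) / fact ?n)"
    by (rule Lim_transform_eventually)
  then show ?thesis
    unfolding j_multiplicity_def krull_dim_R the_enat.simps Let_def I module_length_power_quotient[OF fin(3,4)]
    by (subst limI, assumption) simp
qed

text \<open>With p = |V| - 1 and q = |V'| - 1 the union has n - 1 = p + q + 1, so the normalizations
  (n - 1)! absorb exactly the factorials of \<open>convolution_tendsto\<close>.\<close>

lemma torsion_mult_disjoint_union:
  assumes V: "finite V" "V \<noteq> {}" "finite E" "\<forall>e\<in>E. e \<noteq> {} \<and> e \<subseteq> V"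
    and V': "finite V'" "V' \<noteq> {}" "finite E'" "\<forall>e\<in>E'. e \<noteq> {} \<and> e \<subseteq> V'" and disj: "V \<inter> V' = {}"
  shows "torsion_mult (V \<union> V') (E \<union> E') = torsion_mult V E * torsion_mult V' E'"
proof -
  let ?p = "card V - 1" and ?q = "card V' - 1"
  have pos: "card V > 0" "card V' > 0" using V V' by (auto simp: card_gt_0_iff)
  have n: "card (V \<union> V') - 1 = ?p + ?q + 1"
    using card_Un_disjoint[OF V(1) V'(1) disj] pos by simp
  have "(\<lambda>t. (\<Sum>i\<le>t. real (card (torsion_exps V E i)) * real (card (torsion_exps V' E' (t - i))))
      / real t ^ (?p + ?q + 1)) \<longlonglongrightarrow> torsion_mult V E / fact ?p * (torsion_mult V' E' / fact ?q)
        * fact ?p * fact ?q / fact (?p + ?q + 1)"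
    using V V' by (intro convolution_tendsto torsion_limit) auto
  moreover have "(\<Sum>i\<le>t. real (card (torsion_exps V E i)) * real (card (torsion_exps V' E' (t - i))))
      = real (card (torsion_exps (V \<union> V') (E \<union> E') t))" for t
    using card_torsion_exps_disjoint_union[OF V(1,3,4) V'(1,3,4) disj] by simp
  ultimately have "(\<lambda>t. real (card (torsion_exps (V \<union> V') (E \<union> E') t)) / real t ^ (?p + ?q + 1))
      \<longlonglongrightarrow> torsion_mult V E * torsion_mult V' E' / fact (?p + ?q + 1)"
    by simp
  then show ?thesis
    unfolding torsion_mult_def[of "V \<union> V'"] n by (subst limI, assumption) simp
qed

section \<open>Connected components\<close>

definition adjacency :: "'v hypergraph \<Rightarrow> ('v \<times> 'v) set" where
  "adjacency G = {(x, y). \<exists>e\<in>edges G. x \<in> e \<and> y \<in> e}"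

text \<open>The path steps through the nodes shared by consecutive edges, one adjacency per edge.
  Edge lists are non-empty, hence the transitive closure without reflexivity.\<close>

lemma edge_path_imp_trancl: "edge_path G x es y \<Longrightarrow> (x, y) \<in> (adjacency G)\<^sup>+"
proof (induction es arbitrary: x)
  case (Cons e es)
  show ?case
  proof (cases "es = []")
    case True
    then show ?thesis using Cons.prems by (auto simp: edge_path_def adjacency_def)
  next
    case False
    have meet: "(e # es) ! i \<inter> (e # es) ! Suc i \<noteq> {}" if "i < length es" for i
      using Cons.prems that by (simp add: edge_path_def)
    from meet[of 0] obtain u where u: "u \<in> e" "u \<in> hd es" using False by (auto simp: hd_conv_nth)
    have "es ! i \<inter> es ! Suc i \<noteq> {}" if "Suc i < length es" for i
      using meet[of "Suc i"] that by simp
    then have "edge_path G u es y"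
      using Cons.prems False u by (simp add: edge_path_def)
    then have "(u, y) \<in> (adjacency G)\<^sup>+" by (rule Cons.IH)
    moreover have "(x, u) \<in> adjacency G" using Cons.prems u by (auto simp: edge_path_def adjacency_def)
    ultimately show ?thesis by (rule trancl_into_trancl2[rotated])
  qed
qed (simp add: edge_path_def)

lemma trancl_imp_edge_path: "(x, y) \<in> (adjacency G)\<^sup>+ \<Longrightarrow> \<exists>es. edge_path G x es y"
proof (induction rule: converse_trancl_induct)
  case (base x)
  then obtain e where "e \<in> edges G" "x \<in> e" "y \<in> e" by (auto simp: adjacency_def)
  then show ?case by (intro exI[of _ "[e]"]) (simp add: edge_path_def)
next
  case (step x u)
  then obtain es where es: "edge_path G u es y" by blast
  obtain e where e: "e \<in> edges G" "x \<in> e" "u \<in> e" using step(1) by (auto simp: adjacency_def)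
  have "edge_path G x (e # es) y"
    unfolding edge_path_def
  proof (intro conjI allI impI)
    fix i assume i: "Suc i < length (e # es)"
    show "(e # es) ! i \<inter> (e # es) ! Suc i \<noteq> {}"
      using es e i by (cases i) (auto simp: edge_path_def hd_conv_nth)
  qed (use es e in \<open>auto simp: edge_path_def\<close>)
  then show ?case by blast
qed

text \<open>Reflexivity of the closure matches the exemption of equal nodes in
  \<open>connected_hypergraph\<close>.\<close>

lemma connected_hypergraph_iff:
  "connected_hypergraph G \<longleftrightarrow> (\<forall>x\<in>nodes G. \<forall>y\<in>nodes G. (x, y) \<in> (adjacency G)\<^sup>*)"
proof -
  have "(\<exists>es. edge_path G x es y) \<longleftrightarrow> (x, y) \<in> (adjacency G)\<^sup>+" for x y
    by (metis edge_path_imp_trancl trancl_imp_edge_path)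
  then show ?thesis
    unfolding connected_hypergraph_def rtrancl_eq_or_trancl by (intro ball_cong refl) auto
qed

lemma sym_adjacency: "sym (adjacency G)"
  by (auto simp: sym_def adjacency_def)

text \<open>The reflexive closure keeps x itself, so an isolated node yields a component without
  edges.\<close>

definition component :: "'v hypergraph \<Rightarrow> 'v \<Rightarrow> 'v hypergraph" where
  "component G x = \<lparr>nodes = {y. (x, y) \<in> (adjacency G)\<^sup>*},
     edges = {e\<in>edges G. e \<subseteq> {y. (x, y) \<in> (adjacency G)\<^sup>*}}\<rparr>"

lemma component_eq:
  assumes "(x, y) \<in> (adjacency G)\<^sup>*"
  shows "component G x = component G y"
proof -
  have "(x, z) \<in> (adjacency G)\<^sup>* \<longleftrightarrow> (y, z) \<in> (adjacency G)\<^sup>*" for z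
    using assms sym_rtrancl[OF sym_adjacency, of G] by (meson rtrancl_trans symE)
  then show ?thesis by (simp add: component_def)
qed

lemma component_subhypergraph:
  assumes G: "is_hypergraph G" and x: "x \<in> nodes G"
  shows "subhypergraph (component G x) G"
proof -
  have "y \<in> nodes G" if "(x, y) \<in> (adjacency G)\<^sup>*" for y
    using that by (induction rule: rtrancl_induct) (use x G in \<open>auto simp: adjacency_def is_hypergraph_def\<close>)
  then have sub: "nodes (component G x) \<subseteq> nodes G" by (auto simp: component_def)
  have "finite (nodes (component G x))" by (rule finite_subset[OF sub]) (use G in \<open>simp add: is_hypergraph_def\<close>)
  moreover have "x \<in> nodes (component G x)" by (simp add: component_def)
  ultimately show ?thesis
    using sub G unfolding subhypergraph_def is_hypergraph_def by (auto simp: component_def)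
qed

text \<open>Every edge used by a path in G that starts in the component lies wholly inside it, so
  the path never leaves.\<close>

lemma component_connected: "connected_hypergraph (component G x)"
  unfolding connected_hypergraph_iff
proof (intro ballI)
  fix y z assume y: "y \<in> nodes (component G x)" and z: "z \<in> nodes (component G x)"
  have "(y, z) \<in> (adjacency G)\<^sup>*"
    using y z sym_rtrancl[OF sym_adjacency, of G] by (auto simp: component_def dest: symD intro: rtrancl_trans)
  then show "(y, z) \<in> (adjacency (component G x))\<^sup>*"
  proof (induction rule: rtrancl_induct)
    case (step u w)
    have xu: "(x, u) \<in> (adjacency G)\<^sup>*" using y step(1) by (auto simp: component_def)
    obtain e where e: "e \<in> edges G" "u \<in> e" "w \<in> e" using step(2) by (auto simp: adjacency_def)
    have "(x, v) \<in> (adjacency G)\<^sup>*" if "v \<in> e" for v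
    proof -
      have "(u, v) \<in> adjacency G" using e that by (auto simp: adjacency_def)
      with xu show ?thesis by (rule rtrancl_into_rtrancl)
    qed
    then have "(u, w) \<in> adjacency (component G x)"
      using e by (auto simp: adjacency_def component_def)
    with step.IH show ?case by (rule rtrancl_into_rtrancl)
  qed simp
qed

text \<open>Paths in H are paths in G, so H cannot extend past the class of x. This gives the
  maximality of components and shows that there are no others.\<close>

lemma connected_subhypergraph_component:
  assumes H: "subhypergraph H G" "connected_hypergraph H" "x \<in> nodes H"
  shows "nodes H \<subseteq> nodes (component G x) \<and> edges H \<subseteq> edges (component G x)"
proof -
  have sub: "adjacency H \<subseteq> adjacency G"
    using H(1) by (auto simp: adjacency_def subhypergraph_def)
  have nodes: "nodes H \<subseteq> {y. (x, y) \<in> (adjacency G)\<^sup>*}"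
    using H(2,3) rtrancl_mono[OF sub] by (auto simp: connected_hypergraph_iff)
  have edge: "e \<in> edges G \<and> e \<subseteq> nodes H" if "e \<in> edges H" for e
    using H(1) that by (auto simp: subhypergraph_def is_hypergraph_def)
  have "edges H \<subseteq> {e\<in>edges G. e \<subseteq> {y. (x, y) \<in> (adjacency G)\<^sup>*}}"
  proof (intro subsetI CollectI conjI)
    fix e assume e: "e \<in> edges H"
    show "e \<in> edges G" using edge[OF e] by simp
    fix y assume "y \<in> e"
    then have "y \<in> nodes H" using edge[OF e] by blast
    then show "(x, y) \<in> (adjacency G)\<^sup>*" using nodes by blast
  qed
  then show ?thesis using nodes by (simp add: component_def)
qed

lemma connected_components_eq:
  assumes G: "is_hypergraph G"
  shows "connected_components G = component G ` nodes G"
proof (intro equalityI subsetI)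
  fix H assume "H \<in> connected_components G"
  then have H: "subhypergraph H G" "connected_hypergraph H"
    "\<And>H'. subhypergraph H' G \<Longrightarrow> connected_hypergraph H' \<Longrightarrow> subhypergraph H H' \<Longrightarrow> H' = H"
    unfolding connected_components_def by blast+
  obtain x where x: "x \<in> nodes H" "x \<in> nodes G"
    using H(1) unfolding subhypergraph_def is_hypergraph_def by blast
  have "subhypergraph H (component G x)"
    using connected_subhypergraph_component[OF H(1,2) x(1)] H(1) by (simp add: subhypergraph_def)
  then have "component G x = H"
    by (rule H(3)[OF component_subhypergraph[OF G x(2)] component_connected])
  then show "H \<in> component G ` nodes G" using x(2) by blast
next
  fix H assume "H \<in> component G ` nodes G"
  then obtain x where x: "x \<in> nodes G" "H = component G x" by blast
  have max: "H' = H" if H': "subhypergraph H' G" "connected_hypergraph H'" "subhypergraph H H'" for H'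
  proof -
    have "x \<in> nodes H" by (simp add: x(2) component_def)
    then have "x \<in> nodes H'" using H'(3) by (auto simp: subhypergraph_def)
    from connected_subhypergraph_component[OF H'(1,2) this] H'(3)
    have "nodes H' = nodes H" "edges H' = edges H" by (auto simp: x(2) subhypergraph_def)
    then show ?thesis by simp
  qed
  have "subhypergraph H G" "connected_hypergraph H"
    unfolding x(2) by (rule component_subhypergraph[OF G x(1)], rule component_connected)
  then show "H \<in> connected_components G"
    unfolding connected_components_def by (auto intro: max)
qed

text \<open>The induction starts from a single member, because the formula for two parts asks for
  non-empty node sets on both sides.\<close>

lemma torsion_mult_Union:
  assumes "finite C" "C \<noteq> {}" "\<And>H. H \<in> C \<Longrightarrow> is_hypergraph H"
    and "\<And>H H'. H \<in> C \<Longrightarrow> H' \<in> C \<Longrightarrow> H \<noteq> H' \<Longrightarrow> nodes H \<inter> nodes H' = {}"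
  shows "torsion_mult (\<Union>H\<in>C. nodes H) (\<Union>H\<in>C. edges H)
    = (\<Prod>H\<in>C. torsion_mult (nodes H) (edges H))"
  using assms
proof (induction C rule: finite_ne_induct)
  case (insert H C)
  have hyp: "finite (nodes H')" "nodes H' \<noteq> {}" "finite (edges H')" "\<forall>e\<in>edges H'. e \<noteq> {} \<and> e \<subseteq> nodes H'"
    if "H' \<in> insert H C" for H'
    using insert.prems(1)[OF that] is_hypergraph_finite_edges by (auto simp: is_hypergraph_def)
  have "torsion_mult (nodes H \<union> (\<Union>H\<in>C. nodes H)) (edges H \<union> (\<Union>H\<in>C. edges H))
      = torsion_mult (nodes H) (edges H)
        * torsion_mult (\<Union>H\<in>C. nodes H) (\<Union>H\<in>C. edges H)"
  proof (rule torsion_mult_disjoint_union)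
    show "finite (\<Union>H\<in>C. nodes H)" "finite (\<Union>H\<in>C. edges H)" using insert.hyps(1) hyp by auto
    show "(\<Union>H\<in>C. nodes H) \<noteq> {}" using insert.hyps(2) hyp by auto
    show "\<forall>e\<in>\<Union>H\<in>C. edges H. e \<noteq> {} \<and> e \<subseteq> (\<Union>H\<in>C. nodes H)"
    proof
      fix e assume "e \<in> (\<Union>H\<in>C. edges H)"
      then obtain H' where H': "H' \<in> C" "e \<in> edges H'" by blast
      then have "e \<noteq> {} \<and> e \<subseteq> nodes H'" using hyp(4)[of H'] by simp
      then show "e \<noteq> {} \<and> e \<subseteq> (\<Union>H\<in>C. nodes H)" using H'(1) by blast
    qed
    show "nodes H \<inter> (\<Union>H\<in>C. nodes H) = {}" using insert.prems(2)[of H] insert.hyps(3) by auto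
    show "finite (nodes H)" "nodes H \<noteq> {}" "finite (edges H)" "\<forall>e\<in>edges H. e \<noteq> {} \<and> e \<subseteq> nodes H"
      by (rule hyp[OF insertI1])+
  qed
  then show ?case using insert by simp
qed simp

theorem proposition5p3:
  fixes G :: "'v hypergraph"
  assumes "is_hypergraph G"
  shows "j_multiplicity (local_ring TYPE('k::field) (nodes G)) (edge_ideal TYPE('k) G) =
         (\<Prod>H\<in>connected_components G.
            j_multiplicity (local_ring TYPE('k) (nodes H)) (edge_ideal TYPE('k) H))"
proof -
  let ?C = "connected_components G"
  note C = connected_components_eq[OF assms]
  have hyp: "is_hypergraph H" if "H \<in> ?C" for H
    using that component_subhypergraph[OF assms] by (auto simp: C subhypergraph_def)
  have fin: "finite ?C" "?C \<noteq> {}" using assms by (auto simp: C is_hypergraph_def)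
  have disj: "nodes H \<inter> nodes H' = {}" if H: "H \<in> ?C" "H' \<in> ?C" "H \<noteq> H'" for H H'
  proof (rule ccontr)
    obtain x x' where x: "H = component G x" "H' = component G x'" using H by (auto simp: C)
    assume "nodes H \<inter> nodes H' \<noteq> {}"
    then obtain z where "(x, z) \<in> (adjacency G)\<^sup>*" "(x', z) \<in> (adjacency G)\<^sup>*"
      by (auto simp: x component_def)
    then show False using H(3) component_eq[of x z G] component_eq[of x' z G] x by simp
  qed
  have nodes: "(\<Union>H\<in>?C. nodes H) = nodes G"
  proof
    show "(\<Union>H\<in>?C. nodes H) \<subseteq> nodes G"
      using component_subhypergraph[OF assms] by (auto simp: C subhypergraph_def)
    show "nodes G \<subseteq> (\<Union>H\<in>?C. nodes H)" by (auto simp: C component_def)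
  qed
  have edges: "(\<Union>H\<in>?C. edges H) = edges G"
  proof
    show "(\<Union>H\<in>?C. edges H) \<subseteq> edges G" by (auto simp: C component_def)
    \<comment> \<open>All nodes of an edge are adjacent, so the edge lies in the component of any
      one of them.\<close>
    show "edges G \<subseteq> (\<Union>H\<in>?C. edges H)"
    proof
      fix e assume e: "e \<in> edges G"
      then obtain x where x: "x \<in> e" "x \<in> nodes G" using assms unfolding is_hypergraph_def by blast
      have "e \<subseteq> {y. (x, y) \<in> (adjacency G)\<^sup>*}"
        using e x(1) by (auto simp: adjacency_def)
      then have "e \<in> edges (component G x)" using e by (simp add: component_def)
      then show "e \<in> (\<Union>H\<in>?C. edges H)" using x(2) by (auto simp: C)
    qed
  qed
  \<comment> \<open>The product formula is applied to real numbers and only then embedded into the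
    extended reals.\<close>
  have "j_multiplicity (local_ring TYPE('k) (nodes G)) (edge_ideal TYPE('k) G)
      = ereal (\<Prod>H\<in>?C. torsion_mult (nodes H) (edges H))"
    using j_multiplicity_edge_ideal[OF assms] torsion_mult_Union[OF fin hyp disj]
    by (simp add: nodes edges)
  also have "\<dots> = (\<Prod>H\<in>?C. ereal (torsion_mult (nodes H) (edges H)))"
    by (rule prod_ereal[symmetric])
  also have "\<dots> = (\<Prod>H\<in>?C. j_multiplicity (local_ring TYPE('k) (nodes H)) (edge_ideal TYPE('k) H))"
    using hyp by (intro prod.cong refl j_multiplicity_edge_ideal[symmetric])
  finally show ?thesis .
qed

end
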